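(* For all $(n,m)\in\mathbb{Z}^2$ and all $\xi\in(0,\infty)$, $$P_{-\frac34-m}^{-\frac13-n}(\coth\xi)=\left[(-1)^n2^{5/4-2m-3n}\,3^{-3/8}\left(\tfrac14\right)_m\left(\tfrac{13}{12}\right)_{m+n}^{-1}\Gamma(\tfrac43)^{-1}\right](\sinh\xi)^{1/4-m}$$ $$\qquad\times\Bigl[(-1)^n\sqrt{\sqrt3-1}\;A_+^{1/4+3m+3n}\,r^m_n(-A_-/A_+)-(-1)^m\sqrt{\sqrt3+1}\;A_-^{1/4+3m+3n}\,r^m_n(-A_+/A_-)\Bigr],$$ $$P_{-\frac34-m}^{\frac13+n}(\coth\xi)=\left[(-1)^n2^{-1/4-2m-3n}\,3^{-3/8}\left(\tfrac14\right)_m\left(\tfrac{5}{12}\right)_{m-n}^{-1}\Gamma(\tfrac23)^{-1}\right](\sinh\xi)^{1/4-m}$$ $$\qquad\times\Bigl[(-1)^n\sqrt{\sqrt3+1}\;A_+^{1/4+3m+3n}\,r^m_n(-A_-/A_+)+(-1)^m\sqrt{\sqrt3-1}\;A_-^{1/4+3m+3n}\,r^m_n(-A_+/A_-)\Bigr],$$ where $P_\nu^\mu$ is the associated Legendre function of the first kind, $r^m_n$ are the octahedral functions defined in the context, and $A_\pm=A_\pm(\xi)=\pm\cosh(\xi/3)+\sqrt{\frac{4\cosh^2(\xi/3)-1}{3}}>0$.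
   Context: For $z>1$, $P_\nu^\mu(z)=\frac1{\Gamma(1-\mu)}\left(\frac{z+1}{z-1}\right)^{\mu/2}{}_2F_1\!\left(-\nu,\nu+1;1-\mu;\frac{1-z}2\right)$, with ${}_2F_1$ the (analytically continued) Gauss function. The rising factorial is extended to all integers $k$: $(d)_k=d(d+1)\cdots(d+k-1)$ for $k\ge0$ and $(d)_k=[(d-k')\cdots(d-1)]^{-1}$ for $k=-k'\le0$. Octahedral functions: let $p_{\rm v}(u)=u(1-u)^4$, $p_{\rm e}(u)=(1+u)(1-34u+u^2)$, $p_{\rm f}(u)=1+14u+u^2$, and $R(u)=-108\,p_{\rm v}(u)/p_{\rm e}(u)^2=1-p_{\rm f}(u)^3/p_{\rm e}(u)^2$. For $(n,m)\in\mathbb{Z}^2$, $r^m_n$ is the rational function of $u$ that on a neighborhood of $u=0$ satisfies $${}_2F_1\!\left(-\tfrac1{24}-\tfrac m2-\tfrac n2,\ \tfrac{11}{24}-\tfrac m2-\tfrac n2;\ \tfrac34-m;\ R(u)\right)=p_{\rm e}(u)^{-1/12-m-n}\,r^m_n(u)$$ (with powers of $p_{\rm e}(u)$ equal to $1$ at $u=0$). *)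

theory Defs
  imports "HOL-Complex_Analysis.Complex_Analysis"
begin

section \<open>The Gauss hypergeometric function\<close>

text \<open>
  The value at \<open>z\<close> is the analytic continuation of the Gauss series along the straight segment from
  \<open>0\<close> to \<open>z\<close>: some holomorphic function on an open set that is star-shaped about \<open>0\<close> and contains
  \<open>z\<close> has the Gauss series as its expansion at \<open>0\<close>. For \<open>z\<close> outside the cut \<open>[1, \<infinity>)\<close> this is
  the principal branch; see \<open>hyp2f1_eqI\<close> (independence of the choices), \<open>hyp2f1_slit_eqI\<close> and
  \<open>hyp2f1_eq_series\<close>.
\<close>

definition hyp2f1 :: "complex \<Rightarrow> complex \<Rightarrow> complex \<Rightarrow> complex \<Rightarrow> complex" where
  "hyp2f1 a b c z =
     (THE w. \<exists>S f. open S \<and> 0 \<in> S \<and> z \<in> S \<and> (\<forall>x\<in>S. closed_segment 0 x \<subseteq> S) \<and>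
                   f holomorphic_on S \<and> f has_fps_expansion fps_hypergeo [a, b] [c] 1 \<and> w = f z)"

lemma hyp2f1_eqI:
  assumes S: "open S" "0 \<in> S" "z \<in> S" "\<And>x. x \<in> S \<Longrightarrow> closed_segment 0 x \<subseteq> S"
    and f: "f holomorphic_on S" "f has_fps_expansion fps_hypergeo [a, b] [c] 1"
  shows "hyp2f1 a b c z = f z"
  unfolding hyp2f1_def
proof (rule the_equality)
  show "\<exists>S g. open S \<and> 0 \<in> S \<and> z \<in> S \<and> (\<forall>x\<in>S. closed_segment 0 x \<subseteq> S) \<and>
              g holomorphic_on S \<and> g has_fps_expansion fps_hypergeo [a, b] [c] 1 \<and> f z = g z"
    using assms by blast
next
  fix w
  assume "\<exists>S g. open S \<and> 0 \<in> S \<and> z \<in> S \<and> (\<forall>x\<in>S. closed_segment 0 x \<subseteq> S) \<and>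
                g holomorphic_on S \<and> g has_fps_expansion fps_hypergeo [a, b] [c] 1 \<and> w = g z"
  then obtain T g where T: "open T" "0 \<in> T" "z \<in> T" "\<And>x. x \<in> T \<Longrightarrow> closed_segment 0 x \<subseteq> T"
    and g: "g holomorphic_on T" "g has_fps_expansion fps_hypergeo [a, b] [c] 1" and w: "w = g z"
    by blast
  define U where "U = S \<inter> T"
  have U: "open U" "0 \<in> U" "z \<in> U" using S T by (auto simp: U_def)
  have "starlike U"
    unfolding starlike_def using S T by (intro bexI[of _ 0]) (auto simp: U_def)
  then have conn: "connected U" by (rule starlike_imp_connected)
  have "eventually (\<lambda>x. f x = g x) (nhds 0)"
    using f(2) g(2) unfolding has_fps_expansion_def
    by (auto elim: eventually_elim2)
  then obtain V where V: "open V" "0 \<in> V" "\<And>x. x \<in> V \<Longrightarrow> f x = g x"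
    by (auto simp: eventually_nhds)
  have "f z = g z"
  proof (rule analytic_continuation_open[of "U \<inter> V" U f g])
    show "U \<inter> V \<noteq> {}" using U V by blast
    show "f holomorphic_on U" "g holomorphic_on U"
      using f g by (auto simp: U_def intro: holomorphic_on_subset)
  qed (use U V conn in auto)
  then show "w = f z" using w by simp
qed

lemma hyp2f1_slit_eqI:
  assumes "f holomorphic_on - (of_real ` {1..})" "f has_fps_expansion fps_hypergeo [a, b] [c] 1"
    and "z \<notin> of_real ` {1..}"
  shows "hyp2f1 a b c z = f z"
proof (rule hyp2f1_eqI)
  have "(of_real :: real \<Rightarrow> complex) ` {1..} = {z. Re z \<ge> 1} \<inter> {z. Im z = 0}"
    by (auto simp: complex_eq_iff image_iff)
  then have "closed ((of_real :: real \<Rightarrow> complex) ` {1..})"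
    by (simp add: closed_Int closed_halfspace_Re_ge closed_Collect_eq continuous_on_Im)
  then show "open (- ((of_real :: real \<Rightarrow> complex) ` {1..}))" by auto
  fix x :: complex assume x: "x \<in> - (of_real ` {1..})"
  show "closed_segment 0 x \<subseteq> - (of_real ` {1..})"
  proof safe
    fix t :: real assume "complex_of_real t \<in> closed_segment 0 x" "1 \<le> t"
    then obtain s where s: "0 \<le> s" "s \<le> 1" "complex_of_real t = s *\<^sub>R x"
      by (auto simp: in_segment)
    with \<open>1 \<le> t\<close> have "s > 0" by (cases "s = 0") auto
    then have "x = complex_of_real (t / s)" using s by (simp add: scaleR_conv_of_real)
    moreover have "t / s \<ge> 1" using s \<open>s > 0\<close> \<open>1 \<le> t\<close> by (simp add: field_simps)
    ultimately show False using x by blast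
  qed
qed (use assms in \<open>auto simp: image_iff complex_eq_iff\<close>)

lemma hyp2f1_eq_series:
  assumes "norm z < fps_conv_radius (fps_hypergeo [a, b] [c] 1)"
  shows "hyp2f1 a b c z =
           (\<Sum>k. pochhammer a k * pochhammer b k / (pochhammer c k * fact k) * z ^ k)"
proof -
  let ?F = "fps_hypergeo [a, b] [c] (1 :: complex)"
  have "hyp2f1 a b c z = eval_fps ?F z"
  proof (rule hyp2f1_eqI)
    have pos: "fps_conv_radius ?F > 0" using assms by (metis ereal_less_eq(5) le_less_trans norm_ge_zero)
    then show "eval_fps ?F has_fps_expansion ?F" by (simp add: has_fps_expansion_def)
    show "0 \<in> eball 0 (fps_conv_radius ?F)" using pos by (simp add: in_eball_iff zero_ereal_def)
    show "z \<in> eball 0 (fps_conv_radius ?F)" using assms by (simp add: in_eball_iff)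
    show "eval_fps ?F holomorphic_on eball 0 (fps_conv_radius ?F)"
      by (intro holomorphic_intros) auto
    fix x :: complex assume x: "x \<in> eball 0 (fps_conv_radius ?F)"
    show "closed_segment 0 x \<subseteq> eball 0 (fps_conv_radius ?F)"
    proof
      fix y assume "y \<in> closed_segment 0 x"
      then have "norm y \<le> norm x"
        by (auto simp: in_segment mult_left_le_one_le)
      then show "y \<in> eball 0 (fps_conv_radius ?F)"
        using x by (metis dist_0_norm ereal_less_eq(3) in_eball_iff le_less_trans)
    qed
  qed auto
  then show ?thesis by (simp add: eval_fps_def)
qed

section \<open>The associated Legendre function of the first kind\<close>

text \<open>Meant for \<open>z > 1\<close>, where the base of the power is a positive real.\<close>

definition legendre_P :: "complex \<Rightarrow> complex \<Rightarrow> real \<Rightarrow> complex" where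
  "legendre_P \<nu> \<mu> z =
     1 / Gamma (1 - \<mu>) * of_real ((z + 1) / (z - 1)) powr (\<mu> / 2) *
     hyp2f1 (- \<nu>) (\<nu> + 1) (1 - \<mu>) (of_real ((1 - z) / 2))"

section \<open>Rising factorials with integer index\<close>

definition rising_factorial :: "'a :: field_char_0 \<Rightarrow> int \<Rightarrow> 'a" where
  "rising_factorial d k =
     (if k \<ge> 0 then pochhammer d (nat k) else inverse (\<Prod>i = 1..nat (- k). d - of_nat i))"

section \<open>Octahedral functions\<close>

definition p_v :: "complex \<Rightarrow> complex" where "p_v u = u * (1 - u) ^ 4"
definition p_e :: "complex \<Rightarrow> complex" where "p_e u = (1 + u) * (1 - 34 * u + u ^ 2)"
definition p_f :: "complex \<Rightarrow> complex" where "p_f u = 1 + 14 * u + u ^ 2"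

definition oct_R :: "complex \<Rightarrow> complex" where "oct_R u = -108 * p_v u / p_e u ^ 2"

lemma oct_R_altdef: "p_e u \<noteq> 0 \<Longrightarrow> oct_R u = 1 - p_f u ^ 3 / p_e u ^ 2"
  by (simp add: oct_R_def divide_simps) (simp add: p_v_def p_e_def p_f_def, algebra)

text \<open>
  The rational function is given in lowest terms as \<open>p / q\<close>, so its value \<open>poly p u / poly q u\<close> at
  \<open>u\<close> is determined (lemma \<open>octahedral_r_eqI\<close>); at a pole it is \<open>0\<close> by the division convention.
  Since \<open>p_e 0 = 1\<close>, the principal power of \<open>p_e\<close> is the branch equal to \<open>1\<close> at \<open>0\<close>.
\<close>

definition is_octahedral :: "int \<Rightarrow> int \<Rightarrow> complex poly \<Rightarrow> complex poly \<Rightarrow> bool" where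
  "is_octahedral m n p q \<longleftrightarrow>
     coprime p q \<and> q \<noteq> 0 \<and>
     (\<forall>\<^sub>F u in nhds 0.
        hyp2f1 (-1/24 - of_int m / 2 - of_int n / 2) (11/24 - of_int m / 2 - of_int n / 2)
               (3/4 - of_int m) (oct_R u) =
        p_e u powr (-1/12 - of_int m - of_int n) * (poly p u / poly q u))"

text \<open>\<open>octahedral_r m n\<close> has upper index \<open>m\<close> and lower index \<open>n\<close>.\<close>

definition octahedral_r :: "int \<Rightarrow> int \<Rightarrow> complex \<Rightarrow> complex" where
  "octahedral_r m n u = (THE w. \<exists>p q. is_octahedral m n p q \<and> w = poly p u / poly q u)"

lemma eventually_poly_nonzero:
  fixes p :: "complex poly"
  assumes "p \<noteq> 0"
  shows "\<forall>\<^sub>F u in at 0. poly p u \<noteq> 0"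
proof -
  have "open (- ({u. poly p u = 0} - {0}))"
    using poly_roots_finite[OF assms] by (intro open_Compl finite_imp_closed) auto
  then show ?thesis
    unfolding eventually_at_topological by (intro exI[of _ "- ({u. poly p u = 0} - {0})"]) auto
qed

lemma octahedral_r_eqI:
  assumes "is_octahedral m n p q"
  shows "octahedral_r m n u = poly p u / poly q u"
  unfolding octahedral_r_def
proof (rule the_equality)
  show "\<exists>p' q'. is_octahedral m n p' q' \<and> poly p u / poly q u = poly p' u / poly q' u"
    using assms by blast
next
  have no_common: "\<not> (poly p u = 0 \<and> poly q u = 0)" if "coprime p q" for p q :: "complex poly"
  proof
    assume "poly p u = 0 \<and> poly q u = 0"
    then have "is_unit [:-u, 1:]"
      using that coprime_common_divisor[of p q "[:-u, 1:]"] by (simp add: poly_eq_0_iff_dvd)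
    then show False by (simp add: is_unit_iff_degree)
  qed
  fix w assume "\<exists>p' q'. is_octahedral m n p' q' \<and> w = poly p' u / poly q' u"
  then obtain p' q' where o: "is_octahedral m n p' q'" and w: "w = poly p' u / poly q' u" by blast
  have "p_e 0 \<noteq> 0" by (simp add: p_e_def)
  moreover have "isCont p_e 0" unfolding p_e_def by (intro continuous_intros)
  ultimately have "\<forall>\<^sub>F u in nhds 0. p_e u \<noteq> 0"
    by (simp add: eventually_nhds_conv_at isCont_def tendsto_imp_eventually_ne)
  moreover have "\<forall>\<^sub>F u in nhds 0.
      p_e u powr (-1/12 - of_int m - of_int n) * (poly p u / poly q u) =
      p_e u powr (-1/12 - of_int m - of_int n) * (poly p' u / poly q' u)"
    using assms[unfolded is_octahedral_def, THEN conjunct2, THEN conjunct2]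
      o[unfolded is_octahedral_def, THEN conjunct2, THEN conjunct2]
    by eventually_elim simp
  ultimately have "\<forall>\<^sub>F u in nhds 0. poly p u / poly q u = poly p' u / poly q' u"
    by eventually_elim (metis mult_left_cancel powr_eq_0_iff)
  then have "\<forall>\<^sub>F u in at 0. poly p u / poly q u = poly p' u / poly q' u"
    by (simp add: eventually_nhds_conv_at)
  moreover have "\<forall>\<^sub>F u in at 0. poly q u \<noteq> 0" "\<forall>\<^sub>F u in at 0. poly q' u \<noteq> 0"
    using assms o by (auto simp: is_octahedral_def intro: eventually_poly_nonzero)
  ultimately have ev: "\<forall>\<^sub>F u in at 0. poly (p * q' - p' * q) u = 0"
    by eventually_elim (simp add: field_simps)
  have "p * q' - p' * q = 0"
  proof (rule ccontr)
    assume "p * q' - p' * q \<noteq> 0"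
    from eventually_conj[OF ev eventually_poly_nonzero[OF this]] show False by simp
  qed
  then have "poly p u * poly q' u = poly p' u * poly q u"
    by (metis poly_mult eq_iff_diff_eq_0)
  then show "w = poly p u / poly q u"
    using no_common[of p q] no_common[of p' q'] assms o unfolding w is_octahedral_def
    by (cases "poly q u = 0"; cases "poly q' u = 0") (auto simp: field_simps)
qed

section \<open>The remaining notation\<close>

definition coth :: "real \<Rightarrow> real" where "coth x = cosh x / sinh x"

definition A_plus :: "real \<Rightarrow> real" where
  "A_plus \<xi> = cosh (\<xi> / 3) + sqrt ((4 * cosh (\<xi> / 3) ^ 2 - 1) / 3)"

definition A_minus :: "real \<Rightarrow> real" where
  "A_minus \<xi> = - cosh (\<xi> / 3) + sqrt ((4 * cosh (\<xi> / 3) ^ 2 - 1) / 3)"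

end

theory Submission
  imports Defs
begin

text \<open>
  For neighbouring \<open>(m, n)\<close> the hypergeometric parameters differ by integers once \<open>a\<close> and \<open>b\<close> are
  exchanged, so each neighbour is a first-order differential expression in the given function.
  Starting from \<open>r\<^sup>0\<^sub>0 = 1\<close>, these ladder operators show that every \<open>r\<^sup>m\<^sub>n\<close> exists. The points
  \<open>u = - A\<^sub>- / A\<^sub>+\<close> and \<open>u = - A\<^sub>+ / A\<^sub>-\<close> both satisfy \<open>R u = tanh\<^sup>2 \<xi>\<close>, and along either of them
  \<open>sinh \<xi> powr (1/4 - m) * A powr (1/4 + 3 m + 3 n) * r\<^sup>m\<^sub>n\<close> (up to sign) obeys the same ladder
  relations in \<open>\<xi>\<close> as the suitably normalised Legendre functions of degree \<open>-3/4 - m\<close> and order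
  \<open>\<mp>(1/3 + n)\<close>. Hence only \<open>m = n = 0\<close> remains. There, after removing the factor \<open>exp (\<xi> / 3)\<close>, both
  sides as functions of \<open>w = exp (- 2 \<xi> / 3)\<close> solve \<open>k'' = - 27/16 w / (1 - w\<^sup>3)\<^sup>2 k\<close>, for which \<open>w = 0\<close>
  (that is, \<open>\<xi> = \<infinity>\<close>) is an ordinary point, so comparing \<open>k\<close> and \<open>k'\<close> at \<open>w = 0\<close> suffices.
\<close>

section \<open>Contiguous relations for the Gauss series\<close>

declare fps_hypergeo_nth [simp del]

abbreviation hyp_fps :: "complex \<Rightarrow> complex \<Rightarrow> complex \<Rightarrow> complex fps" where
  "hyp_fps a b c \<equiv> fps_hypergeo [a, b] [c] 1"

abbreviation hyp_ser :: "complex \<Rightarrow> complex \<Rightarrow> complex \<Rightarrow> complex \<Rightarrow> complex" where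
  "hyp_ser a b c \<equiv> eval_fps (hyp_fps a b c)"

abbreviation hyp_ser' :: "complex \<Rightarrow> complex \<Rightarrow> complex \<Rightarrow> complex \<Rightarrow> complex" where
  "hyp_ser' a b c \<equiv> eval_fps (fps_deriv (hyp_fps a b c))"

lemma pochhammer_nonzero: "pochhammer c k \<noteq> 0" if "c \<notin> \<int>" for c :: complex
  using that by (auto simp: pochhammer_eq_0_iff)

lemma add_nat_nonzero: "c + of_nat k \<noteq> 0" if "c \<notin> \<int>" for c :: complex
  using that by (metis Ints_minus Ints_of_nat add.inverse_inverse add_eq_0_iff)

lemma fact_Suc_factored: "fact k + of_nat k * fact k = (fact k * (1 + of_nat k) :: complex)"
  by (simp add: algebra_simps)

lemma hyp_fps_conv_radius:
  assumes "a \<notin> \<int>" "b \<notin> \<int>" "c \<notin> \<int>"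
  shows "fps_conv_radius (hyp_fps a b c) = 1"
  unfolding fps_conv_radius_def
proof (rule conv_radius_ratio_limit_nonzero[of _ 1])
  have *: "(\<lambda>n. (c + of_nat n) / (a + of_nat n)) \<longlonglongrightarrow> 1" if "a \<notin> \<int>" for a c :: complex
  proof -
    have "(\<lambda>n. (c - a) / (a + of_nat n)) \<longlonglongrightarrow> 0" for a c :: complex
      by (intro tendsto_divide_0[OF tendsto_const] tendsto_add_filterlim_at_infinity[OF tendsto_const] tendsto_of_nat)
    then have "(\<lambda>n. 1 + (c - a) / (a + of_nat n)) \<longlonglongrightarrow> 1 + 0" for a c :: complex
      by (intro tendsto_add tendsto_const)
    from this[of c a] show ?thesis
      using add_nat_nonzero[OF that] by (simp add: field_simps)
  qed
  have "(\<lambda>n. norm ((c + of_nat n) / (a + of_nat n) * ((1 + of_nat n) / (b + of_nat n)))) \<longlonglongrightarrow> norm (1 * 1 :: complex)"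
    by (intro tendsto_norm tendsto_mult * assms)
  also have "(\<lambda>n. norm ((c + of_nat n) / (a + of_nat n) * ((1 + of_nat n) / (b + of_nat n)))) =
    (\<lambda>n. norm (fps_nth (hyp_fps a b c) n) / norm (fps_nth (hyp_fps a b c) (Suc n)))"
    using assms by (intro ext, subst norm_divide [symmetric], simp add: fps_hypergeo_nth pochhammer_Suc
        pochhammer_nonzero add_nat_nonzero fact_Suc_factored)
  finally show "(\<lambda>n. norm (fps_nth (hyp_fps a b c) n) / norm (fps_nth (hyp_fps a b c) (Suc n))) \<longlonglongrightarrow> 1" by simp
qed auto

lemma fps_linear_nth:
  fixes F :: "complex fps"
  shows "fps_nth (fps_of_poly [:p:] * F) k = p * fps_nth F k"
    and "fps_nth (fps_of_poly [:p, q:] * F) 0 = p * fps_nth F 0"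
    and "fps_nth (fps_of_poly [:p, q:] * F) (Suc k) = p * fps_nth F (Suc k) + q * fps_nth F k"
    and "fps_nth (fps_of_poly [:p, q, r:] * F) 0 = p * fps_nth F 0"
    and "fps_nth (fps_of_poly [:0, q, r:] * fps_deriv F) (Suc k) =
           q * (1 + of_nat k) * fps_nth F (Suc k) + r * of_nat k * fps_nth F k"
    and "fps_nth (fps_of_poly [:0, q, r:] * fps_deriv (fps_deriv F)) k =
           q * of_nat k * (of_nat k + 1) * fps_nth F (Suc k) + r * of_nat k * (of_nat k - 1) * fps_nth F k"
proof -
  have expand: "fps_of_poly [:p, q, r:] * F = fps_const p * F + fps_X * (fps_const q * F + fps_X * (fps_const r * F))"
    for p q r and F :: "complex fps"
    by (simp add: fps_of_poly_pCons algebra_simps)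
  show "fps_nth (fps_of_poly [:0, q, r:] * fps_deriv F) (Suc k) =
           q * (1 + of_nat k) * fps_nth F (Suc k) + r * of_nat k * fps_nth F k"
    by (cases k; simp add: expand; simp add: algebra_simps)
  show "fps_nth (fps_of_poly [:0, q, r:] * fps_deriv (fps_deriv F)) k =
           q * of_nat k * (of_nat k + 1) * fps_nth F (Suc k) + r * of_nat k * (of_nat k - 1) * fps_nth F k"
  proof (cases k)
    case (Suc j)
    then show ?thesis by (cases j; simp add: expand; simp add: algebra_simps)
  qed (simp add: expand)
qed (simp_all add: fps_of_poly_pCons distrib_right mult.assoc)

abbreviation fps_first_order :: "complex poly \<Rightarrow> complex poly \<Rightarrow> complex fps \<Rightarrow> complex fps" where
  "fps_first_order \<alpha> \<beta> F \<equiv> fps_of_poly \<alpha> * fps_deriv F + fps_of_poly \<beta> * F"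

lemma eval_fps_first_order:
  fixes F G :: "complex fps"
  assumes "G = fps_first_order \<alpha> \<beta> F" "fps_conv_radius F \<ge> 1" "norm z < 1"
  shows "eval_fps G z = poly \<alpha> z * eval_fps (fps_deriv F) z + poly \<beta> z * eval_fps F z"
proof -
  have z: "ereal (norm z) < 1" using assms(3) by simp
  have *: "ereal (norm z) < fps_conv_radius F" "ereal (norm z) < fps_conv_radius (fps_deriv F)"
    using z assms(2) fps_conv_radius_deriv[of F] less_le_trans order_trans by blast+
  have "ereal (norm z) < fps_conv_radius (fps_of_poly \<alpha> * fps_deriv F)"
       "ereal (norm z) < fps_conv_radius (fps_of_poly \<beta> * F)"
    using fps_conv_radius_mult[of "fps_of_poly \<alpha>" "fps_deriv F"] fps_conv_radius_mult[of "fps_of_poly \<beta>" F] *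
    by (auto intro: less_le_trans)
  then show ?thesis using * by (simp add: assms(1) eval_fps_add eval_fps_mult)
qed

lemma fps_eqI_Suc:
  fixes F G :: "complex fps"
  assumes "fps_nth F 0 = fps_nth G 0" "\<And>k. fps_nth F (Suc k) = fps_nth G (Suc k)"
  shows "F = G"
  using assms by (metis fps_ext not0_implies_Suc)

lemma pochhammer_up: "a * pochhammer (a + 1) k = pochhammer a k * (a + of_nat k)" for a :: complex
  by (metis pochhammer_Suc pochhammer_rec)

lemma pochhammer_down: "pochhammer (a - 1) (Suc k) = (a - 1) * pochhammer a k" for a :: complex
  by (simp add: pochhammer_rec)

context
  fixes a b c :: complex and h :: "nat \<Rightarrow> complex"
  assumes c: "c \<notin> \<int>"
  defines "h \<equiv> fps_nth (hyp_fps a b c)"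
begin

lemma c_facts: "c \<noteq> 0" "c - 1 \<noteq> 0" "c + of_nat k \<noteq> 0" "c + (1 + of_nat k) \<noteq> 0" "1 + of_nat k \<noteq> (0::complex)"
  "2 + of_nat k \<noteq> (0::complex)" "pochhammer c k \<noteq> 0" "pochhammer (c - 1) k \<noteq> 0" "pochhammer (c + 1) k \<noteq> 0"
proof -
  have "of_nat (Suc k) \<noteq> (0::complex)" "of_nat (Suc (Suc k)) \<noteq> (0::complex)" by (simp_all del: of_nat_Suc)
  then show "1 + of_nat k \<noteq> (0::complex)" "2 + of_nat k \<noteq> (0::complex)" by simp_all
  have "c - 1 \<notin> \<int>" "c + 1 \<notin> \<int>"
    using c Ints_add[of "c - 1" 1] Ints_diff[of "c + 1" 1] by auto
  moreover from this show "c - 1 \<noteq> 0" by (metis Ints_0)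
  ultimately show "pochhammer c k \<noteq> 0" "pochhammer (c - 1) k \<noteq> 0" "pochhammer (c + 1) k \<noteq> 0"
    using c by (auto simp: pochhammer_nonzero simp del: right_minus_eq)
  show "c + of_nat k \<noteq> 0" "c + (1 + of_nat k) \<noteq> 0" "c \<noteq> 0"
    using add_nat_nonzero[OF c, of k] add_nat_nonzero[OF c, of "Suc k"] c by auto
qed

lemma h_Suc: "h (Suc k) = h k * ((a + of_nat k) * (b + of_nat k) / ((c + of_nat k) * (1 + of_nat k)))"
  by (simp add: h_def fps_hypergeo_nth pochhammer_Suc c_facts fact_Suc_factored) (simp add: mult_ac)

lemma hyp_fps_raise:
  assumes "a \<noteq> 0"
  shows "hyp_fps (a + 1) b c = fps_first_order [:0, 1/a:] [:1:] (hyp_fps a b c)" (is "_ = ?rhs")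
proof (rule fps_eqI_Suc)
  fix k
  have "pochhammer (a + 1) (Suc k) = pochhammer a (Suc k) * (a + of_nat (Suc k)) / a"
    using pochhammer_up[of a "Suc k"] assms by (simp add: field_simps)
  then have "fps_nth (hyp_fps (a + 1) b c) (Suc k) = h (Suc k) * (a + of_nat (Suc k)) / a"
    by (simp add: h_def fps_hypergeo_nth mult_ac)
  also have "\<dots> = 1/a * of_nat (Suc k) * h (Suc k) + h (Suc k)"
    using assms by (simp add: field_simps)
  finally show "fps_nth (hyp_fps (a + 1) b c) (Suc k) = fps_nth ?rhs (Suc k)"
    unfolding fps_add_nth fps_linear_nth h_def[symmetric] by (simp add: h_def)
qed (simp add: fps_linear_nth)

lemma hyp_fps_lower:
  assumes "c \<noteq> b"
  shows "hyp_fps a (b - 1) c = fps_first_order [:0, 1/(c-b), -1/(c-b):] [:1, -a/(c-b):] (hyp_fps a b c)" (is "_ = ?rhs")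
proof (rule fps_eqI_Suc)
  fix k
  have e: "fps_nth (hyp_fps a (b - 1) c) (Suc k) = h k * ((a + of_nat k) * (b - 1) / ((c + of_nat k) * (1 + of_nat k)))"
    by (simp add: h_def fps_hypergeo_nth pochhammer_down, simp add: pochhammer_Suc c_facts fact_Suc_factored,
      simp add: mult_ac)
  show "fps_nth (hyp_fps a (b - 1) c) (Suc k) = fps_nth ?rhs (Suc k)"
    using assms unfolding e fps_add_nth fps_linear_nth h_def[symmetric] h_Suc
    by (simp add: c_facts divide_simps) (simp add: algebra_simps)
qed (simp add: fps_linear_nth)

lemma hyp_fps_lower_lower:
  shows "hyp_fps a (b - 1) (c - 1) = fps_first_order [:0, 1/(c-1), -1/(c-1):] [:1, -a/(c-1):] (hyp_fps a b c)"
    (is "_ = ?rhs")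
proof (rule fps_eqI_Suc)
  fix k
  have e: "fps_nth (hyp_fps a (b - 1) (c - 1)) (Suc k) = h k * ((a + of_nat k) * (b - 1) / ((c - 1) * (1 + of_nat k)))"
    by (simp add: h_def fps_hypergeo_nth pochhammer_down, simp add: pochhammer_Suc c_facts fact_Suc_factored,
      simp add: mult_ac)
  show "fps_nth (hyp_fps a (b - 1) (c - 1)) (Suc k) = fps_nth ?rhs (Suc k)"
    using c_facts(2) unfolding e fps_add_nth fps_linear_nth h_def[symmetric] h_Suc
    by (simp add: c_facts divide_simps) (simp add: algebra_simps)
qed (simp add: fps_linear_nth)

lemma hyp_fps_raise_raise:
  assumes "a \<noteq> 0" "c \<noteq> b"
  shows "hyp_fps (a + 1) b (c + 1) =
    fps_first_order [:-c/(a*(c-b)), c/(a*(c-b)):] [:c/(c-b):] (hyp_fps a b c)" (is "_ = ?rhs")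
proof (rule fps_ext)
  fix k
  have "pochhammer (a + 1) k = pochhammer a k * (a + of_nat k) / a"
    "pochhammer (c + 1) k = pochhammer c k * (c + of_nat k) / c"
    using pochhammer_up[of a k] pochhammer_up[of c k] assms by (simp_all add: c_facts field_simps)
  then have l: "fps_nth (hyp_fps (a + 1) b (c + 1)) k = h k * ((a + of_nat k) * c / ((c + of_nat k) * a))"
    by (simp add: h_def fps_hypergeo_nth mult_ac)
  have r: "fps_nth ?rhs k
     = -c/(a*(c-b)) * ((1 + of_nat k) * h (Suc k)) + c/(a*(c-b)) * (of_nat k * h k) + c/(c-b) * h k"
    by (cases k; unfold fps_add_nth fps_linear_nth h_def; simp add: fps_linear_nth)
  show "fps_nth (hyp_fps (a + 1) b (c + 1)) k = fps_nth ?rhs k"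
    using assms unfolding l r h_Suc
    by (simp add: c_facts divide_simps) (simp add: algebra_simps)
qed

lemma hyp_fps_ode:
  "fps_of_poly [:0, 1, -1:] * fps_deriv (fps_deriv (hyp_fps a b c)) + fps_of_poly [:c, -a-b-1:] * fps_deriv (hyp_fps a b c)
     = fps_const (a * b) * hyp_fps a b c"
proof (rule fps_ext)
  fix k
  have e: "fps_nth (fps_of_poly [:c, -a-b-1:] * fps_deriv (hyp_fps a b c)) k =
    c * ((1 + of_nat k) * h (Suc k)) + (-a-b-1) * (of_nat k * h k)"
    by (cases k; unfold fps_add_nth fps_linear_nth h_def; simp add: fps_linear_nth)
  show "fps_nth (fps_of_poly [:0, 1, -1:] * fps_deriv (fps_deriv (hyp_fps a b c)) +
    fps_of_poly [:c, -a-b-1:] * fps_deriv (hyp_fps a b c)) k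
     = fps_nth (fps_const (a * b) * hyp_fps a b c) k"
    unfolding fps_add_nth e fps_linear_nth fps_mult_left_const_nth h_def[symmetric] h_Suc
    by (simp add: c_facts divide_simps) (simp add: algebra_simps)
qed

text \<open>
  Shifting \<open>a\<close> and \<open>b\<close> simultaneously is in general a second-order step. It is of first order in the
  quadratic case \<open>c = 1 - a + b\<close>, to which Legendre functions belong.
\<close>

lemma hyp_fps_shift_up:
  assumes "c = 1 - a + b" "a \<noteq> 0" "b \<noteq> 0"
  shows "fps_of_poly [:1, -1:] * hyp_fps (a + 1) (b + 1) c =
    fps_first_order [:0, 2/b:] [:1:] (hyp_fps a b c)" (is "_ = ?rhs")
proof (rule fps_eqI_Suc)
  fix k
  have "pochhammer (a + 1) k = pochhammer a k * (a + of_nat k) / a"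
       "pochhammer (b + 1) k = pochhammer b k * (b + of_nat k) / b" for k
    using pochhammer_up[of a k] pochhammer_up[of b k] assms(2,3) by (simp_all add: field_simps)
  then have *: "fps_nth (hyp_fps (a + 1) (b + 1) c) k = h k * ((a + of_nat k) * (b + of_nat k) / (a * b))" for k
    by (simp add: h_def fps_hypergeo_nth mult_ac)
  have poly: "H * ((a + K) * (b + K)) * ((a + (1 + K)) * (b + (1 + K))) - H * ((a + K) * (b + K)) * ((c + K) * (1 + K))
     = (2 * (H * ((a + K) * ((b + K) * (1 + K)))) + H * ((a + K) * (b + K)) * b) * a" for H K
    unfolding assms(1) by (simp add: algebra_simps)
  have d: "fps_nth (fps_deriv (hyp_fps a b c)) k = (1 + of_nat k) * h (Suc k)"
    by (simp add: h_def)
  show "fps_nth (fps_of_poly [:1, -1:] * hyp_fps (a + 1) (b + 1) c) (Suc k) = fps_nth ?rhs (Suc k)"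
    unfolding fps_add_nth fps_linear_nth d h_def[symmetric] * h_Suc
    using assms(2,3) by (simp add: c_facts divide_simps) (simp add: poly)
qed (simp add: fps_linear_nth)

lemma hyp_fps_shift_down:
  assumes "c = 1 - a + b" "c \<noteq> a"
  shows "hyp_fps (a - 1) (b - 1) c =
    fps_first_order [:0, 2/(c-a), -2/(c-a):] [:1, (2-4*a)/(c-a) - 1:] (hyp_fps a b c)" (is "_ = ?rhs")
proof (rule fps_eqI_Suc)
  fix k
  have b: "b = c - 1 + a" unfolding assms(1) by simp
  have e: "fps_nth (hyp_fps (a - 1) (b - 1) c) (Suc k) = h k * ((a - 1) * (b - 1) / ((c + of_nat k) * (1 + of_nat k)))"
    by (simp add: h_def fps_hypergeo_nth pochhammer_down, simp add: pochhammer_Suc c_facts fact_Suc_factored,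
      simp add: mult_ac)
  show "fps_nth (hyp_fps (a - 1) (b - 1) c) (Suc k) = fps_nth ?rhs (Suc k)"
    using assms(2) unfolding e fps_add_nth fps_linear_nth h_def[symmetric] h_Suc
    by (simp add: c_facts divide_simps) (simp add: b algebra_simps)
qed (simp add: fps_linear_nth)

end

lemma hyp_fps_unique:
  fixes F :: "complex fps"
  assumes c: "c \<notin> \<int>" and F0: "fps_nth F 0 = 1"
    and ode: "fps_of_poly [:0, 1, -1:] * fps_deriv (fps_deriv F) + fps_of_poly [:c, -a-b-1:] * fps_deriv F =
      fps_const (a * b) * F"
  shows "F = hyp_fps a b c"
proof (rule fps_ext)
  have rec: "fps_nth F (Suc k) = fps_nth F k * ((a + of_nat k) * (b + of_nat k) / ((c + of_nat k) * (1 + of_nat k)))" for k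
  proof -
    have "fps_nth (fps_of_poly [:c, -a-b-1:] * fps_deriv F) k =
      c * ((1 + of_nat k) * fps_nth F (Suc k)) + (-a-b-1) * (of_nat k * fps_nth F k)"
      by (cases k) (simp_all add: fps_linear_nth)
    then have "of_nat k * (of_nat k + 1) * fps_nth F (Suc k) - of_nat k * (of_nat k - 1) * fps_nth F k +
        (c * ((1 + of_nat k) * fps_nth F (Suc k)) + (-a-b-1) * (of_nat k * fps_nth F k)) = a * b * fps_nth F k"
      using arg_cong[OF ode, of "\<lambda>G. fps_nth G k"] by (simp add: fps_linear_nth)
    then have "fps_nth F (Suc k) * ((c + of_nat k) * (1 + of_nat k)) = fps_nth F k * ((a + of_nat k) * (b + of_nat k))"
      by (simp add: algebra_simps)
    then show ?thesis by (simp add: c_facts[OF c] divide_simps)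
  qed
  show "fps_nth F k = fps_nth (hyp_fps a b c) k" for k
    by (induction k) (simp_all add: F0 rec h_Suc[OF c])
qed

lemma hyp_has_fps_expansionI:
  assumes c: "c \<notin> \<int>" and S: "open S" "0 \<in> S" and f0: "f 0 = 1"
    and f: "\<And>x. x \<in> S \<Longrightarrow> (f has_field_derivative f' x) (at x)"
    and f': "\<And>x. x \<in> S \<Longrightarrow> (f' has_field_derivative f'' x) (at x)"
    and ode: "\<And>x. x \<in> S \<Longrightarrow> x * (1 - x) * f'' x + (c - (a + b + 1) * x) * f' x = a * b * f x"
  shows "f has_fps_expansion hyp_fps a b c"
proof -
  have hol: "f holomorphic_on S" using f S by (auto simp: holomorphic_on_open)
  then obtain F where F: "f has_fps_expansion F"
    using S analytic_at_imp_has_fps_expansion_0 analytic_at by blast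
  have ev: "\<forall>\<^sub>F x in nhds 0. x \<in> S" using S by (simp add: eventually_nhds_in_open)
  have "\<forall>\<^sub>F x in nhds 0. deriv f x = f' x" using ev by eventually_elim (auto intro: DERIV_imp_deriv f)
  then have F': "f' has_fps_expansion fps_deriv F"
    using has_fps_expansion_deriv[OF F] has_fps_expansion_cong[OF _ refl] by blast
  have "\<forall>\<^sub>F x in nhds 0. deriv f' x = f'' x" using ev by eventually_elim (auto intro: DERIV_imp_deriv f')
  then have F'': "f'' has_fps_expansion fps_deriv (fps_deriv F)"
    using has_fps_expansion_deriv[OF F'] has_fps_expansion_cong[OF _ refl] by blast
  have poly: "(\<lambda>x. poly p x) has_fps_expansion fps_of_poly p" for p :: "complex poly"
    by (simp add: has_fps_expansion_def)
  have 1: "(\<lambda>x. poly [:0, 1, -1:] x * f'' x + poly [:c, -a-b-1:] x * f' x) has_fps_expansion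
      fps_of_poly [:0, 1, -1:] * fps_deriv (fps_deriv F) + fps_of_poly [:c, -a-b-1:] * fps_deriv F"
    by (intro has_fps_expansion_add has_fps_expansion_mult poly F' F'')
  have 3: "(\<lambda>x. a * b * f x) has_fps_expansion fps_const (a * b) * F"
    by (intro has_fps_expansion_cmult_left F)
  have 4: "\<forall>\<^sub>F x in nhds 0. a * b * f x = poly [:0, 1, -1:] x * f'' x + poly [:c, -a-b-1:] x * f' x"
    using ev by eventually_elim (use ode in \<open>simp add: algebra_simps\<close>)
  have "(\<lambda>x. poly [:0, 1, -1:] x * f'' x + poly [:c, -a-b-1:] x * f' x) has_fps_expansion fps_const (a * b) * F"
    by (rule iffD1[OF has_fps_expansion_cong[OF 4 refl] 3])
  note 2 = fps_expansion_unique_complex[OF 1 this]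
  have "fps_nth F 0 = 1" using has_fps_expansion_imp_0_eq_fps_nth_0[OF F] f0 by simp
  then show ?thesis using hyp_fps_unique[OF c _ 2] F by simp
qed

section \<open>Octahedral functions\<close>

text \<open>
  The points \<open>1\<close> and the zeros of \<open>p_f\<close> are critical points of \<open>oct_R\<close>: raising or lowering an index
  of \<open>octahedral_r\<close> involves a division by the derivative of \<open>oct_R\<close>.
\<close>

definition oct_dom :: "complex set" where
  "oct_dom = {u. u \<noteq> 0 \<and> u \<noteq> 1 \<and> p_f u \<noteq> 0 \<and> p_e u \<noteq> 0}"

definition rational_on :: "complex set \<Rightarrow> (complex \<Rightarrow> complex) \<Rightarrow> bool" where
  "rational_on S f \<longleftrightarrow> (\<exists>p q. \<forall>u\<in>S. poly q u \<noteq> 0 \<and> f u = poly p u / poly q u)"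

lemma rational_onI: "(\<And>u. u \<in> S \<Longrightarrow> poly q u \<noteq> 0 \<and> f u = poly p u / poly q u) \<Longrightarrow> rational_on S f"
  by (auto simp: rational_on_def)

lemma rational_on_const: "rational_on S (\<lambda>_. c)"
  by (rule rational_onI[of _ 1 _ "[:c:]"]) auto

lemma rational_on_add:
  assumes "rational_on S f" "rational_on S g" shows "rational_on S (\<lambda>u. f u + g u)"
proof -
  obtain p q where f: "\<And>u. u \<in> S \<Longrightarrow> poly q u \<noteq> 0" "\<And>u. u \<in> S \<Longrightarrow> f u = poly p u / poly q u"
    using assms(1) unfolding rational_on_def by blast
  obtain p' q' where g: "\<And>u. u \<in> S \<Longrightarrow> poly q' u \<noteq> 0" "\<And>u. u \<in> S \<Longrightarrow> g u = poly p' u / poly q' u"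
    using assms(2) unfolding rational_on_def by blast
  show ?thesis by (intro rational_onI[of _ "q * q'" _ "p * q' + p' * q"]) (simp add: f g add_frac_eq)
qed

lemma rational_on_mult:
  assumes "rational_on S f" "rational_on S g" shows "rational_on S (\<lambda>u. f u * g u)"
proof -
  obtain p q where f: "\<And>u. u \<in> S \<Longrightarrow> poly q u \<noteq> 0" "\<And>u. u \<in> S \<Longrightarrow> f u = poly p u / poly q u"
    using assms(1) unfolding rational_on_def by blast
  obtain p' q' where g: "\<And>u. u \<in> S \<Longrightarrow> poly q' u \<noteq> 0" "\<And>u. u \<in> S \<Longrightarrow> g u = poly p' u / poly q' u"
    using assms(2) unfolding rational_on_def by blast
  show ?thesis by (intro rational_onI[of _ "q * q'" _ "p * p'"]) (simp add: f g)
qed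

lemma rational_on_inverse:
  assumes "rational_on S f" "\<And>u. u \<in> S \<Longrightarrow> f u \<noteq> 0" shows "rational_on S (\<lambda>u. inverse (f u))"
proof -
  obtain p q where pq: "\<And>u. u \<in> S \<Longrightarrow> poly q u \<noteq> 0" "\<And>u. u \<in> S \<Longrightarrow> f u = poly p u / poly q u"
    using assms(1) unfolding rational_on_def by blast
  then show ?thesis using assms(2) by (intro rational_onI[of _ p _ q]) auto
qed

lemma rational_on_divide:
  assumes "rational_on S f" "rational_on S g" "\<And>u. u \<in> S \<Longrightarrow> g u \<noteq> 0" shows "rational_on S (\<lambda>u. f u / g u)"
  using rational_on_mult[OF assms(1) rational_on_inverse[OF assms(2,3)]] by (simp add: divide_inverse)

lemma rational_on_power:
  assumes "rational_on S f" shows "rational_on S (\<lambda>u. f u ^ k)"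
  by (induction k) (simp_all add: rational_on_const rational_on_mult assms)

lemma rational_on_powi:
  assumes "rational_on S f" "\<And>u. u \<in> S \<Longrightarrow> f u \<noteq> 0" shows "rational_on S (\<lambda>u. f u powi k)"
  unfolding power_int_def using rational_on_power[OF assms(1)] rational_on_power[OF rational_on_inverse[OF assms]]
  by (cases "k \<ge> 0") simp_all

lemma rational_on_compose_poly:
  assumes "rational_on S f" shows "rational_on S (\<lambda>u. poly p (f u))"
  by (induction p) (simp_all add: rational_on_const rational_on_mult rational_on_add assms)

lemma rational_on_deriv:
  assumes "rational_on S f" "open S"
  shows "rational_on S (deriv f)" "\<And>u. u \<in> S \<Longrightarrow> (f has_field_derivative deriv f u) (at u)"
proof -
  obtain p q where pq: "\<And>u. u \<in> S \<Longrightarrow> poly q u \<noteq> 0" "\<And>u. u \<in> S \<Longrightarrow> f u = poly p u / poly q u"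
    using assms(1) unfolding rational_on_def by blast
  have *: "(f has_field_derivative (poly (pderiv p) u * poly q u - poly p u * poly (pderiv q) u) /
    (poly q u * poly q u)) (at u)"
    if u: "u \<in> S" for u
  proof (rule has_field_derivative_transform_within_open[OF _ assms(2) u])
    show "((\<lambda>u. poly p u / poly q u) has_field_derivative (poly (pderiv p) u * poly q u -
      poly p u * poly (pderiv q) u) / (poly q u * poly q u)) (at u)"
      using pq(1)[OF u] by (intro DERIV_divide poly_DERIV)
  qed (use pq in auto)
  show "(f has_field_derivative deriv f u) (at u)" if "u \<in> S" for u
    using *[OF that] DERIV_imp_deriv[OF *[OF that]] by simp
  show "rational_on S (deriv f)"
    by (intro rational_onI[of _ "q * q" _ "pderiv p * q - p * pderiv q"]) (simp add: pq(1) DERIV_imp_deriv[OF *])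
qed

lemma open_oct_dom: "open oct_dom"
  unfolding oct_dom_def p_f_def p_e_def
  by (intro open_Collect_conj open_Collect_neq continuous_intros)

abbreviation p_e' :: "complex \<Rightarrow> complex" where "p_e' u \<equiv> 3 * (u\<^sup>2 - 22 * u - 11)"

lemma DERIV_p_e: "(p_e has_field_derivative p_e' u) (at u)"
  unfolding p_e_def [abs_def] by (auto intro!: derivative_eq_intros simp: algebra_simps power2_eq_square)

lemma DERIV_p_f: "(p_f has_field_derivative 14 + 2 * u) (at u)"
  unfolding p_f_def [abs_def] by (auto intro!: derivative_eq_intros)

definition oct_R' :: "complex \<Rightarrow> complex" where
  "oct_R' u = -108 * (1 - u) ^ 3 * p_f u ^ 2 / p_e u ^ 3"

lemma DERIV_oct_R:
  assumes "p_e u \<noteq> 0"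
  shows "(oct_R has_field_derivative oct_R' u) (at u)"
proof -
  have v: "(p_v has_field_derivative (1 - u) ^ 3 * (1 - 5 * u)) (at u)"
    unfolding p_v_def [abs_def] by (auto intro!: derivative_eq_intros) (simp add: algebra_simps power_numeral_reduce)
  have "((\<lambda>u. -108 * p_v u / p_e u ^ 2) has_field_derivative
      (-108 * ((1 - u) ^ 3 * (1 - 5 * u)) * p_e u ^ 2 - (-108 * p_v u) * (2 * p_e' u * p_e u)) /
        (p_e u ^ 2 * p_e u ^ 2)) (at u)"
    using assms by (auto intro!: derivative_eq_intros v DERIV_p_e simp: divide_simps)
  also have "(-108 * ((1 - u) ^ 3 * (1 - 5 * u)) * p_e u ^ 2 - (-108 * p_v u) * (2 * p_e' u * p_e u)) /
    (p_e u ^ 2 * p_e u ^ 2)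
      = -108 * (1 - u) ^ 3 * ((1 - 5 * u) * p_e u - u * (1 - u) * (2 * p_e' u)) / p_e u ^ 3"
    using assms by (simp add: p_v_def divide_simps power_numeral_reduce) (simp add: algebra_simps)
  also have "(1 - 5 * u) * p_e u - u * (1 - u) * (2 * p_e' u) = p_f u ^ 2"
    unfolding p_e_def p_f_def by (simp add: algebra_simps power_numeral_reduce)
  finally show ?thesis by (simp add: oct_R_def [abs_def] oct_R'_def)
qed

lemma not_nonpos_RealsI: "Re z > 0 \<Longrightarrow> z \<notin> \<real>\<^sub>\<le>\<^sub>0"
  by (auto simp: complex_nonpos_Reals_iff)

definition oct_germ :: "complex set" where
  "oct_germ = {u. Re (p_e u) > 0 \<and> u \<noteq> 1 \<and> p_f u \<noteq> 0}"

lemma open_oct_germ: "open oct_germ"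
  unfolding oct_germ_def p_f_def p_e_def
  by (intro open_Collect_conj open_Collect_neq open_Collect_less continuous_intros)

lemma zero_in_oct_germ: "0 \<in> oct_germ"
  by (simp add: oct_germ_def p_e_def p_f_def)

lemma oct_germD: "u \<in> oct_germ \<Longrightarrow> p_e u \<noteq> 0 \<and> p_e u \<notin> \<real>\<^sub>\<le>\<^sub>0 \<and> u \<noteq> 1 \<and> 1 - u \<noteq> 0 \<and> p_f u \<noteq> 0 \<and> oct_R' u \<noteq> 0"
  by (auto simp: oct_germ_def oct_R'_def not_nonpos_RealsI)

lemma oct_germ_dom: "u \<in> oct_germ \<Longrightarrow> u \<noteq> 0 \<Longrightarrow> u \<in> oct_dom"
  by (auto simp: oct_germ_def oct_dom_def)

lemma DERIV_p_e_powr: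
  assumes "p_e u \<notin> \<real>\<^sub>\<le>\<^sub>0"
  shows "((\<lambda>u. p_e u powr s) has_field_derivative p_e u powr s * (s * p_e' u / p_e u)) (at u)"
proof -
  have "p_e u \<noteq> 0" using assms by auto
  then show ?thesis
    using DERIV_chain2[OF has_field_derivative_powr[OF assms] DERIV_p_e, of s] by (simp add: powr_diff mult_ac)
qed

lemma nonint_24:
  fixes x :: "'a :: field_char_0"
  assumes "x = of_int k / 24" "\<not> 24 dvd k"
  shows "x \<notin> \<int>"
proof
  assume "x \<in> \<int>"
  then obtain j where "x = of_int j" by (auto elim: Ints_cases)
  then have "of_int k = (of_int (24 * j) :: 'a)" using assms by simp
  then have "k = 24 * j" by (simp only: of_int_eq_iff)
  then show False using assms by simp
qed

lemma oct_R_at_0: "filterlim oct_R (nhds 0) (nhds 0)"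
proof -
  have "isCont oct_R 0" by (rule DERIV_isCont[OF DERIV_oct_R]) (simp add: p_e_def)
  then have "filterlim oct_R (nhds (oct_R 0)) (nhds 0)"
    unfolding isCont_def tendsto_at_iff_tendsto_nhds .
  then show ?thesis by (simp add: oct_R_def p_v_def)
qed

lemma oct_base_algebra:
  fixes D E F d d2 f1 u :: complex
  assumes [simp]: "D \<noteq> 0" "E \<noteq> 0" "F \<noteq> 0"
  defines "Q \<equiv> 23/12 * d ^ 2 * D * F + E * d2 * D * F + 3 * E * d * F - 2 * E * d * D * f1"
  shows "-108 * D ^ 3 * F ^ 2 / E ^ 3 * (E ^ 2 * d / (1296 * D ^ 3 * F ^ 2)) = -1/12 * d / E"
    and "-1/12 * d / E * (E ^ 2 * d / (1296 * D ^ 3 * F ^ 2)) +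
      ((2 * E * d * d + E ^ 2 * d2) * (1296 * D ^ 3 * F ^ 2)
       - E ^ 2 * d * (1296 * (-3 * D ^ 2) * F ^ 2 + 1296 * D ^ 3 * (2 * F * f1)))
      / ((1296 * D ^ 3 * F ^ 2) * (1296 * D ^ 3 * F ^ 2))
     = -108 * D ^ 3 * F ^ 2 / E ^ 3 * (- (E ^ 4 * Q / (1296 * 108 * D ^ 7 * F ^ 5)))"
    and "-108 * (u * D ^ 4) / E ^ 2 * (F ^ 3 / E ^ 2) * (- (E ^ 4 * Q / (1296 * 108 * D ^ 7 * F ^ 5)))
        = u * Q / (1296 * D ^ 3 * F ^ 2)"
    and "(3/4 - (-1/24 + 11/24 + 1) * (-108 * (u * D ^ 4) / E ^ 2)) * (E ^ 2 * d / (1296 * D ^ 3 * F ^ 2))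
        = (3/4 * E ^ 2 + 153 * u * D ^ 4) * d / (1296 * D ^ 3 * F ^ 2)"
proof -
  show "-108 * D ^ 3 * F ^ 2 / E ^ 3 * (E ^ 2 * d / (1296 * D ^ 3 * F ^ 2)) = -1/12 * d / E"
    by (simp add: divide_simps) (simp add: power_numeral_reduce)
  show "-1/12 * d / E * (E ^ 2 * d / (1296 * D ^ 3 * F ^ 2)) +
      ((2 * E * d * d + E ^ 2 * d2) * (1296 * D ^ 3 * F ^ 2)
       - E ^ 2 * d * (1296 * (-3 * D ^ 2) * F ^ 2 + 1296 * D ^ 3 * (2 * F * f1)))
      / ((1296 * D ^ 3 * F ^ 2) * (1296 * D ^ 3 * F ^ 2))
     = -108 * D ^ 3 * F ^ 2 / E ^ 3 * (- (E ^ 4 * Q / (1296 * 108 * D ^ 7 * F ^ 5)))"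
  proof -
    have 1: "-1/12 * d / E * (E ^ 2 * d / (1296 * D ^ 3 * F ^ 2)) = E * (-1/12 * d ^ 2 * D * F) / (1296 * D ^ 4 * F ^ 3)"
      by (simp add: divide_simps) (simp add: power_numeral_reduce)
    have 2: "((2 * E * d * d + E ^ 2 * d2) * (1296 * D ^ 3 * F ^ 2)
       - E ^ 2 * d * (1296 * (-3 * D ^ 2) * F ^ 2 + 1296 * D ^ 3 * (2 * F * f1)))
      = (E * (2 * d ^ 2 * D * F + E * d2 * D * F + 3 * E * d * F - 2 * E * d * D * f1)) * (1296 * D ^ 2 * F)"
      by (simp add: algebra_simps power_numeral_reduce)
    have 3: "(1296 * D ^ 3 * F ^ 2) * (1296 * D ^ 3 * F ^ 2) = (1296 * D ^ 4 * F ^ 3) * (1296 * D ^ 2 * F)"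
      by (simp add: power_numeral_reduce)
    have 4: "-108 * D ^ 3 * F ^ 2 / E ^ 3 * (- (E ^ 4 * Q / (1296 * 108 * D ^ 7 * F ^ 5))) = E * Q / (1296 * D ^ 4 * F ^ 3)"
      by (simp add: divide_simps) (simp add: power_numeral_reduce)
    have 5: "x * y / (z * y) = x / z" if "y \<noteq> 0" for x y z :: complex
      using that by simp
    show ?thesis
      unfolding 1 2 3 4 by (subst 5, simp, unfold add_divide_distrib[symmetric] Q_def)
        (simp add: algebra_simps power2_eq_square)
  qed
  show "-108 * (u * D ^ 4) / E ^ 2 * (F ^ 3 / E ^ 2) * (- (E ^ 4 * Q / (1296 * 108 * D ^ 7 * F ^ 5)))
        = u * Q / (1296 * D ^ 3 * F ^ 2)"
    by (simp add: divide_simps)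
  show "(3/4 - (-1/24 + 11/24 + 1) * (-108 * (u * D ^ 4) / E ^ 2)) * (E ^ 2 * d / (1296 * D ^ 3 * F ^ 2))
        = (3/4 * E ^ 2 + 153 * u * D ^ 4) * d / (1296 * D ^ 3 * F ^ 2)"
    by (simp add: divide_simps)
qed

text \<open>
  Near \<open>0\<close> the map \<open>oct_R\<close> has a holomorphic inverse, so \<open>p_e powr (-1/12)\<close> may be regarded as a
  function of \<open>x = oct_R u\<close>; as such it satisfies the hypergeometric equation.
\<close>

lemma oct_base_germ:
  "\<forall>\<^sub>F u in nhds 0. hyp_ser (-1/24) (11/24) (3/4) (oct_R u) = p_e u powr (-1/12)"
proof -
  have holR: "oct_R holomorphic_on oct_germ"
    using DERIV_oct_R oct_germD open_oct_germ by (auto simp: holomorphic_on_open)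
  have dR: "deriv oct_R u = oct_R' u" if "u \<in> oct_germ" for u
    using DERIV_oct_R oct_germD that by (intro DERIV_imp_deriv) auto
  obtain r where r: "r > 0" "ball 0 r \<subseteq> oct_germ" "open (oct_R ` ball 0 r)" "inj_on oct_R (ball 0 r)"
    using has_complex_derivative_locally_invertible[OF holR zero_in_oct_germ open_oct_germ]
      dR[OF zero_in_oct_germ] oct_germD[OF zero_in_oct_germ] by auto
  obtain g where g: "g holomorphic_on (oct_R ` ball 0 r)"
      "\<And>z. z \<in> ball 0 r \<Longrightarrow> deriv oct_R z * deriv g (oct_R z) = 1"
      "\<And>z. z \<in> ball 0 r \<Longrightarrow> g (oct_R z) = z"
    using holomorphic_has_inverse[OF holomorphic_on_subset[OF holR r(2)] open_ball r(4)] by blast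
  have Dg: "(g has_field_derivative 1 / oct_R' (g x)) (at x)" if x: "x \<in> oct_R ` ball 0 r" for x
  proof -
    obtain u where u: "x = oct_R u" "u \<in> ball 0 r" using x by auto
    have "deriv g x = 1 / oct_R' (g x)"
      using g(2,3)[OF u(2)] u(1) dR[of u] r(2) u(2) oct_germD[of u] by (auto simp: divide_simps mult.commute)
    then show ?thesis using holomorphic_derivI[OF g(1) r(3) x] by simp
  qed
  define N where "N = (\<lambda>u. p_e u ^ 2 * p_e' u / (1296 * (1 - u) ^ 3 * p_f u ^ 2))"
  define Q where "Q = (\<lambda>u. 23/12 * p_e' u ^ 2 * (1 - u) * p_f u + p_e u * (6 * u - 66) * (1 - u) * p_f u
     + 3 * p_e u * p_e' u * p_f u - 2 * p_e u * p_e' u * (1 - u) * (14 + 2 * u))"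
  define \<phi> where "\<phi> = (\<lambda>u. p_e u powr (-1/12))"
  define \<phi>1 where "\<phi>1 = (\<lambda>u. \<phi> u * N u)"
  define \<phi>2 where "\<phi>2 = (\<lambda>u. \<phi> u * (- (p_e u ^ 4 * Q u / (1296 * 108 * (1 - u) ^ 7 * p_f u ^ 5))))"
  have D0: "(\<phi> has_field_derivative oct_R' u * \<phi>1 u) (at u)" if u: "u \<in> oct_germ" for u
  proof -
    note [simp] = oct_germD[OF u]
    have "oct_R' u * \<phi>1 u = p_e u powr (-1/12) * (-1/12 * p_e' u / p_e u)"
      by (simp add: oct_R'_def \<phi>1_def \<phi>_def N_def divide_simps power_numeral_reduce)
    then show ?thesis using DERIV_p_e_powr[of u "-1/12"] unfolding \<phi>_def by simp
  qed
  have D1: "(\<phi>1 has_field_derivative oct_R' u * \<phi>2 u) (at u)" if u: "u \<in> oct_germ" for u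
  proof -
    note [simp] = oct_germD[OF u]
    have "(N has_field_derivative ((2 * p_e u * p_e' u * p_e' u + p_e u ^ 2 * (6 * u - 66)) *
      (1296 * (1 - u) ^ 3 * p_f u ^ 2)
       - p_e u ^ 2 * p_e' u * (1296 * (-3 * (1 - u) ^ 2) * p_f u ^ 2 + 1296 * (1 - u) ^ 3 * (2 * p_f u * (14 + 2 * u))))
      / ((1296 * (1 - u) ^ 3 * p_f u ^ 2) * (1296 * (1 - u) ^ 3 * p_f u ^ 2))) (at u)"
      (is "(_ has_field_derivative ?X) _")
      unfolding N_def by (auto intro!: derivative_eq_intros DERIV_p_e DERIV_p_f) (simp add: algebra_simps)
    from DERIV_mult[OF D0[OF u, unfolded \<phi>1_def] this]
    show ?thesis unfolding \<phi>1_def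
    proof (rule DERIV_cong)
      have *: "oct_R' u * (\<phi> u * N u) * N u + X * \<phi> u = oct_R' u * \<phi>2 u"
        if "-1/12 * p_e' u / p_e u * N u + X =
          oct_R' u * (- (p_e u ^ 4 * Q u / (1296 * 108 * (1 - u) ^ 7 * p_f u ^ 5)))" for X
      proof -
        have "oct_R' u * (\<phi> u * N u) * N u + X * \<phi> u = (oct_R' u * N u * N u + X) * \<phi> u"
          by (simp add: algebra_simps)
        also have "oct_R' u * N u = -1/12 * p_e' u / p_e u"
          unfolding oct_R'_def N_def by (rule oct_base_algebra) auto
        finally show ?thesis unfolding that \<phi>2_def by (simp only: mult_ac)
      qed
      show "oct_R' u * (\<phi> u * N u) * N u + ?X * \<phi> u = oct_R' u * \<phi>2 u"
        by (rule *) (unfold oct_R'_def N_def Q_def, rule oct_base_algebra, auto)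
    qed
  qed
  have ode: "oct_R u * (1 - oct_R u) * \<phi>2 u + (3/4 - (-1/24 + 11/24 + 1) * oct_R u) * \<phi>1 u = -1/24 * (11/24) * \<phi> u"
    if u: "u \<in> oct_germ" for u
  proof -
    note [simp] = oct_germD[OF u]
    have "1 - oct_R u = p_f u ^ 3 / p_e u ^ 2" by (simp add: oct_R_altdef)
    have key: "u * Q u + (3/4 * p_e u ^ 2 + 153 * u * (1 - u) ^ 4) * p_e' u = -99/4 * (1 - u) ^ 3 * p_f u ^ 2"
      unfolding Q_def p_e_def p_f_def by (simp add: field_simps power_numeral_reduce)
    have e1: "oct_R u * (p_f u ^ 3 / p_e u ^ 2) * (- (p_e u ^ 4 * Q u / (1296 * 108 * (1 - u) ^ 7 * p_f u ^ 5)))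
        = u * Q u / (1296 * (1 - u) ^ 3 * p_f u ^ 2)"
      unfolding oct_R_def p_v_def Q_def by (rule oct_base_algebra) auto
    have e2: "(3/4 - (-1/24 + 11/24 + 1) * oct_R u) * N u
        = (3/4 * p_e u ^ 2 + 153 * u * (1 - u) ^ 4) * p_e' u / (1296 * (1 - u) ^ 3 * p_f u ^ 2)"
      unfolding oct_R_def p_v_def N_def by (rule oct_base_algebra) auto
    have "oct_R u * (p_f u ^ 3 / p_e u ^ 2) * (- (p_e u ^ 4 * Q u / (1296 * 108 * (1 - u) ^ 7 * p_f u ^ 5)))
       + (3/4 - (-1/24 + 11/24 + 1) * oct_R u) * N u = (-99/4 * (1 - u) ^ 3 * p_f u ^ 2) / (1296 * (1 - u) ^ 3 * p_f u ^ 2)"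
      by (subst e1, subst e2, subst add_divide_distrib[symmetric], subst key, rule refl)
    also have "\<dots> = -1/24 * (11/24)" by (simp add: divide_simps)
    finally have *: "oct_R u * (p_f u ^ 3 / p_e u ^ 2) * (- (p_e u ^ 4 * Q u / (1296 * 108 * (1 - u) ^ 7 * p_f u ^ 5)))
       + (3/4 - (-1/24 + 11/24 + 1) * oct_R u) * N u = -1/24 * (11/24)" .
    have distr: "x * y * (p * w) + t * (p * v) = (x * y * w + t * v) * p" for x y p w t v :: complex
      by (simp add: algebra_simps)
    show ?thesis
      unfolding \<open>1 - oct_R u = p_f u ^ 3 / p_e u ^ 2\<close> \<phi>1_def \<phi>2_def distr * by (rule refl)
  qed
  have "(\<lambda>x. \<phi> (g x)) has_fps_expansion hyp_fps (-1/24) (11/24) (3/4)"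
  proof (rule hyp_has_fps_expansionI[where f' = "\<lambda>x. \<phi>1 (g x)" and f'' = "\<lambda>x. \<phi>2 (g x)"])
    show "3/4 \<notin> (\<int> :: complex set)" by (rule nonint_24[of _ 18]) auto
    show "0 \<in> oct_R ` ball 0 r" using r(1) by (intro image_eqI[of _ _ 0]) (auto simp: oct_R_def p_v_def)
    have "g (oct_R 0) = 0" using g(3)[of 0] r(1) by simp
    then show "\<phi> (g 0) = 1" by (simp add: oct_R_def p_v_def \<phi>_def p_e_def)
    fix x assume x: "x \<in> oct_R ` ball 0 r"
    then obtain u where u: "x = oct_R u" "g x = u" "u \<in> oct_germ" using g(3) r(2) by auto
    show "((\<lambda>x. \<phi> (g x)) has_field_derivative \<phi>1 (g x)) (at x)"
      using DERIV_chain2[OF D0[OF u(3), folded u(2)] Dg[OF x]] u oct_germD[OF u(3)] by simp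
    show "((\<lambda>x. \<phi>1 (g x)) has_field_derivative \<phi>2 (g x)) (at x)"
      using DERIV_chain2[OF D1[OF u(3), folded u(2)] Dg[OF x]] u oct_germD[OF u(3)] by simp
    show "x * (1 - x) * \<phi>2 (g x) + (3/4 - (-1/24 + 11/24 + 1) * x) * \<phi>1 (g x) = -1/24 * (11/24) * \<phi> (g x)"
      using ode[OF u(3)] u by simp
  qed (use r in auto)
  then have ev: "\<forall>\<^sub>F x in nhds 0. hyp_ser (-1/24) (11/24) (3/4) x = \<phi> (g x)"
    by (simp add: has_fps_expansion_def)
  from eventually_compose_filterlim[OF ev oct_R_at_0]
  have "\<forall>\<^sub>F u in nhds 0. hyp_ser (-1/24) (11/24) (3/4) (oct_R u) = \<phi> (g (oct_R u))" .
  moreover have "\<forall>\<^sub>F u in nhds 0. u \<in> ball (0::complex) r" using r(1) by (intro eventually_nhds_in_open) auto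
  ultimately show ?thesis by eventually_elim (simp add: g(3) \<phi>_def)
qed

definition oct_a :: "int \<Rightarrow> int \<Rightarrow> complex" where "oct_a m n = -1/24 - of_int m / 2 - of_int n / 2"
definition oct_b :: "int \<Rightarrow> int \<Rightarrow> complex" where "oct_b m n = 11/24 - of_int m / 2 - of_int n / 2"
definition oct_c :: "int \<Rightarrow> complex" where "oct_c m = 3/4 - of_int m"

lemma oct_params_nonint:
  "oct_a m n \<notin> \<int>" "oct_b m n \<notin> \<int>" "oct_c m \<notin> \<int>" "oct_c m - oct_b m n \<notin> \<int>" "oct_c m - oct_a m n \<notin> \<int>"
  "oct_c m - 1 \<notin> \<int>"
proof -
  have "\<not> 24 dvd (-1 - 12 * m - 12 * n)" "\<not> 24 dvd (11 - 12 * m - 12 * n)" "\<not> 24 dvd (18 - 24 * m)"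
    "\<not> 24 dvd (7 - 12 * m + 12 * n)" "\<not> 24 dvd (19 - 12 * m + 12 * n)" "\<not> 24 dvd (-6 - 24 * m)"
    by presburger+
  note d = this
  show "oct_a m n \<notin> \<int>" by (rule nonint_24[OF _ d(1)]) (simp add: oct_a_def field_simps)
  show "oct_b m n \<notin> \<int>" by (rule nonint_24[OF _ d(2)]) (simp add: oct_b_def field_simps)
  show "oct_c m \<notin> \<int>" by (rule nonint_24[OF _ d(3)]) (simp add: oct_c_def field_simps)
  show "oct_c m - oct_b m n \<notin> \<int>" by (rule nonint_24[OF _ d(4)]) (simp add: oct_c_def oct_b_def field_simps)
  show "oct_c m - oct_a m n \<notin> \<int>" by (rule nonint_24[OF _ d(5)]) (simp add: oct_c_def oct_a_def field_simps)
  show "oct_c m - 1 \<notin> \<int>" by (rule nonint_24[OF _ d(6)]) (simp add: oct_c_def field_simps)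
qed

abbreviation oct_fps :: "int \<Rightarrow> int \<Rightarrow> complex fps" where
  "oct_fps m n \<equiv> hyp_fps (oct_a m n) (oct_b m n) (oct_c m)"

lemma oct_conv_radius: "fps_conv_radius (oct_fps m n) = 1"
  by (rule hyp_fps_conv_radius) (rule oct_params_nonint)+

definition oct_rep :: "int \<Rightarrow> int \<Rightarrow> (complex \<Rightarrow> complex) \<Rightarrow> bool" where
  "oct_rep m n f \<longleftrightarrow> rational_on oct_dom f \<and>
     (\<forall>\<^sub>F u in at 0. eval_fps (oct_fps m n) (oct_R u) = p_e u powr (2 * oct_a m n) * f u)"

lemma eventually_oct_germ: "\<forall>\<^sub>F u in nhds 0. u \<in> oct_germ \<and> norm (oct_R u) < 1"
proof -
  have "\<forall>\<^sub>F u in nhds 0. oct_R u \<in> ball 0 1"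
    by (rule eventually_compose_filterlim[OF eventually_nhds_in_open oct_R_at_0]) auto
  moreover have "\<forall>\<^sub>F u in nhds 0. u \<in> oct_germ"
    by (intro eventually_nhds_in_open open_oct_germ zero_in_oct_germ)
  ultimately show ?thesis by eventually_elim simp
qed

lemma poly_lowest_terms:
  fixes p q :: "'a :: field poly"
  assumes "q \<noteq> 0"
  shows "\<exists>p' q' g. p = p' * g \<and> q = q' * g \<and> coprime p' q'"
  using assms
proof (induction "degree q" arbitrary: p q rule: less_induct)
  case less
  show ?case
  proof (cases "coprime p q")
    case True
    then show ?thesis by (intro exI[of _ p] exI[of _ q] exI[of _ 1]) simp
  next
    case False
    then obtain d where "d dvd p" "d dvd q" and d: "\<not> is_unit d" by (rule not_coprimeE)
    then obtain p1 q1 where p1: "p = d * p1" and q1: "q = d * q1" by (elim dvdE)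
    have "d \<noteq> 0" "q1 \<noteq> 0" using less.prems q1 by auto
    then have "degree q1 < degree q"
      using d by (simp add: q1 degree_mult_eq is_unit_iff_degree)
    from less.hyps[OF this \<open>q1 \<noteq> 0\<close>, of p1] obtain p' q' g
      where "p1 = p' * g" "q1 = q' * g" "coprime p' q'" by blast
    then show ?thesis using p1 q1 by (intro exI[of _ p'] exI[of _ q'] exI[of _ "d * g"]) (simp add: mult_ac)
  qed
qed

lemma oct_rep_octahedral_r:
  assumes "oct_rep m n f" "u \<in> oct_dom"
  shows "octahedral_r m n u = f u"
proof -
  obtain p q where q: "\<And>u. u \<in> oct_dom \<Longrightarrow> poly q u \<noteq> 0" and f: "\<And>u. u \<in> oct_dom \<Longrightarrow> f u = poly p u / poly q u"
    using assms(1) unfolding oct_rep_def rational_on_def by blast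
  have "q \<noteq> 0" using q[OF assms(2)] by auto
  then obtain p' q' g where p': "p = p' * g" and q': "q = q' * g" and cop: "coprime p' q'"
    using poly_lowest_terms by metis
  have q'0: "q' \<noteq> 0" using \<open>q \<noteq> 0\<close> q' by auto
  have fr: "f u = poly p' u / poly q' u" if "u \<in> oct_dom" for u
    using q[OF that] f[OF that] by (simp add: p' q')
  define H where "H = (\<lambda>u. eval_fps (oct_fps m n) (oct_R u) * p_e u powr (- (2 * oct_a m n)))"
  have germ: "\<forall>\<^sub>F u in at 0. u \<in> oct_germ \<and> u \<noteq> 0"
    using eventually_oct_germ unfolding eventually_at_filter by eventually_elim simp
  have ev: "\<forall>\<^sub>F u in at 0. H u = poly p' u / poly q' u"
    using assms(1)[unfolded oct_rep_def, THEN conjunct2] germ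
  proof eventually_elim
    case (elim u)
    then show ?case using oct_germD[of u] oct_germ_dom[of u] fr[of u]
      by (auto simp: H_def powr_minus)
  qed
  have 1: "isCont (eval_fps (oct_fps m n)) (oct_R 0)"
    by (intro continuous_eval_fps) (simp add: oct_R_def p_v_def oct_conv_radius)
  have 2: "isCont oct_R 0" by (rule DERIV_isCont[OF DERIV_oct_R]) (simp add: p_e_def)
  have 3: "isCont (\<lambda>u. p_e u powr s) 0" for s
    by (rule DERIV_isCont[OF DERIV_p_e_powr]) (simp add: p_e_def)
  have "isCont H 0" unfolding H_def by (intro isCont_mult isCont_o2[OF 2 1] 3)
  then have lim: "(\<lambda>u. H u * poly q' u) \<midarrow>0\<rightarrow> H 0 * poly q' 0"
    using poly_isCont[of 0 q'] unfolding isCont_def by (rule tendsto_mult)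
  have ev2: "\<forall>\<^sub>F u in at 0. poly p' u = H u * poly q' u"
    using ev eventually_poly_nonzero[OF q'0] by eventually_elim simp
  have "poly p' \<midarrow>0\<rightarrow> H 0 * poly q' 0"
    by (rule iffD2[OF tendsto_cong[OF ev2] lim])
  moreover have "poly p' \<midarrow>0\<rightarrow> poly p' 0" using poly_isCont[of 0 p'] unfolding isCont_def .
  ultimately have eq0: "poly p' 0 = H 0 * poly q' 0" using LIM_unique by blast
  have "poly q' 0 \<noteq> 0"
  proof
    assume "poly q' 0 = 0"
    moreover from this have "poly p' 0 = 0" using eq0 by simp
    ultimately have "[:0, 1:] dvd p'" "[:0, 1:] dvd q'" by (simp_all add: poly_eq_0_iff_dvd)
    then have "is_unit [:0, 1 :: complex:]" using cop coprime_common_divisor by blast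
    then show False by (simp add: is_unit_iff_degree)
  qed
  then have "H 0 = poly p' 0 / poly q' 0" using eq0 by simp
  then have ev': "\<forall>\<^sub>F u in nhds 0. H u = poly p' u / poly q' u"
    using ev by (simp add: eventually_nhds_conv_at)
  have "is_octahedral m n p' q'"
    unfolding is_octahedral_def
  proof (intro conjI cop q'0)
    show "\<forall>\<^sub>F u in nhds 0. hyp2f1 (-1/24 - of_int m / 2 - of_int n / 2) (11/24 - of_int m / 2 - of_int n / 2)
               (3/4 - of_int m) (oct_R u) =
        p_e u powr (-1/12 - of_int m - of_int n) * (poly p' u / poly q' u)"
      using ev' eventually_oct_germ
    proof eventually_elim
      case (elim u)
      have "hyp2f1 (oct_a m n) (oct_b m n) (oct_c m) (oct_R u) = eval_fps (oct_fps m n) (oct_R u)"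
        using elim oct_conv_radius[of m n]
        by (subst hyp2f1_eq_series) (auto simp: eval_fps_def fps_hypergeo_nth)
      also have "\<dots> = p_e u powr (2 * oct_a m n) * H u"
        using oct_germD[of u] elim(2) by (simp add: H_def powr_minus)
      also have "2 * oct_a m n = -1/12 - of_int m - of_int n" by (simp add: oct_a_def algebra_simps)
      finally show ?case using elim by (simp add: oct_a_def oct_b_def oct_c_def)
    qed
  qed
  from octahedral_r_eqI[OF this] fr[OF assms(2)] show ?thesis by simp
qed

definition oct_grad :: "complex \<Rightarrow> (complex \<Rightarrow> complex) \<Rightarrow> complex \<Rightarrow> complex" where
  "oct_grad s f u = (deriv f u + s * p_e' u / p_e u * f u) / oct_R' u"

definition oct_step :: "complex poly \<Rightarrow> complex poly \<Rightarrow> int \<Rightarrow> complex \<Rightarrow> (complex \<Rightarrow> complex) \<Rightarrow> complex \<Rightarrow> complex" where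
  "oct_step \<alpha> \<beta> \<delta> s f u = p_e u powi \<delta> * (poly \<alpha> (oct_R u) * oct_grad s f u + poly \<beta> (oct_R u) * f u)"

lemma oct_domD: "u \<in> oct_dom \<Longrightarrow> u \<noteq> 0 \<and> 1 - u \<noteq> 0 \<and> p_f u \<noteq> 0 \<and> p_e u \<noteq> 0 \<and> oct_R' u \<noteq> 0"
  by (auto simp: oct_dom_def oct_R'_def)

lemma rational_on_oct_step:
  assumes "rational_on oct_dom f"
  shows "rational_on oct_dom (oct_step \<alpha> \<beta> \<delta> s f)"
proof -
  have e: "rational_on oct_dom p_e" by (rule rational_onI[of _ 1 _ "[:1, -33, -33, 1:]"])
    (simp add: p_e_def algebra_simps power2_eq_square)
  have f: "rational_on oct_dom p_f" by (rule rational_onI[of _ 1 _ "[:1, 14, 1:]"])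
    (simp add: p_f_def algebra_simps power2_eq_square)
  have v: "rational_on oct_dom p_v" by (rule rational_onI[of _ 1 _ "[:0, 1:] * [:1, -1:] ^ 4"])
    (simp add: p_v_def)
  have d: "rational_on oct_dom (\<lambda>u. 3 * (u\<^sup>2 - 22 * u - 11))" by (rule rational_onI[of _ 1 _ "[:-33, -66, 3:]"])
    (simp add: algebra_simps power2_eq_square)
  have l: "rational_on oct_dom (\<lambda>u. 1 - u)" by (rule rational_onI[of _ 1 _ "[:1, -1:]"]) simp
  have R: "rational_on oct_dom oct_R" unfolding oct_R_def [abs_def]
    by (intro rational_on_divide rational_on_mult rational_on_const rational_on_power e v) (auto dest: oct_domD)
  have R': "rational_on oct_dom oct_R'" unfolding oct_R'_def [abs_def]
    by (intro rational_on_divide rational_on_mult rational_on_const rational_on_power e f l) (auto dest: oct_domD)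
  show ?thesis unfolding oct_step_def [abs_def] oct_grad_def
    by (intro rational_on_mult rational_on_add rational_on_divide rational_on_powi rational_on_compose_poly
        rational_on_deriv rational_on_const assms e R R' d open_oct_dom) (auto dest: oct_domD)
qed

lemma oct_rep_step:
  assumes rep: "oct_rep m n f"
    and step: "oct_fps m' n' = fps_first_order \<alpha> \<beta> (oct_fps m n)"
    and sum: "m' + n' = m + n + \<delta>"
  shows "oct_rep m' n' (oct_step \<alpha> \<beta> \<delta> (2 * oct_a m n) f)"
proof -
  let ?s = "2 * oct_a m n"
  have rat: "rational_on oct_dom f" using rep by (simp add: oct_rep_def)
  obtain T where T: "open T" "0 \<in> T"
    and eqT: "\<And>u. u \<in> T \<Longrightarrow> u \<noteq> 0 \<Longrightarrow> eval_fps (oct_fps m n) (oct_R u) = p_e u powr ?s * f u"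
    and germ: "\<And>u. u \<in> T \<Longrightarrow> u \<in> oct_germ \<and> norm (oct_R u) < 1"
  proof -
    have "\<forall>\<^sub>F u in nhds 0. (u \<noteq> 0 \<longrightarrow> eval_fps (oct_fps m n) (oct_R u) = p_e u powr ?s * f u) \<and> u \<in> oct_germ \<and>
      norm (oct_R u) < 1"
      using rep[unfolded oct_rep_def eventually_at_filter, THEN conjunct2] eventually_oct_germ by eventually_elim simp
    then obtain T where "open T" "0 \<in> T"
      "\<forall>u\<in>T. (u \<noteq> 0 \<longrightarrow> eval_fps (oct_fps m n) (oct_R u) = p_e u powr ?s * f u) \<and> u \<in> oct_germ \<and> norm (oct_R u) < 1"
      unfolding eventually_nhds by blast
    then show thesis by (intro that[of T]) auto
  qed
  have "eval_fps (oct_fps m' n') (oct_R u) = p_e u powr (2 * oct_a m' n') * oct_step \<alpha> \<beta> \<delta> ?s f u"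
    if u: "u \<in> T" "u \<noteq> 0" for u
  proof -
    have ug: "p_e u \<noteq> 0" "p_e u \<notin> \<real>\<^sub>\<le>\<^sub>0" "oct_R' u \<noteq> 0" and uT: "norm (oct_R u) < 1"
      using germ[OF u(1)] oct_germD[of u] by auto
    have "u \<in> oct_dom" using germ[OF u(1)] oct_germ_dom u(2) by blast
    then have Df: "(f has_field_derivative deriv f u) (at u)"
      using rational_on_deriv(2)[OF rat open_oct_dom] by blast
    have "((\<lambda>u. p_e u powr ?s * f u) has_field_derivative p_e u powr ?s * (?s * p_e' u / p_e u) * f u +
      deriv f u * p_e u powr ?s) (at u)"
      by (rule DERIV_mult[OF DERIV_p_e_powr[OF ug(2)] Df])
    then have 1: "((\<lambda>u. eval_fps (oct_fps m n) (oct_R u)) has_field_derivative p_e u powr ?s *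
      (?s * p_e' u / p_e u) * f u + deriv f u * p_e u powr ?s) (at u)"
      by (rule has_field_derivative_transform_within_open[of _ _ _ "T - {0}"]) (use T(1) u eqT in auto)
    have "ereal (norm (oct_R u)) < fps_conv_radius (oct_fps m n)" using uT by (simp add: oct_conv_radius)
    then have 2: "((\<lambda>u. eval_fps (oct_fps m n) (oct_R u)) has_field_derivative eval_fps (fps_deriv (oct_fps m n)) (oct_R u) * oct_R' u) (at u)"
      by (intro DERIV_chain2[OF has_field_derivative_eval_fps DERIV_oct_R[OF ug(1)]])
    have grad: "eval_fps (fps_deriv (oct_fps m n)) (oct_R u) = p_e u powr ?s * oct_grad ?s f u"
      using DERIV_unique[OF 1 2] ug(1,3) by (simp add: oct_grad_def divide_simps) (simp add: algebra_simps)
    have "2 * oct_a m' n' + of_int \<delta> = ?s"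
      using arg_cong[OF sum, of "of_int :: int \<Rightarrow> complex"] by (simp add: oct_a_def algebra_simps)
    then have "p_e u powr ?s = p_e u powr (2 * oct_a m' n') * p_e u powi \<delta>"
      using ug(1) complex_powr_of_int[of "p_e u" \<delta>] powr_add[of "p_e u" "2 * oct_a m' n'" "of_int \<delta>"] by simp
    moreover have "eval_fps (oct_fps m' n') (oct_R u) = poly \<alpha> (oct_R u) * (p_e u powr ?s * oct_grad ?s f u)
        + poly \<beta> (oct_R u) * (p_e u powr ?s * f u)"
      using eval_fps_first_order[OF step _ uT] unfolding grad eqT[OF u] by (simp add: oct_conv_radius)
    ultimately show ?thesis by (simp add: oct_step_def algebra_simps)
  qed
  then have "\<forall>\<^sub>F u in at 0. eval_fps (oct_fps m' n') (oct_R u) = p_e u powr (2 * oct_a m' n') * oct_step \<alpha> \<beta> \<delta> ?s f u"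
    unfolding eventually_at_topological using T by blast
  then show ?thesis using rational_on_oct_step[OF rat] by (simp add: oct_rep_def)
qed

lemma hyp_fps_commute: "hyp_fps a b c = hyp_fps b a c"
  by (rule fps_ext) (simp add: fps_hypergeo_nth mult_ac)

definition up_n :: "int \<Rightarrow> int \<Rightarrow> complex poly \<times> complex poly" where
  "up_n m n = (let d = oct_c m - oct_b m n in ([:0, 1/d, -1/d:], [:1, -oct_a m n / d:]))"
definition down_n :: "int \<Rightarrow> int \<Rightarrow> complex poly \<times> complex poly" where
  "down_n m n = ([:0, 1 / oct_a m n:], [:1:])"
definition up_m :: "int \<Rightarrow> int \<Rightarrow> complex poly \<times> complex poly" where
  "up_m m n = (let d = oct_c m - 1 in ([:0, 1/d, -1/d:], [:1, -oct_a m n / d:]))"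
definition down_m :: "int \<Rightarrow> int \<Rightarrow> complex poly \<times> complex poly" where
  "down_m m n = (let d = oct_c m - oct_b m n; k = oct_c m / (oct_a m n * d) in ([:-k, k:], [:oct_c m / d:]))"

text \<open>
  Since \<open>oct_b = oct_a + 1/2\<close>, a step in \<open>m\<close> or \<open>n\<close> replaces \<open>(a, b)\<close> by \<open>(b - 1, a)\<close> or
  \<open>(b, a + 1)\<close>.
\<close>

lemma oct_fps_ladder:
  "oct_fps m (n + 1) = fps_first_order (fst (up_n m n)) (snd (up_n m n)) (oct_fps m n)" (is ?up_n)
  "oct_fps m (n - 1) = fps_first_order (fst (down_n m n)) (snd (down_n m n)) (oct_fps m n)" (is ?down_n)
  "oct_fps (m + 1) n = fps_first_order (fst (up_m m n)) (snd (up_m m n)) (oct_fps m n)" (is ?up_m)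
  "oct_fps (m - 1) n = fps_first_order (fst (down_m m n)) (snd (down_m m n)) (oct_fps m n)" (is ?down_m)
proof -
  have nz: "oct_a m n \<noteq> 0" "oct_c m \<noteq> oct_b m n"
    using oct_params_nonint(1)[of m n] oct_params_nonint(4)[of m n] by auto
  have up: "hyp_fps (oct_a m (n + 1)) (oct_b m (n + 1)) c = hyp_fps (oct_a m n) (oct_b m n - 1) c"
    "hyp_fps (oct_a (m + 1) n) (oct_b (m + 1) n) c = hyp_fps (oct_a m n) (oct_b m n - 1) c" for c
    by (subst hyp_fps_commute; rule arg_cong2[of _ _ _ _ "\<lambda>a b. hyp_fps a b c"]; simp add: oct_a_def oct_b_def field_simps)+
  have down: "hyp_fps (oct_a m (n - 1)) (oct_b m (n - 1)) c = hyp_fps (oct_a m n + 1) (oct_b m n) c"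
    "hyp_fps (oct_a (m - 1) n) (oct_b (m - 1) n) c = hyp_fps (oct_a m n + 1) (oct_b m n) c" for c
    by (subst hyp_fps_commute; rule arg_cong2[of _ _ _ _ "\<lambda>a b. hyp_fps a b c"]; simp add: oct_a_def oct_b_def field_simps)+
  have c: "oct_c (m + 1) = oct_c m - 1" "oct_c (m - 1) = oct_c m + 1" by (simp_all add: oct_c_def)
  note ni = oct_params_nonint(3)[of m]
  show ?up_n
    unfolding up hyp_fps_lower[OF ni nz(2)] by (simp add: up_n_def Let_def)
  show ?down_n
    unfolding down hyp_fps_raise[OF ni nz(1)] by (simp add: down_n_def)
  show ?up_m
    unfolding up c hyp_fps_lower_lower[OF ni] by (simp add: up_m_def Let_def)
  show ?down_m
    unfolding down c hyp_fps_raise_raise[OF ni nz] by (simp add: down_m_def Let_def)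
qed

lemma oct_rep_base: "oct_rep 0 0 (\<lambda>_. 1)"
proof -
  have "eval_fps (oct_fps 0 0) = hyp_ser (-1/24) (11/24) (3/4)" "2 * oct_a 0 0 = -1/12"
    by (simp_all add: oct_a_def oct_b_def oct_c_def)
  then show ?thesis
    using oct_base_germ by (auto simp: oct_rep_def rational_on_const eventually_at_filter elim: eventually_mono)
qed

lemma int_pair_induct [case_names base up_m down_m up_n down_n]:
  fixes m n :: int
  assumes "P 0 0" "\<And>m n. P m n \<Longrightarrow> P (m + 1) n" "\<And>m n. P m n \<Longrightarrow> P (m - 1) n"
    "\<And>m n. P m n \<Longrightarrow> P m (n + 1)" "\<And>m n. P m n \<Longrightarrow> P m (n - 1)"
  shows "P m n"
proof -
  have "P m 0" by (induction m rule: int_induct[of _ 0]) (use assms in auto)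
  then show ?thesis by (induction n rule: int_induct[of _ 0]) (use assms in auto)
qed

lemma oct_rep_exists: "\<exists>f. oct_rep m n f"
proof (induction m n rule: int_pair_induct)
  case base
  show ?case using oct_rep_base by blast
next
  case (up_m m n)
  then show ?case using oct_rep_step[OF _ oct_fps_ladder(3), of m n _ 1] by auto
next
  case (down_m m n)
  then show ?case using oct_rep_step[OF _ oct_fps_ladder(4), of m n _ "-1"] by auto
next
  case (up_n m n)
  then show ?case using oct_rep_step[OF _ oct_fps_ladder(1), of m n _ 1] by auto
next
  case (down_n m n)
  then show ?case using oct_rep_step[OF _ oct_fps_ladder(2), of m n _ "-1"] by auto
qed

lemma oct_rep_octahedral: "oct_rep m n (octahedral_r m n)"
proof -
  obtain f where f: "oct_rep m n f" using oct_rep_exists by blast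
  then have eq: "\<And>u. u \<in> oct_dom \<Longrightarrow> octahedral_r m n u = f u" by (rule oct_rep_octahedral_r)
  have "rational_on oct_dom (octahedral_r m n)"
    using f eq unfolding oct_rep_def rational_on_def by simp
  moreover have "\<forall>\<^sub>F u in at 0. u \<in> oct_dom"
    using eventually_oct_germ unfolding eventually_at_filter by eventually_elim (simp add: oct_germ_dom)
  then have "\<forall>\<^sub>F u in at 0. eval_fps (oct_fps m n) (oct_R u) = p_e u powr (2 * oct_a m n) * octahedral_r m n u"
    using f[unfolded oct_rep_def, THEN conjunct2] by eventually_elim (simp add: eq)
  ultimately show ?thesis by (simp add: oct_rep_def)
qed

lemma octahedral_r_base: "u \<in> oct_dom \<Longrightarrow> octahedral_r 0 0 u = 1"
  by (rule oct_rep_octahedral_r[OF oct_rep_base])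

lemma octahedral_r_step:
  assumes "oct_fps m' n' = fps_first_order \<alpha> \<beta> (oct_fps m n)"
    and "m' + n' = m + n + \<delta>" "u \<in> oct_dom"
  shows "octahedral_r m' n' u = oct_step \<alpha> \<beta> \<delta> (2 * oct_a m n) (octahedral_r m n) u"
  by (rule oct_rep_octahedral_r[OF oct_rep_step[OF oct_rep_octahedral assms(1,2)] assms(3)])

lemma octahedral_r_DERIV:
  "u \<in> oct_dom \<Longrightarrow> (octahedral_r m n has_field_derivative deriv (octahedral_r m n) u) (at u)"
  using rational_on_deriv(2)[OF _ open_oct_dom] oct_rep_octahedral unfolding oct_rep_def by blast

section \<open>Ladder relations in \<open>\<xi>\<close>\<close>

definition oct_ladder :: "(int \<Rightarrow> int \<Rightarrow> real \<Rightarrow> complex) \<Rightarrow> int \<Rightarrow> int \<Rightarrow> real \<Rightarrow> complex \<Rightarrow> bool" where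
  "oct_ladder E m n \<xi> d \<longleftrightarrow> (E m n has_vector_derivative d) (at \<xi>) \<and>
     (oct_c m - oct_b m n) * E m (n + 1) \<xi> = 4 * (of_real (sinh \<xi>) * d + (1/3 + of_int n) * of_real (cosh \<xi>) * E m n \<xi>) \<and>
     16 * oct_a m n * E m (n - 1) \<xi> = of_real (sinh \<xi>) * d - (1/3 + of_int n) * of_real (cosh \<xi>) * E m n \<xi> \<and>
     (oct_c m - 1) * of_real (sinh \<xi>) * E (m + 1) n \<xi> =
       4 * of_real (sinh \<xi>) * d - (3 + 4 * of_int m) * of_real (cosh \<xi>) * E m n \<xi> \<and>
     - 16 * oct_a m n * (oct_c m - oct_b m n) * of_real (sinh \<xi>) * E (m - 1) n \<xi> =
       oct_c m * (of_real (sinh \<xi>) * d - (1/4 - of_int m) * of_real (cosh \<xi>) * E m n \<xi>)"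

definition oct_family :: "(int \<Rightarrow> int \<Rightarrow> real \<Rightarrow> complex) \<Rightarrow> bool" where
  "oct_family E \<longleftrightarrow> (\<forall>m n \<xi>. \<xi> > 0 \<longrightarrow> (\<exists>d. oct_ladder E m n \<xi> d))"

lemma oct_ladderD:
  assumes "oct_ladder E m n \<xi> d"
  shows "(E m n has_vector_derivative d) (at \<xi>)"
    "(oct_c m - oct_b m n) * E m (n + 1) \<xi> = 4 * (of_real (sinh \<xi>) * d + (1/3 + of_int n) * of_real (cosh \<xi>) * E m n \<xi>)"
    "16 * oct_a m n * E m (n - 1) \<xi> = of_real (sinh \<xi>) * d - (1/3 + of_int n) * of_real (cosh \<xi>) * E m n \<xi>"
    "(oct_c m - 1) * of_real (sinh \<xi>) * E (m + 1) n \<xi> =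
       4 * of_real (sinh \<xi>) * d - (3 + 4 * of_int m) * of_real (cosh \<xi>) * E m n \<xi>"
    "- 16 * oct_a m n * (oct_c m - oct_b m n) * of_real (sinh \<xi>) * E (m - 1) n \<xi> =
       oct_c m * (of_real (sinh \<xi>) * d - (1/4 - of_int m) * of_real (cosh \<xi>) * E m n \<xi>)"
  using assms unfolding oct_ladder_def by blast+

lemma oct_family_lincomb:
  assumes "oct_family E" "oct_family F"
  shows "oct_family (\<lambda>m n \<xi>. x * E m n \<xi> + y * F m n \<xi>)"
  unfolding oct_family_def
proof (intro allI impI)
  fix m n :: int and \<xi> :: real assume "\<xi> > 0"
  obtain d where "oct_ladder E m n \<xi> d"
    using assms(1) \<open>\<xi> > 0\<close> unfolding oct_family_def by blast
  note d = oct_ladderD[OF this]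
  obtain e where "oct_ladder F m n \<xi> e"
    using assms(2) \<open>\<xi> > 0\<close> unfolding oct_family_def by blast
  note e = oct_ladderD[OF this]
  have lin: "k * (x * u + y * v) = x * (k * u) + y * (k * v)" for k u v :: complex
    by (simp add: algebra_simps)
  show "\<exists>d. oct_ladder (\<lambda>m n \<xi>. x * E m n \<xi> + y * F m n \<xi>) m n \<xi> d"
    unfolding oct_ladder_def lin d e
    by (intro exI[of _ "x * d + y * e"] conjI has_vector_derivative_add has_vector_derivative_mult_right d e)
      (simp_all add: algebra_simps)
qed

lemma oct_family_unique:
  assumes "oct_family E" "oct_family F" and base: "\<And>\<xi>. \<xi> > 0 \<Longrightarrow> E 0 0 \<xi> = F 0 0 \<xi>" and "\<xi> > 0"
  shows "E m n \<xi> = F m n \<xi>"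
proof -
  have "\<forall>\<xi>>0. E m n \<xi> = F m n \<xi>"
  proof (induction m n rule: int_pair_induct)
    case base
    then show ?case using assms(3) by blast
  next
    fix m n assume eq: "\<forall>\<xi>>0. E m n \<xi> = F m n \<xi>"
    have nz: "oct_c m - oct_b m n \<noteq> 0" "oct_a m n \<noteq> 0" "oct_c m - 1 \<noteq> 0"
      using oct_params_nonint(1)[of m n] oct_params_nonint(4)[of m n] oct_params_nonint(6)[of m] by (metis Ints_0)+
    have all: "E m (n + 1) \<xi> = F m (n + 1) \<xi> \<and> E m (n - 1) \<xi> = F m (n - 1) \<xi> \<and>
      E (m + 1) n \<xi> = F (m + 1) n \<xi> \<and> E (m - 1) n \<xi> = F (m - 1) n \<xi>" if \<xi>: "\<xi> > 0" for \<xi>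
    proof -
      have s: "complex_of_real (sinh \<xi>) \<noteq> 0" using \<xi> by simp
      obtain d where "oct_ladder E m n \<xi> d"
        using assms(1) \<open>\<xi> > 0\<close> unfolding oct_family_def by blast
      note d = oct_ladderD[OF this]
      obtain e where "oct_ladder F m n \<xi> e"
        using assms(2) \<open>\<xi> > 0\<close> unfolding oct_family_def by blast
      note e = oct_ladderD[OF this]
      have "(E m n has_vector_derivative e) (at \<xi>)"
        by (rule has_vector_derivative_transform_within_open[OF e(1), of "{0<..}"]) (use eq \<xi> in auto)
      then have "d = e" by (rule vector_derivative_unique_at[OF d(1)])
      then have "(oct_c m - oct_b m n) * E m (n + 1) \<xi> = (oct_c m - oct_b m n) * F m (n + 1) \<xi>"
        "16 * oct_a m n * E m (n - 1) \<xi> = 16 * oct_a m n * F m (n - 1) \<xi>"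
        "(oct_c m - 1) * of_real (sinh \<xi>) * E (m + 1) n \<xi> = (oct_c m - 1) * of_real (sinh \<xi>) * F (m + 1) n \<xi>"
        "- 16 * oct_a m n * (oct_c m - oct_b m n) * of_real (sinh \<xi>) * E (m - 1) n \<xi> =
         - 16 * oct_a m n * (oct_c m - oct_b m n) * of_real (sinh \<xi>) * F (m - 1) n \<xi>"
        unfolding d(2-) e(2-) using eq \<xi> by simp_all
      then show ?thesis using nz s by simp
    qed
    then show "\<forall>\<xi>>0. E (m + 1) n \<xi> = F (m + 1) n \<xi>" "\<forall>\<xi>>0. E (m - 1) n \<xi> = F (m - 1) n \<xi>"
      "\<forall>\<xi>>0. E m (n + 1) \<xi> = F m (n + 1) \<xi>" "\<forall>\<xi>>0. E m (n - 1) \<xi> = F m (n - 1) \<xi>" by blast+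
  qed
  then show ?thesis using assms(4) by blast
qed

lemma DERIV_powr_log:
  fixes f :: "real \<Rightarrow> real"
  assumes "(f has_real_derivative f') (at x)" "f x > 0"
  shows "((\<lambda>x. f x powr k) has_real_derivative f x powr k * (k * (f' / f x))) (at x)"
  using DERIV_fun_powr[OF assms, of k] assms(2) by (simp add: powr_diff mult_ac)

text \<open>
  The sign \<open>\<epsilon>\<close> is that of \<open>p_e\<close> along the branch; it produces the factors \<open>(-1) powi n\<close> and
  \<open>(-1) powi m\<close> of the theorem.
\<close>

locale oct_branch =
  fixes A U A' U' :: "real \<Rightarrow> real" and \<epsilon> :: real
  assumes eps: "\<epsilon> * \<epsilon> = 1"
    and A_pos: "\<And>\<xi>. \<xi> > 0 \<Longrightarrow> A \<xi> > 0"
    and A_deriv: "\<And>\<xi>. \<xi> > 0 \<Longrightarrow> (A has_real_derivative A' \<xi>) (at \<xi>)"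
    and U_deriv: "\<And>\<xi>. \<xi> > 0 \<Longrightarrow> (U has_real_derivative U' \<xi>) (at \<xi>)"
    and U_dom: "\<And>\<xi>. \<xi> > 0 \<Longrightarrow> of_real (U \<xi>) \<in> oct_dom"
    and p_e_U: "\<And>\<xi>. \<xi> > 0 \<Longrightarrow> p_e (of_real (U \<xi>)) = of_real (\<epsilon> * (8 * cosh \<xi>) / A \<xi> ^ 3)"
    and R_U: "\<And>\<xi>. \<xi> > 0 \<Longrightarrow> oct_R (of_real (U \<xi>)) = of_real ((sinh \<xi> / cosh \<xi>)\<^sup>2)"
begin

definition pref :: "int \<Rightarrow> int \<Rightarrow> real \<Rightarrow> real" where
  "pref m n \<xi> = \<epsilon> powi (m + n) * (sinh \<xi> powr (1/4 - of_int m) * A \<xi> powr (1/4 + 3 * of_int m + 3 * of_int n))"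

definition E :: "int \<Rightarrow> int \<Rightarrow> real \<Rightarrow> complex" where
  "E m n \<xi> = of_real (pref m n \<xi>) * octahedral_r m n (of_real (U \<xi>))"

lemma eps_nz: "\<epsilon> \<noteq> 0" using eps by auto

lemma chain:
  fixes f :: "complex \<Rightarrow> complex"
  assumes "(f has_field_derivative f') (at (of_real (U \<xi>)))" "\<xi> > 0"
  shows "((\<lambda>\<xi>. f (of_real (U \<xi>))) has_vector_derivative of_real (U' \<xi>) * f') (at \<xi>)"
  using field_vector_diff_chain_at[of "\<lambda>\<xi>. complex_of_real (U \<xi>)" "of_real (U' \<xi>)" \<xi> f f']
    has_vector_derivative_of_real[of U "U' \<xi>" "at \<xi>"] U_deriv[OF assms(2)] assms(1)
  by (simp add: o_def has_real_derivative_iff_has_vector_derivative)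

lemma transfer_deriv:
  fixes f :: "complex \<Rightarrow> complex"
  assumes "(f has_field_derivative f') (at (of_real (U \<xi>)))" "\<xi> > 0"
    and "\<And>\<xi>. \<xi> > 0 \<Longrightarrow> f (of_real (U \<xi>)) = of_real (g \<xi>)" "(g has_real_derivative g') (at \<xi>)"
  shows "of_real (U' \<xi>) * f' = of_real g'"
proof (rule vector_derivative_unique_at[OF chain[OF assms(1,2)]])
  have "((\<lambda>\<xi>. complex_of_real (g \<xi>)) has_vector_derivative of_real g') (at \<xi>)"
    using assms(4) by (intro has_vector_derivative_of_real) (simp add: has_real_derivative_iff_has_vector_derivative)
  then show "((\<lambda>\<xi>. f (of_real (U \<xi>))) has_vector_derivative of_real g') (at \<xi>)"
    by (rule has_vector_derivative_transform_within_open[of _ _ _ "{0<..}"]) (use assms in auto)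
qed

lemma p_e_deriv:
  assumes "\<xi> > 0"
  shows "of_real (U' \<xi>) * p_e' (of_real (U \<xi>)) =
    p_e (of_real (U \<xi>)) * of_real (sinh \<xi> / cosh \<xi> - 3 * A' \<xi> / A \<xi>)"
proof -
  have "((\<lambda>\<xi>. \<epsilon> * (8 * cosh \<xi>) / A \<xi> ^ 3) has_real_derivative
      (\<epsilon> * (8 * sinh \<xi>) * A \<xi> ^ 3 - \<epsilon> * (8 * cosh \<xi>) * (3 * A' \<xi> * A \<xi> ^ 2)) / (A \<xi> ^ 3 * A \<xi> ^ 3)) (at \<xi>)"
    using A_pos[OF assms] by (auto intro!: derivative_eq_intros A_deriv assms simp: algebra_simps)
  from transfer_deriv[OF DERIV_p_e assms p_e_U this]
  have "of_real (U' \<xi>) * p_e' (of_real (U \<xi>)) =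
     complex_of_real ((\<epsilon> * (8 * sinh \<xi>) * A \<xi> ^ 3 - \<epsilon> * (8 * cosh \<xi>) * (3 * A' \<xi> * A \<xi> ^ 2)) / (A \<xi> ^ 3 * A \<xi> ^ 3))" .
  also have "(\<epsilon> * (8 * sinh \<xi>) * A \<xi> ^ 3 - \<epsilon> * (8 * cosh \<xi>) * (3 * A' \<xi> * A \<xi> ^ 2)) / (A \<xi> ^ 3 * A \<xi> ^ 3)
     = (\<epsilon> * (8 * cosh \<xi>) / A \<xi> ^ 3) * (sinh \<xi> / cosh \<xi> - 3 * A' \<xi> / A \<xi>)"
    using A_pos[OF assms] by (simp add: field_simps power_numeral_reduce)
  finally show ?thesis unfolding p_e_U[OF assms] of_real_mult .
qed

lemma R_deriv:
  assumes "\<xi> > 0"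
  shows "of_real (U' \<xi>) * oct_R' (of_real (U \<xi>)) = of_real (2 * sinh \<xi> / cosh \<xi> ^ 3)"
proof -
  have "((\<lambda>\<xi>. (sinh \<xi> / cosh \<xi>)\<^sup>2) has_real_derivative
      2 * (sinh \<xi> / cosh \<xi>) * ((cosh \<xi> * cosh \<xi> - sinh \<xi> * sinh \<xi>) / (cosh \<xi> * cosh \<xi>))) (at \<xi>)"
    by (auto intro!: derivative_eq_intros simp: mult_ac)
  also have "cosh \<xi> * cosh \<xi> - sinh \<xi> * sinh \<xi> = 1"
    using cosh_square_eq[of \<xi>] by (simp add: power2_eq_square)
  finally have "of_real (U' \<xi>) * oct_R' (of_real (U \<xi>)) = of_real (2 * (sinh \<xi> / cosh \<xi>) * (1 / (cosh \<xi> * cosh \<xi>)))"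
    using oct_domD[OF U_dom[OF assms]] by (intro transfer_deriv[OF DERIV_oct_R assms R_U]) auto
  then show ?thesis by (simp add: power_numeral_reduce)
qed

lemma pref_deriv:
  assumes "\<xi> > 0"
  shows "(pref m n has_real_derivative pref m n \<xi> *
    ((1/4 - of_int m) * (cosh \<xi> / sinh \<xi>) + (1/4 + 3 * of_int m + 3 * of_int n) * (A' \<xi> / A \<xi>))) (at \<xi>)"
proof -
  have "sinh \<xi> > 0" using assms by simp
  have sinh: "(sinh has_real_derivative cosh \<xi>) (at \<xi>)" by (auto intro!: derivative_eq_intros)
  show ?thesis
    unfolding pref_def [abs_def]
    by (rule DERIV_cong[OF DERIV_cmult[OF DERIV_mult[OF DERIV_powr_log[OF sinh \<open>sinh \<xi> > 0\<close>]
      DERIV_powr_log[OF A_deriv A_pos]]]])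
       (use assms in \<open>auto simp: algebra_simps\<close>)
qed

lemma E_deriv:
  assumes "\<xi> > 0"
  defines "u \<equiv> complex_of_real (U \<xi>)"
  shows "(E m n has_vector_derivative of_real (pref m n \<xi>) *
    (((1/4 - of_int m) * of_real (cosh \<xi> / sinh \<xi>) - 2 * oct_a m n * of_real (sinh \<xi> / cosh \<xi>)) * octahedral_r m n u
      + of_real (2 * sinh \<xi> / cosh \<xi> ^ 3) * oct_grad (2 * oct_a m n) (octahedral_r m n) u)) (at \<xi>)"
proof -
  have u: "u \<in> oct_dom" using U_dom[OF assms(1)] by (simp add: u_def)
  note nz = oct_domD[OF u]
  let ?r = "octahedral_r m n" and ?s = "2 * oct_a m n"
  define l where "l = A' \<xi> / A \<xi>"
  have D: "(E m n has_vector_derivative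
     of_real (pref m n \<xi>) * (of_real (U' \<xi>) * deriv ?r u) + of_real (pref m n \<xi> *
    ((1/4 - of_int m) * (cosh \<xi> / sinh \<xi>) + (1/4 + 3 * of_int m + 3 * of_int n) * l)) * ?r u) (at \<xi>)"
    unfolding E_def [abs_def] u_def l_def
    by (intro has_vector_derivative_mult chain octahedral_r_DERIV U_dom assms has_vector_derivative_of_real)
      (use pref_deriv[OF assms(1), of m n] in \<open>simp add: has_real_derivative_iff_has_vector_derivative\<close>)
  have e1: "of_real (U' \<xi>) * deriv ?r u = of_real (2 * sinh \<xi> / cosh \<xi> ^ 3) * oct_grad ?s ?r u
      - ?s * of_real (sinh \<xi> / cosh \<xi> - 3 * l) * ?r u"
  proof -
    have "oct_R' u * oct_grad ?s ?r u = deriv ?r u + ?s * p_e' u / p_e u * ?r u"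
      using nz by (simp add: oct_grad_def)
    then have "(of_real (U' \<xi>) * oct_R' u) * oct_grad ?s ?r u =
       of_real (U' \<xi>) * deriv ?r u + ?s * (of_real (U' \<xi>) * p_e' u) / p_e u * ?r u"
      by (simp only: mult.assoc distrib_left times_divide_eq_right times_divide_eq_left mult.left_commute)
    also have "of_real (U' \<xi>) * p_e' u = p_e u * of_real (sinh \<xi> / cosh \<xi> - 3 * l)"
      using p_e_deriv[OF assms(1)] by (simp add: u_def l_def)
    also have "of_real (U' \<xi>) * oct_R' u = of_real (2 * sinh \<xi> / cosh \<xi> ^ 3)"
      using R_deriv[OF assms(1)] by (simp add: u_def)
    finally show ?thesis using nz by simp
  qed
  have e2: "complex_of_real (pref m n \<xi> * ((1/4 - of_int m) * (cosh \<xi> / sinh \<xi>) + (1/4 + 3 * of_int m + 3 * of_int n) * l)) =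
      of_real (pref m n \<xi>) * ((1/4 - of_int m) * of_real (cosh \<xi> / sinh \<xi>) - 3 * ?s * of_real l)"
    by (simp add: oct_a_def algebra_simps)
  have "(E m n has_vector_derivative
     of_real (pref m n \<xi>) * (of_real (2 * sinh \<xi> / cosh \<xi> ^ 3) * oct_grad ?s ?r u
      - ?s * of_real (sinh \<xi> / cosh \<xi> - 3 * l) * ?r u) +
     of_real (pref m n \<xi>) * ((1/4 - of_int m) * of_real (cosh \<xi> / sinh \<xi>) - 3 * ?s * of_real l) * ?r u) (at \<xi>)"
    by (rule D[unfolded e1 e2])
  also have "p * (g - k * of_real (t - 3 * l) * q) + p * (w - 3 * k * of_real l) * q = p * ((w - k * of_real t) * q + g)"
    for p g k q w :: complex and t
    by (simp add: algebra_simps)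
  finally show ?thesis .
qed

lemma E_shift:
  assumes "\<xi> > 0"
    and ij: "m' = m + i" "n' = n + j"
    and step: "oct_fps m' n' = fps_first_order \<alpha> \<beta> (oct_fps m n)"
  defines "u \<equiv> complex_of_real (U \<xi>)" and "x \<equiv> complex_of_real ((sinh \<xi> / cosh \<xi>)\<^sup>2)"
  shows "E m' n' \<xi> = of_real (pref m n \<xi>) * of_real (sinh \<xi> powi (- i) * (8 * cosh \<xi>) powi (i + j)) *
    (poly \<alpha> x * oct_grad (2 * oct_a m n) (octahedral_r m n) u + poly \<beta> x * octahedral_r m n u)"
proof -
  have u: "u \<in> oct_dom" using U_dom[OF assms(1)] by (simp add: u_def)
  have S: "sinh \<xi> > 0" and A: "A \<xi> > 0" using assms(1) A_pos by auto
  have "sinh \<xi> powr (1/4 - of_int (m + i)) = sinh \<xi> powr (1/4 - of_int m) * sinh \<xi> powr of_int (- i)"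
    unfolding powr_add [symmetric] by (simp add: algebra_simps)
  moreover have "sinh \<xi> powr of_int (- i) = sinh \<xi> powi (- i)"
    using S by (intro powr_real_of_int') auto
  moreover have "A \<xi> powr (1/4 + 3 * of_int (m + i) + 3 * of_int (n + j)) =
      A \<xi> powr (1/4 + 3 * of_int m + 3 * of_int n) * A \<xi> powr of_int (3 * (i + j))"
    unfolding powr_add [symmetric] by (simp add: algebra_simps)
  moreover have "A \<xi> powr of_int (3 * (i + j)) = (A \<xi> ^ 3) powi (i + j)"
    using A power_int_mult[of "A \<xi>" 3 "i + j"] powr_real_of_int'[of "A \<xi>" "3 * (i + j)"] by simp
  moreover have "\<epsilon> powi (m + i + (n + j)) = \<epsilon> powi (m + n) * \<epsilon> powi (i + j)"
    using eps_nz by (simp add: power_int_add [symmetric] algebra_simps)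
  ultimately have pref: "pref (m + i) (n + j) \<xi> = pref m n \<xi> * (\<epsilon> powi (i + j) * sinh \<xi> powi (- i) * (A \<xi> ^ 3) powi (i + j))"
    unfolding pref_def by (simp only: mult_ac)
  have "\<epsilon> powi (i + j) * (A \<xi> ^ 3) powi (i + j) * (\<epsilon> * (8 * cosh \<xi>) / A \<xi> ^ 3) powi (i + j) = (8 * cosh \<xi>) powi (i + j)"
  proof -
    have "\<epsilon> * A \<xi> ^ 3 * (\<epsilon> * (8 * cosh \<xi>) / A \<xi> ^ 3) = (\<epsilon> * \<epsilon>) * (8 * cosh \<xi>)"
      using A by simp
    then show ?thesis unfolding power_int_mult_distrib [symmetric] eps by simp
  qed
  then have P: "pref (m + i) (n + j) \<xi> * (\<epsilon> * (8 * cosh \<xi>) / A \<xi> ^ 3) powi (i + j) =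
    pref m n \<xi> * (sinh \<xi> powi (- i) * (8 * cosh \<xi>) powi (i + j))"
    unfolding pref by (metis mult.assoc mult.left_commute)
  have "E m' n' \<xi> = of_real (pref (m + i) (n + j) \<xi>) * (of_real ((\<epsilon> * (8 * cosh \<xi>) / A \<xi> ^ 3) powi (i + j)) *
     (poly \<alpha> x * oct_grad (2 * oct_a m n) (octahedral_r m n) u + poly \<beta> x * octahedral_r m n u))"
    using octahedral_r_step[OF step _ u, of "i + j"] unfolding E_def u_def[symmetric] ij oct_step_def
    by (simp add: u_def x_def p_e_U[OF assms(1)] R_U[OF assms(1)])
  then show ?thesis unfolding mult.assoc[symmetric] of_real_mult[symmetric] using P by (simp only: mult.assoc)
qed

lemma E_family: "oct_family E"
  unfolding oct_family_def
proof (intro allI impI)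
  fix m n :: int and \<xi> :: real assume \<xi>: "\<xi> > 0"
  define s where "s = complex_of_real (sinh \<xi>)"
  define c where "c = complex_of_real (cosh \<xi>)"
  define P where "P = complex_of_real (pref m n \<xi>)"
  define r where "r = octahedral_r m n (of_real (U \<xi>))"
  define \<rho> where "\<rho> = oct_grad (2 * oct_a m n) (octahedral_r m n) (of_real (U \<xi>))"
  define M N where "M = complex_of_int m" and "N = complex_of_int n"
  define d where "d = P * (((1/4 - M) * (c / s) - 2 * oct_a m n * (s / c)) * r + 2 * s / c ^ 3 * \<rho>)"
  define x where "x = s\<^sup>2 / c\<^sup>2"
  have sc: "s \<noteq> 0" "c \<noteq> 0" using \<xi> by (simp_all add: s_def c_def)
  have rel: "s\<^sup>2 = c\<^sup>2 - 1" using arg_cong[OF cosh_square_eq[of \<xi>], of complex_of_real] by (simp add: s_def c_def)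
  define y z where "y = s\<^sup>2 / c" and "z = s\<^sup>2 / c ^ 3"
  have yz: "y = c - 1 / c" "c * x = y" "c * (x * (1 / c\<^sup>2)) = z" "2 / c * x = 2 * z"
    using sc rel by (simp_all add: x_def y_def z_def divide_simps power_numeral_reduce)
  have sd: "s * d = P * (((1/4 - M) * c - 2 * oct_a m n * y) * r + 2 * z * \<rho>)"
    using sc by (simp add: d_def y_def z_def divide_simps) (simp add: algebra_simps power2_eq_square)
  have x1: "1 - x = 1 / c\<^sup>2" using sc by (simp add: x_def rel divide_simps)
  have nz: "oct_c m - oct_b m n \<noteq> 0" "oct_a m n \<noteq> 0" "oct_c m - 1 \<noteq> 0"
    using oct_params_nonint(1)[of m n] oct_params_nonint(4)[of m n] oct_params_nonint(6)[of m] by (metis Ints_0)+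
  have a: "oct_a m n = -1/24 - M / 2 - N / 2" and d0: "oct_c m - oct_b m n = 7/24 - M / 2 + N / 2"
    and d1: "oct_c m - 1 = -1/4 - M"
    by (simp_all add: oct_a_def oct_b_def oct_c_def M_def N_def)
  have D: "(E m n has_vector_derivative d) (at \<xi>)"
    using E_deriv[OF \<xi>, of m n] by (simp add: d_def P_def r_def \<rho>_def s_def c_def M_def)
  have E0: "E m n \<xi> = P * r" by (simp add: E_def P_def r_def)
  have x: "complex_of_real ((sinh \<xi> / cosh \<xi>)\<^sup>2) = x" by (simp add: x_def s_def c_def power_divide)
  have "E m (n + 1) \<xi> = P * (8 * c) * (poly (fst (up_n m n)) x * \<rho> + poly (snd (up_n m n)) x * r)"
    using E_shift[OF \<xi> _ _ oct_fps_ladder(1)[of m n], of 0 1]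
    unfolding P_def r_def \<rho>_def s_def c_def x [symmetric] by simp
  then have "(oct_c m - oct_b m n) * E m (n + 1) \<xi> =
    P * (8 * c) * (x * (1 - x) * \<rho> + ((oct_c m - oct_b m n) - oct_a m n * x) * r)"
    using nz by (simp add: up_n_def Let_def divide_simps) (simp add: algebra_simps)
  also have "\<dots> = P * (8 * (c * (x * (1 / c\<^sup>2))) * \<rho> + 8 * ((oct_c m - oct_b m n) * c - oct_a m n * (c * x)) * r)"
    unfolding x1 by (simp add: algebra_simps)
  also have "\<dots> = 4 * (s * d + (1/3 + N) * c * (P * r))"
    unfolding sd yz(2,3) d0 by (simp add: algebra_simps)
  finally have 1: "(oct_c m - oct_b m n) * E m (n + 1) \<xi> = 4 * (s * d + (1/3 + N) * c * (P * r))" .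
  have "E m (n - 1) \<xi> = P * (1 / (8 * c)) * (poly (fst (down_n m n)) x * \<rho> + poly (snd (down_n m n)) x * r)"
    using E_shift[OF \<xi> _ _ oct_fps_ladder(2)[of m n], of 0 "-1"]
    unfolding P_def r_def \<rho>_def s_def c_def x [symmetric] by (simp add: power_int_minus inverse_eq_divide)
  then have "16 * oct_a m n * E m (n - 1) \<xi> = P * (2 / c) * (x * \<rho> + oct_a m n * r)"
    using nz sc by (simp add: down_n_def divide_simps) (simp add: mult_ac)
  also have "\<dots> = P * ((2 / c * x) * \<rho> + 2 * oct_a m n * (1 / c) * r)"
    by (simp add: algebra_simps)
  also have "\<dots> = s * d - (1/3 + N) * c * (P * r)"
    unfolding sd yz(1,4) a by (simp add: algebra_simps) (simp add: field_simps)
  finally have 2: "16 * oct_a m n * E m (n - 1) \<xi> = s * d - (1/3 + N) * c * (P * r)" .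
  have "E (m + 1) n \<xi> = P * (8 * c / s) * (poly (fst (up_m m n)) x * \<rho> + poly (snd (up_m m n)) x * r)"
    using E_shift[OF \<xi> _ _ oct_fps_ladder(3)[of m n], of 1 0]
    unfolding P_def r_def \<rho>_def s_def c_def x [symmetric] by (simp add: power_int_minus inverse_eq_divide mult_ac)
  then have "(oct_c m - 1) * s * E (m + 1) n \<xi> = P * (8 * c) * (x * (1 - x) * \<rho> + ((oct_c m - 1) - oct_a m n * x) * r)"
    using nz sc by (simp add: up_m_def Let_def divide_simps) (simp add: algebra_simps)
  also have "\<dots> = P * (8 * (c * (x * (1 / c\<^sup>2))) * \<rho> + 8 * ((oct_c m - 1) * c - oct_a m n * (c * x)) * r)"
    unfolding x1 by (simp add: algebra_simps)
  also have "\<dots> = 4 * s * d - (3 + 4 * M) * c * (P * r)"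
    unfolding mult.assoc[of 4 s d] sd yz(2,3) d1 by (simp add: algebra_simps)
  finally have 3: "(oct_c m - 1) * s * E (m + 1) n \<xi> = 4 * s * d - (3 + 4 * M) * c * (P * r)" .
  have "E (m - 1) n \<xi> = P * (s / (8 * c)) * (poly (fst (down_m m n)) x * \<rho> + poly (snd (down_m m n)) x * r)"
    using E_shift[OF \<xi> _ _ oct_fps_ladder(4)[of m n], of "-1" 0]
    unfolding P_def r_def \<rho>_def s_def c_def x [symmetric] by (simp add: power_int_minus inverse_eq_divide mult_ac)
  moreover define k where "k = oct_c m / (oct_a m n * (oct_c m - oct_b m n))"
  have k: "oct_c m / (oct_c m - oct_b m n) = k * oct_a m n" "oct_a m n * (oct_c m - oct_b m n) * k = oct_c m"
    using nz by (simp_all add: k_def)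
  have "poly (fst (down_m m n)) x * \<rho> + poly (snd (down_m m n)) x * r = - k * ((1 - x) * \<rho> - oct_a m n * r)"
    by (simp add: down_m_def Let_def k flip: k_def) (simp add: algebra_simps)
  ultimately have "- 16 * oct_a m n * (oct_c m - oct_b m n) * s * E (m - 1) n \<xi> =
      16 * (oct_a m n * (oct_c m - oct_b m n) * k) * s * (P * (s / (8 * c))) * ((1 - x) * \<rho> - oct_a m n * r)"
    by (simp only: mult_ac minus_mult_left [symmetric] minus_mult_right [symmetric] minus_minus)
  also have "\<dots> = oct_c m * (P * (2 * z * \<rho> - 2 * oct_a m n * y * r))"
    unfolding x1 k using sc
    by (simp add: y_def z_def right_diff_distrib power2_eq_square power3_eq_cube) (simp add: mult_ac)
  also have "\<dots> = oct_c m * (s * d - (1/4 - M) * c * (P * r))"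
    unfolding sd by (simp add: algebra_simps)
  finally have 4: "- 16 * oct_a m n * (oct_c m - oct_b m n) * s * E (m - 1) n \<xi> =
    oct_c m * (s * d - (1/4 - M) * c * (P * r))" .
  show "\<exists>d. oct_ladder E m n \<xi> d"
    using D 1 2 3 4 unfolding oct_ladder_def E0 s_def c_def M_def N_def by blast
qed

end

section \<open>Legendre functions\<close>

lemma hyp_ser_ode:
  assumes "a \<notin> \<int>" "b \<notin> \<int>" "c \<notin> \<int>" "norm y < 1"
  shows "y * (1 - y) * eval_fps (fps_deriv (fps_deriv (hyp_fps a b c))) y +
    (c - (a + b + 1) * y) * hyp_ser' a b c y = a * b * hyp_ser a b c y"
proof -
  let ?F = "hyp_fps a b c"
  have r0: "fps_conv_radius ?F = 1" by (rule hyp_fps_conv_radius[OF assms(1-3)])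
  then have r1: "fps_conv_radius (fps_deriv ?F) \<ge> 1" using fps_conv_radius_deriv[of ?F] by simp
  have "eval_fps (fps_const (a * b) * ?F) y =
    poly [:0, 1, -1:] y * eval_fps (fps_deriv (fps_deriv ?F)) y + poly [:c, -a-b-1:] y * eval_fps (fps_deriv ?F) y"
    by (rule eval_fps_first_order[OF hyp_fps_ode[OF assms(3), symmetric] r1 assms(4)])
  moreover have "eval_fps (fps_const (a * b) * ?F) y = a * b * eval_fps ?F y"
    using assms(4) r0 by (subst eval_fps_mult) auto
  ultimately show ?thesis by (simp add: algebra_simps)
qed

lemma DERIV_hyp_ser:
  assumes "a \<notin> \<int>" "b \<notin> \<int>" "c \<notin> \<int>" "norm y < 1"
  shows "(hyp_ser a b c has_field_derivative hyp_ser' a b c y) (at y)"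
    "(hyp_ser' a b c has_field_derivative eval_fps (fps_deriv (fps_deriv (hyp_fps a b c))) y) (at y)"
proof -
  have r0: "fps_conv_radius (hyp_fps a b c) = 1" by (rule hyp_fps_conv_radius[OF assms(1-3)])
  then have r1: "fps_conv_radius (fps_deriv (hyp_fps a b c)) \<ge> 1" using fps_conv_radius_deriv[of "hyp_fps a b c"] by simp
  have y: "ereal (norm y) < 1" using assms(4) by simp
  show "(hyp_ser a b c has_field_derivative hyp_ser' a b c y) (at y)"
    using r0 y by (intro has_field_derivative_eval_fps) simp
  show "(hyp_ser' a b c has_field_derivative eval_fps (fps_deriv (fps_deriv (hyp_fps a b c))) y) (at y)"
    using r1 y by (intro has_field_derivative_eval_fps) (rule less_le_trans)
qed

lemma pfaff_transformation:
  assumes "a \<notin> \<int>" "c - b \<notin> \<int>" "c \<notin> \<int>" "Re X < 1/2"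
  shows "hyp2f1 a b c X = (1 - X) powr (- a) * hyp_ser a (c - b) c (X / (X - 1))"
proof -
  define S where "S = {x :: complex. Re x < 1/2}"
  define g where "g = hyp_ser a (c - b) c"
  define g1 where "g1 = hyp_ser' a (c - b) c"
  define g2 where "g2 = eval_fps (fps_deriv (fps_deriv (hyp_fps a (c - b) c)))"
  define f where "f = (\<lambda>x. (1 - x) powr (- a) * g (x / (x - 1)))"
  define f1 where "f1 = (\<lambda>x. (1 - x) powr (- a) * (a / (1 - x) * g (x / (x - 1)) - g1 (x / (x - 1)) / (1 - x)\<^sup>2))"
  define f2 where "f2 = (\<lambda>x. (1 - x) powr (- a) * ((a\<^sup>2 + a) / (1 - x)\<^sup>2 * g (x / (x - 1))
      - (2 * a + 2) / (1 - x) ^ 3 * g1 (x / (x - 1)) + g2 (x / (x - 1)) / (1 - x) ^ 4))"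
  have small: "norm (x / (x - 1)) < 1" "1 - x \<noteq> 0" "1 - x \<notin> \<real>\<^sub>\<le>\<^sub>0" if "x \<in> S" for x
  proof -
    have "(Re x)\<^sup>2 < (Re x - 1)\<^sup>2" using that by (simp add: S_def power2_eq_square algebra_simps)
    then have "norm x < norm (x - 1)" by (simp add: cmod_def)
    then show "norm (x / (x - 1)) < 1" by (simp add: norm_divide divide_simps)
    show "1 - x \<notin> \<real>\<^sub>\<le>\<^sub>0" using that by (auto simp: S_def complex_nonpos_Reals_iff)
    then show "1 - x \<noteq> 0" by auto
  qed
  have dpow: "((\<lambda>x. (1 - x) powr (- a)) has_field_derivative (1 - x) powr (- a) * (a / (1 - x))) (at x)" if "x \<in> S" for x
  proof -
    have "((\<lambda>x. (1 - x) powr (- a)) has_field_derivative - a * (1 - x) powr (- a - 1) * (- 1)) (at x)"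
      by (rule DERIV_chain2[where g = "\<lambda>x. 1 - x", OF has_field_derivative_powr[OF small(3)[OF that]]])
        (auto intro!: derivative_eq_intros)
    then show ?thesis using small(2)[OF that] by (simp add: powr_diff mult_ac)
  qed
  have darg: "((\<lambda>x. x / (x - 1)) has_field_derivative - 1 / (1 - x)\<^sup>2) (at x)" if "x \<in> S" for x
  proof -
    have "x - 1 \<noteq> 0" using small(2)[OF that] by auto
    then have "((\<lambda>x. x / (x - 1)) has_field_derivative (1 * (x - 1) - x * 1) / ((x - 1) * (x - 1))) (at x)"
      by (auto intro!: derivative_eq_intros)
    moreover have "(x - 1) * (x - 1) = (1 - x)\<^sup>2" by (simp add: power2_eq_square algebra_simps)
    ultimately show ?thesis by simp
  qed
  have dg: "((\<lambda>x. g (x / (x - 1))) has_field_derivative g1 (x / (x - 1)) * (- 1 / (1 - x)\<^sup>2)) (at x)"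
    "((\<lambda>x. g1 (x / (x - 1))) has_field_derivative g2 (x / (x - 1)) * (- 1 / (1 - x)\<^sup>2)) (at x)" if "x \<in> S" for x
    unfolding g_def g1_def g2_def
    by (intro DERIV_chain2[OF DERIV_hyp_ser(1)] DERIV_chain2[OF DERIV_hyp_ser(2)] assms small darg that)+
  have df: "(f has_field_derivative f1 x) (at x)" if "x \<in> S" for x
    unfolding f_def by (rule DERIV_cong[OF DERIV_mult[OF dpow[OF that] dg(1)[OF that]]]) (simp add: f1_def algebra_simps)
  have df1: "(f1 has_field_derivative f2 x) (at x)" if x: "x \<in> S" for x
  proof -
    note [simp] = small(2)[OF x]
    have "((\<lambda>x. a / (1 - x)) has_field_derivative a / (1 - x)\<^sup>2) (at x)"
         "((\<lambda>x. 1 / (1 - x)\<^sup>2) has_field_derivative 2 / (1 - x) ^ 3) (at x)"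
      using small(2)[OF x] by (auto intro!: derivative_eq_intros simp: divide_simps power_numeral_reduce)
    note D = this
    have "((\<lambda>x. (1 - x) powr (- a) *
      (a / (1 - x) * g (x / (x - 1)) - 1 / (1 - x)\<^sup>2 * g1 (x / (x - 1)))) has_field_derivative f2 x) (at x)"
      by (rule DERIV_cong[OF DERIV_mult[OF dpow[OF x]
        DERIV_diff[OF DERIV_mult[OF D(1) dg(1)[OF x]] DERIV_mult[OF D(2) dg(2)[OF x]]]]])
        (simp add: f2_def divide_simps, simp add: algebra_simps power_numeral_reduce)
    then show ?thesis by (simp add: f1_def)
  qed
  have S: "open S" "0 \<in> S" unfolding S_def by (rule open_halfspace_Re_lt) simp
  have "hyp2f1 a b c X = f X"
  proof (rule hyp2f1_eqI[OF S])
    show "X \<in> S" using assms by (simp add: S_def)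
    show "closed_segment 0 x \<subseteq> S" if "x \<in> S" for x
    proof -
      have "convex S" unfolding S_def by (rule convex_halfspace_Re_lt)
      then show ?thesis using S that by (intro closed_segment_subset) auto
    qed
    show "f holomorphic_on S" using df S by (auto simp: holomorphic_on_open)
    show "f has_fps_expansion hyp_fps a b c"
    proof (rule hyp_has_fps_expansionI[OF assms(3) S _ df df1])
      show "f 0 = 1" by (simp add: f_def g_def eval_fps_at_0)
      fix x assume x: "x \<in> S"
      define y where "y = x / (x - 1)"
      define t where "t = 1 - x"
      have t: "t \<noteq> 0" using small(2)[OF x] by (simp add: t_def)
      have y: "y = (t - 1) / t" using t by (simp add: y_def t_def divide_simps) (simp add: algebra_simps)
      have xt: "x = 1 - t" by (simp add: t_def)
      have ode: "y * (1 - y) * g2 y + (c - (a + (c - b) + 1) * y) * g1 y = a * (c - b) * g y"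
        unfolding g_def g1_def g2_def y_def by (rule hyp_ser_ode[OF assms(1-3) small(1)[OF x]])
      have "x * t * ((a\<^sup>2 + a) / t\<^sup>2 * g y - (2 * a + 2) / t ^ 3 * g1 y + g2 y / t ^ 4) +
         (c - (a + b + 1) * x) * (a / t * g y - g1 y / t\<^sup>2) - a * b * g y
        = - 1 / t * (y * (1 - y) * g2 y + (c - (a + (c - b) + 1) * y) * g1 y - a * (c - b) * g y)"
        unfolding xt y using t by (simp add: divide_simps) (simp add: algebra_simps power_numeral_reduce)
      then have *: "x * t * ((a\<^sup>2 + a) / t\<^sup>2 * g y - (2 * a + 2) / t ^ 3 * g1 y + g2 y / t ^ 4) +
         (c - (a + b + 1) * x) * (a / t * g y - g1 y / t\<^sup>2) = a * b * g y"
        unfolding ode by simp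
      have distr: "u * (p * v) + w * (p * z) = p * (u * v + w * z)" for u p v w z :: complex
        by (simp add: algebra_simps)
      show "x * (1 - x) * f2 x + (c - (a + b + 1) * x) * f1 x = a * b * f x"
        unfolding f_def f1_def f2_def y_def[symmetric] t_def[symmetric] distr * by (simp only: mult_ac)
    qed
  qed
  then show ?thesis by (simp add: f_def g_def)
qed

definition legendre_q :: "complex \<Rightarrow> complex \<Rightarrow> complex \<Rightarrow> complex" where
  "legendre_q \<nu> \<mu> z = exp (\<mu> * z) * (1 - exp (- 2 * z)) powr (- \<nu>) *
     hyp_ser (- \<nu>) (- \<mu> - \<nu>) (1 - \<mu>) (exp (- 2 * z)) / Gamma (1 - \<mu>)"

lemma exp_neg_less_1: "Re z > 0 \<Longrightarrow> norm (exp (- 2 * z)) < 1"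
  by (simp add: norm_exp_eq_Re)

lemma legendre_P_coth:
  assumes "\<nu> \<notin> \<int>" "\<mu> \<notin> \<int>" "\<mu> + \<nu> \<notin> \<int>" "\<xi> > 0"
  shows "legendre_P \<nu> \<mu> (coth \<xi>) = legendre_q \<nu> \<mu> (of_real \<xi>)"
proof -
  define q where "q = exp (- 2 * \<xi>)"
  define e where "e = exp \<xi>"
  have q: "0 < q" "q < 1" using assms(4) by (simp_all add: q_def)
  have e: "e > 0" "q = 1 / e\<^sup>2" "e\<^sup>2 > 1"
    using assms(4) by (simp_all add: e_def q_def exp_minus inverse_eq_divide flip: exp_double)
  have z: "coth \<xi> = (e\<^sup>2 + 1) / (e\<^sup>2 - 1)"
    using e by (simp add: coth_def cosh_def sinh_def exp_minus divide_simps flip: e_def)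
      (simp add: algebra_simps power2_eq_square)
  have X: "(1 - coth \<xi>) / 2 = - q / (1 - q)"
    unfolding z e(2) using e(1,3) by (simp add: divide_simps)
  have "(coth \<xi> + 1) / (coth \<xi> - 1) = e\<^sup>2"
    unfolding z using e(1,3) by (simp add: divide_simps)
  then have "(coth \<xi> + 1) / (coth \<xi> - 1) = exp (2 * \<xi>)"
    by (simp add: e_def exp_double)
  then have 1: "complex_of_real ((coth \<xi> + 1) / (coth \<xi> - 1)) powr (\<mu> / 2) = exp (\<mu> * of_real \<xi>)"
    by (simp add: powr_def Ln_of_real flip: exp_of_real)
  have X1: "1 - complex_of_real (- q / (1 - q)) = of_real (1 / (1 - q))"
    using q by (simp add: divide_simps)
  have X2: "complex_of_real (- q / (1 - q)) / (complex_of_real (- q / (1 - q)) - 1) = of_real q"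
    using q by (simp add: divide_simps)
  have "hyp2f1 (- \<nu>) (\<nu> + 1) (1 - \<mu>) (of_real (- q / (1 - q))) =
      of_real (1 / (1 - q)) powr \<nu> * hyp_ser (- \<nu>) (1 - \<mu> - (\<nu> + 1)) (1 - \<mu>) (of_real q)"
  proof (subst pfaff_transformation)
    show "1 - \<mu> - (\<nu> + 1) \<notin> \<int>"
      using assms(3) minus_in_Ints_iff[of "\<mu> + \<nu>"] by (simp add: algebra_simps)
    show "1 - \<mu> \<notin> \<int>" using assms(2) Ints_diff[OF Ints_1, of "1 - \<mu>"] by auto
  qed (use assms q in \<open>simp_all add: X1 X2 minus_in_Ints_iff divide_simps\<close>)
  also have "1 - \<mu> - (\<nu> + 1) = - \<mu> - \<nu>" by simp
  also have "complex_of_real (1 / (1 - q)) powr \<nu> = of_real (1 - q) powr (- \<nu>)"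
  proof -
    have "Ln (complex_of_real (1 / (1 - q))) = - Ln (complex_of_real (1 - q))"
      using q Ln_of_real[of "1 / (1 - q)"] Ln_of_real[of "1 - q"]
      by (simp add: ln_div del: of_real_diff of_real_divide)
    then show ?thesis using q by (simp add: powr_def del: of_real_diff of_real_divide)
  qed
  finally show ?thesis
    unfolding legendre_P_def X 1 legendre_q_def q_def by (simp add: exp_of_real [symmetric])
qed

lemma Gamma_shift:
  fixes \<mu> :: complex
  assumes "\<mu> \<notin> \<int>"
  shows "Gamma (1 - \<mu>) = - \<mu> * Gamma (1 - (\<mu> + 1))" "Gamma (1 - (\<mu> - 1)) = (1 - \<mu>) * Gamma (1 - \<mu>)"
    "Gamma (1 - \<mu>) \<noteq> 0"
proof -
  have "- \<mu> \<notin> \<int>" "1 - \<mu> \<notin> \<int>" using assms by (auto simp: minus_in_Ints_iff dest: Ints_diff[OF Ints_1])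
  then have "- \<mu> \<notin> \<int>\<^sub>\<le>\<^sub>0" "1 - \<mu> \<notin> \<int>\<^sub>\<le>\<^sub>0" using nonpos_Ints_Int by blast+
  then show "Gamma (1 - \<mu>) = - \<mu> * Gamma (1 - (\<mu> + 1))" "Gamma (1 - (\<mu> - 1)) = (1 - \<mu>) * Gamma (1 - \<mu>)"
    using Gamma_plus1[of "- \<mu>"] Gamma_plus1[of "1 - \<mu>"] by (simp_all add: algebra_simps)
  show "Gamma (1 - \<mu>) \<noteq> 0" using \<open>1 - \<mu> \<notin> \<int>\<^sub>\<le>\<^sub>0\<close> by (simp add: Gamma_eq_zero_iff)
qed

lemma legendre_q_ladder:
  assumes ni: "\<nu> \<notin> \<int>" "\<mu> \<notin> \<int>" "\<nu> + \<mu> \<notin> \<int>" "\<nu> - \<mu> \<notin> \<int>" and z: "Re z > 0"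
  obtains d where "(legendre_q \<nu> \<mu> has_field_derivative d) (at z)"
    "(\<nu> + \<mu>) * sinh z * legendre_q (\<nu> - 1) \<mu> z = sinh z * d + \<nu> * cosh z * legendre_q \<nu> \<mu> z"
    "(\<nu> - \<mu> + 1) * sinh z * legendre_q (\<nu> + 1) \<mu> z = - (sinh z * d) + (\<nu> + 1) * cosh z * legendre_q \<nu> \<mu> z"
    "legendre_q \<nu> (\<mu> + 1) z = - (sinh z * d) - \<mu> * cosh z * legendre_q \<nu> \<mu> z"
    "(\<nu> + \<mu>) * (\<nu> - \<mu> + 1) * legendre_q \<nu> (\<mu> - 1) z = - (sinh z * d) + \<mu> * cosh z * legendre_q \<nu> \<mu> z"
proof -
  define a b c where "a = - \<nu>" and "b = - \<mu> - \<nu>" and "c = 1 - \<mu>"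
  have abc: "a \<notin> \<int>" "b \<notin> \<int>" "c \<notin> \<int>" "c - a \<notin> \<int>"
  proof -
    show "a \<notin> \<int>" using ni(1) by (simp add: a_def minus_in_Ints_iff)
    have "b = - (\<nu> + \<mu>)" by (simp add: b_def)
    then show "b \<notin> \<int>" using ni(3) by (simp only: minus_in_Ints_iff not_False_eq_True)
    show "c \<notin> \<int>" using ni(2) Ints_diff[OF Ints_1, of c] by (auto simp: c_def)
    show "c - a \<notin> \<int>" using ni(4) Ints_diff[OF _ Ints_1, of "c - a"] by (auto simp: c_def a_def algebra_simps)
  qed
  have nz: "a \<noteq> 0" "b \<noteq> 0" "c \<noteq> a" "c - 1 \<noteq> 0" "c \<noteq> 0"
    using abc ni(2) by (auto simp: c_def)
  have rel: "c = 1 - a + b" by (simp add: a_def b_def c_def)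
  define q where "q = exp (- 2 * z)"
  define e where "e = exp z"
  have q1: "norm q < 1" unfolding q_def by (rule exp_neg_less_1[OF z])
  have "1 - q \<notin> \<real>\<^sub>\<le>\<^sub>0"
  proof
    assume "1 - q \<in> \<real>\<^sub>\<le>\<^sub>0"
    then have "Re q \<ge> 1" by (auto simp: complex_nonpos_Reals_iff)
    then show False using complex_Re_le_cmod[of q] q1 by linarith
  qed
  then have q2: "1 - q \<notin> \<real>\<^sub>\<le>\<^sub>0" "1 - q \<noteq> 0" by auto
  have e: "e \<noteq> 0" "exp (- z) = e * q" by (simp_all add: e_def q_def flip: exp_add)
  have S: "sinh z = e * (1 - q) / 2" and C: "cosh z = e * (1 + q) / 2"
    by (simp_all add: sinh_def cosh_def scaleR_conv_of_real e(2) algebra_simps flip: e_def)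
  define W where "W = exp (\<mu> * z) * (1 - q) powr (- \<nu>)"
  define G where "G = Gamma (1 - \<mu>)"
  note Gam = Gamma_shift[OF ni(2), folded G_def]
  define g where "g = hyp_ser a b c q"
  define g1 where "g1 = hyp_ser' a b c q"
  define d where "d = W * ((\<mu> - 2 * \<nu> * q / (1 - q)) * g - 2 * q * g1) / G"
  have p: "legendre_q \<nu> \<mu> z = W * g / G"
    by (simp add: legendre_q_def W_def g_def G_def a_def b_def c_def q_def)
  have r: "fps_conv_radius (hyp_fps a b c) \<ge> 1" using hyp_fps_conv_radius[OF abc(1-3)] by simp
  have dq: "((\<lambda>z. exp (- 2 * z)) has_field_derivative - 2 * q) (at z)"
    by (auto intro!: derivative_eq_intros simp: q_def)
  have dexp: "((\<lambda>z. exp (\<mu> * z)) has_field_derivative exp (\<mu> * z) * \<mu>) (at z)"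
    by (auto intro!: derivative_eq_intros)
  have dpow: "((\<lambda>z. (1 - exp (- 2 * z)) powr (- \<nu>)) has_field_derivative (1 - q) powr (- \<nu>) *
    (- 2 * \<nu> * q / (1 - q))) (at z)"
  proof -
    have "((\<lambda>z. (1 - exp (- 2 * z)) powr (- \<nu>)) has_field_derivative (- \<nu> * (1 - q) powr (- \<nu> - 1)) * (0 - - 2 * q)) (at z)"
      by (rule DERIV_chain2[where g = "\<lambda>z. 1 - exp (- 2 * z)" and f = "\<lambda>x. x powr (- \<nu>)"])
        (use has_field_derivative_powr[OF q2(1), of "- \<nu>"] in \<open>simp add: q_def\<close>, intro DERIV_diff DERIV_const dq)
    then show ?thesis using q2(2) by (simp add: powr_diff mult_ac)
  qed
  have dg: "((\<lambda>z. hyp_ser a b c (exp (- 2 * z))) has_field_derivative g1 * (- 2 * q)) (at z)"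
    unfolding g1_def
    by (rule DERIV_chain2[where g = "\<lambda>z. exp (- 2 * z)"]) (use DERIV_hyp_ser(1)[OF abc(1-3) q1] dq in \<open>simp_all add: q_def\<close>)
  have "(legendre_q \<nu> \<mu> has_field_derivative d) (at z)"
    unfolding legendre_q_def [abs_def]
    by (rule DERIV_cong[OF DERIV_cdivide[OF DERIV_mult[OF DERIV_mult[OF dexp dpow] dg[unfolded a_def b_def c_def]]]])
      (simp add: d_def W_def g_def G_def a_def b_def c_def q_def algebra_simps)
  have Wn: "exp (\<mu> * z) * (1 - q) powr (a + 1) = W * (1 - q)" "exp (\<mu> * z) * (1 - q) powr (a - 1) = W / (1 - q)"
    "exp ((\<mu> + 1) * z) * (1 - q) powr a = W * e" "exp ((\<mu> - 1) * z) * (1 - q) powr a = W / e"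
    using q2(2) by (simp_all add: W_def a_def e_def distrib_right left_diff_distrib exp_add exp_diff powr_add
      powr_diff powr_minus divide_simps)
  have pars: "- (\<nu> - 1) = a + 1" "- (\<nu> + 1) = a - 1" "- \<nu> = a" "- \<mu> - (\<nu> - 1) = b + 1" "- \<mu> - (\<nu> + 1) = b - 1"
    "- (\<mu> + 1) - \<nu> = b - 1" "- (\<mu> - 1) - \<nu> = b + 1" "1 - \<mu> = c" "1 - (\<mu> + 1) = c - 1" "1 - (\<mu> - 1) = c + 1"
    by (simp_all add: a_def b_def c_def)
  have G: "Gamma c = G" "Gamma (c - 1) = G / (c - 1)" "Gamma (c + 1) = c * G"
    using Gam nz(4) unfolding pars G_def by (simp_all add: c_def)
  have P: "legendre_q (\<nu> - 1) \<mu> z = W * (1 - q) * hyp_ser (a + 1) (b + 1) c q / G"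
    "legendre_q (\<nu> + 1) \<mu> z = W / (1 - q) * hyp_ser (a - 1) (b - 1) c q / G"
    "legendre_q \<nu> (\<mu> + 1) z = W * e * hyp_ser a (b - 1) (c - 1) q / (G / (c - 1))"
    "legendre_q \<nu> (\<mu> - 1) z = W / e * hyp_ser a (b + 1) (c + 1) q / (c * G)"
    unfolding legendre_q_def q_def[symmetric] pars Wn G by (rule refl)+
  have abc_up: "a + 1 \<notin> \<int>" "b + 1 \<notin> \<int>"
    using abc Ints_diff[OF _ Ints_1, of "a + 1"] Ints_diff[OF _ Ints_1, of "b + 1"] by auto
  have r': "fps_conv_radius (hyp_fps (a + 1) (b + 1) c) = 1" by (rule hyp_fps_conv_radius[OF abc_up abc(3)])
  have "(1 - q) * hyp_ser (a + 1) (b + 1) c q = eval_fps (fps_of_poly [:1, -1:] * hyp_fps (a + 1) (b + 1) c) q"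
    using q1 r' by (subst eval_fps_mult) auto
  also have "\<dots> = poly [:0, 2/b:] q * g1 + poly [:1:] q * g"
    unfolding g_def g1_def by (rule eval_fps_first_order[OF hyp_fps_shift_up[OF abc(3) rel nz(1,2)] r q1])
  finally have h1: "(1 - q) * hyp_ser (a + 1) (b + 1) c q = 2 / b * q * g1 + g" by simp
  have h2: "hyp_ser (a - 1) (b - 1) c q = 2 / (c - a) * q * (1 - q) * g1 + (1 + ((2 - 4 * a) / (c - a) - 1) * q) * g"
    unfolding g_def g1_def eval_fps_first_order[OF hyp_fps_shift_down[OF abc(3) rel nz(3)] r q1]
    by (simp add: right_diff_distrib left_diff_distrib distrib_left distrib_right) (simp add: mult_ac)
  have h3: "hyp_ser a (b - 1) (c - 1) q = 1 / (c - 1) * q * (1 - q) * g1 + (1 - a / (c - 1) * q) * g"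
    unfolding g_def g1_def eval_fps_first_order[OF hyp_fps_lower_lower[OF abc(3)] r q1]
    by (simp add: right_diff_distrib left_diff_distrib distrib_left distrib_right)
  have h4: "hyp_ser a (b + 1) (c + 1) q = - c / (b * (c - a)) * (1 - q) * g1 + c / (c - a) * g"
    unfolding g_def g1_def hyp_fps_commute[of a]
      eval_fps_first_order[OF hyp_fps_raise_raise[OF abc(3) nz(2,3)] r[unfolded hyp_fps_commute[of a]] q1]
    by (simp add: right_diff_distrib left_diff_distrib distrib_left distrib_right)
  show thesis
  proof (rule that[of d])
    show "(legendre_q \<nu> \<mu> has_field_derivative d) (at z)" by fact
    have "(\<nu> + \<mu>) * legendre_q (\<nu> - 1) \<mu> z = (\<nu> + \<mu>) * (W * ((1 - q) * hyp_ser (a + 1) (b + 1) c q)) / G"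
      unfolding P by (simp only: mult_ac times_divide_eq_right)
    also have "\<dots> = W * ((\<mu> + \<nu>) * g - 2 * q * g1) / G"
      unfolding h1 using nz(2) by (simp add: b_def divide_simps) (simp add: algebra_simps)
    finally have L: "(\<nu> + \<mu>) * legendre_q (\<nu> - 1) \<mu> z = W * ((\<mu> + \<nu>) * g - 2 * q * g1) / G" .
    have "(\<nu> + \<mu>) * sinh z * legendre_q (\<nu> - 1) \<mu> z = sinh z * ((\<nu> + \<mu>) * legendre_q (\<nu> - 1) \<mu> z)"
      by (simp only: mult_ac)
    also have "\<dots> = sinh z * d + \<nu> * cosh z * legendre_q \<nu> \<mu> z"
      unfolding L p d_def S C using q2(2) Gam(3) by (simp add: divide_simps) (simp add: algebra_simps)
    finally show "(\<nu> + \<mu>) * sinh z * legendre_q (\<nu> - 1) \<mu> z = sinh z * d + \<nu> * cosh z * legendre_q \<nu> \<mu> z" .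
    have ca: "c - a = \<nu> - \<mu> + 1" by (simp add: c_def a_def)
    have "(\<nu> - \<mu> + 1) * legendre_q (\<nu> + 1) \<mu> z = W / (1 - q) * ((c - a) * hyp_ser (a - 1) (b - 1) c q) / G"
      unfolding P ca by (simp only: mult_ac times_divide_eq_right times_divide_eq_left)
    also have "(c - a) * hyp_ser (a - 1) (b - 1) c q = 2 * q * (1 - q) * g1 + ((c - a) * (1 - q) + (2 - 4 * a) * q) * g"
      unfolding h2 using nz(3) by (simp add: divide_simps) (simp add: algebra_simps)
    finally have L: "(\<nu> - \<mu> + 1) * legendre_q (\<nu> + 1) \<mu> z =
       W / (1 - q) * (2 * q * (1 - q) * g1 + ((\<nu> - \<mu> + 1) * (1 - q) + (2 + 4 * \<nu>) * q) * g) / G"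
      unfolding ca by (simp add: a_def)
    have "(\<nu> - \<mu> + 1) * sinh z * legendre_q (\<nu> + 1) \<mu> z = sinh z * ((\<nu> - \<mu> + 1) * legendre_q (\<nu> + 1) \<mu> z)"
      by (simp only: mult_ac)
    also have "\<dots> = - (sinh z * d) + (\<nu> + 1) * cosh z * legendre_q \<nu> \<mu> z"
      unfolding L p d_def S C using q2(2) Gam(3) by (simp add: divide_simps) (simp add: algebra_simps)
    finally show "(\<nu> - \<mu> + 1) * sinh z * legendre_q (\<nu> + 1) \<mu> z = - (sinh z * d) + (\<nu> + 1) * cosh z * legendre_q \<nu> \<mu> z" .
    have "legendre_q \<nu> (\<mu> + 1) z = W * e * ((c - 1) * hyp_ser a (b - 1) (c - 1) q) / G"
      unfolding P by (simp add: mult_ac)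
    also have "(c - 1) * hyp_ser a (b - 1) (c - 1) q = q * (1 - q) * g1 + (c - 1 - a * q) * g"
      unfolding h3 using nz(4) by (simp add: divide_simps)
    also have "W * e * (q * (1 - q) * g1 + (c - 1 - a * q) * g) / G = - (sinh z * d) - \<mu> * cosh z * legendre_q \<nu> \<mu> z"
      unfolding p d_def S C c_def a_def using q2(2) Gam(3) by (simp add: divide_simps) (simp add: algebra_simps)
    finally show "legendre_q \<nu> (\<mu> + 1) z = - (sinh z * d) - \<mu> * cosh z * legendre_q \<nu> \<mu> z" .
    have "(\<nu> + \<mu>) * (\<nu> - \<mu> + 1) * legendre_q \<nu> (\<mu> - 1) z = - b * (c - a) * (W / e * hyp_ser a (b + 1) (c + 1) q / (c * G))"
      unfolding P ca by (simp add: b_def)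
    also have "\<dots> = W / e * ((1 - q) * g1 - b * g) / G"
      unfolding h4 using nz Gam(3) e(1) by (simp add: divide_simps) (simp add: algebra_simps)
    also have "\<dots> = W * e * q * ((1 - q) * g1 - b * g) / G"
    proof -
      have "1 / e = e * q" using e by (simp add: exp_minus inverse_eq_divide flip: e_def)
      then have "W / e = W * e * q" by (metis divide_inverse inverse_eq_divide mult.assoc)
      then show ?thesis by simp
    qed
    also have "\<dots> = - (sinh z * d) + \<mu> * cosh z * legendre_q \<nu> \<mu> z"
      unfolding p d_def S C b_def using q2(2) Gam(3) by (simp add: divide_simps) (simp add: algebra_simps)
    finally show "(\<nu> + \<mu>) * (\<nu> - \<mu> + 1) * legendre_q \<nu> (\<mu> - 1) z = - (sinh z * d) + \<mu> * cosh z * legendre_q \<nu> \<mu> z" .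
  qed
qed

lemma rising_factorial_neg: "rising_factorial d (- int i) = inverse (\<Prod>j = 1..i. d - of_nat j)"
  by (cases "i = 0") (simp_all add: rising_factorial_def)

lemma rising_factorial_step:
  fixes d :: real
  assumes "d \<notin> \<int>"
  shows "rising_factorial d (k + 1) = rising_factorial d k * (d + of_int k)" "rising_factorial d k \<noteq> 0"
proof -
  have nz: "d + of_int j \<noteq> 0" for j using assms
    by (metis Ints_minus Ints_of_int add_eq_0_iff2)
  have nz': "d - of_nat j \<noteq> 0" for j using assms by (metis Ints_of_nat eq_iff_diff_eq_0)
  show "rising_factorial d (k + 1) = rising_factorial d k * (d + of_int k)"
  proof (cases "k \<ge> 0")
    case True
    then show ?thesis by (simp add: rising_factorial_def nat_add_distrib pochhammer_Suc)
  next
    case False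
    define i where "i = nat (- k - 1)"
    have k: "k = - int (Suc i)" "k + 1 = - int i" using False by (simp_all add: i_def)
    obtain y where y: "d - of_nat (Suc i) = y" by blast
    have e: "d + of_int (- int (Suc i)) = y" "(\<Prod>j = 1..Suc i. d - of_nat j) = (\<Prod>j = 1..i. d - of_nat j) * y"
      using y by simp_all
    have "y \<noteq> 0" using nz'[of "Suc i"] y by simp
    then show ?thesis unfolding k(2) unfolding k(1) rising_factorial_neg e by simp
  qed
  show "rising_factorial d k \<noteq> 0"
    using nz nz' by (auto simp: rising_factorial_def pochhammer_eq_0_iff) (metis add_0 nz of_int_of_nat_eq)
qed

definition legendre_const1 :: "int \<Rightarrow> int \<Rightarrow> real" where
  "legendre_const1 m n = 2 powr (5/4 - 2 * of_int m - 3 * of_int n) * 3 powr (-3/8) *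
        rising_factorial (1/4) m * inverse (rising_factorial (13/12) (m + n)) * inverse (Gamma (4/3))"

definition legendre_const2 :: "int \<Rightarrow> int \<Rightarrow> real" where
  "legendre_const2 m n = 2 powr (-1/4 - 2 * of_int m - 3 * of_int n) * 3 powr (-3/8) *
        rising_factorial (1/4) m * inverse (rising_factorial (5/12) (m - n)) * inverse (Gamma (2/3))"

lemma powr2_step:
  "(2::real) powr (x - 2 * of_int (m + 1) - y) = 2 powr (x - 2 * of_int m - y) / 4"
  "(2::real) powr (x - 3 * of_int (n + 1)) = 2 powr (x - 3 * of_int n) / 8"
proof -
  have "x - 2 * of_int (m + 1) - y = (x - 2 * of_int m - y) - 2" "x - 3 * of_int (n + 1) = (x - 3 * of_int n) - 3"
    by simp_all
  then show "(2::real) powr (x - 2 * of_int (m + 1) - y) = 2 powr (x - 2 * of_int m - y) / 4"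
    "(2::real) powr (x - 3 * of_int (n + 1)) = 2 powr (x - 3 * of_int n) / 8"
    by (simp_all only: powr_diff) simp_all
qed

lemma rf_nonint: "(1/4 :: real) \<notin> \<int>" "(13/12 :: real) \<notin> \<int>" "(5/12 :: real) \<notin> \<int>"
  by (rule nonint_24[of _ 6] nonint_24[of _ 26] nonint_24[of _ 10]; simp)+

lemma legendre_const1_rec:
  "legendre_const1 m n = legendre_const1 m (n + 1) * (8 * (13/12 + of_int m + of_int n))"
  "legendre_const1 m n * (1/4 + of_int m) = legendre_const1 (m + 1) n * (4 * (13/12 + of_int m + of_int n))"
  "legendre_const1 m n \<noteq> 0"
proof -
  have K: "13/12 + of_int m + of_int n \<noteq> (0::real)"
    using rising_factorial_step[OF rf_nonint(2), of "m + n"] rising_factorial_step(2)[OF rf_nonint(2), of "m + n + 1"]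
    by (metis add.assoc mult_zero_right of_int_add)
  have e: "13/12 + of_int m + of_int n = 13/12 + (of_int (m + n) :: real)" by simp
  obtain k :: real where k: "13/12 + of_int (m + n) = k" by blast
  have mn: "m + (n + 1) = m + n + 1" "m + 1 + n = m + n + 1" by simp_all
  show "legendre_const1 m n = legendre_const1 m (n + 1) * (8 * (13/12 + of_int m + of_int n))"
    unfolding legendre_const1_def powr2_step mn rising_factorial_step(1)[OF rf_nonint(2)] e
    using K[unfolded e] unfolding k by simp
  show "legendre_const1 m n * (1/4 + of_int m) = legendre_const1 (m + 1) n * (4 * (13/12 + of_int m + of_int n))"
    unfolding legendre_const1_def powr2_step mn rising_factorial_step(1)[OF rf_nonint(2)]
      rising_factorial_step(1)[OF rf_nonint(1)] e
    using K[unfolded e] unfolding k by simp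
  show "legendre_const1 m n \<noteq> 0"
    using rising_factorial_step(2)[OF rf_nonint(1)] rising_factorial_step(2)[OF rf_nonint(2)]
      less_imp_neq[OF Gamma_real_pos[of "4/3"]]
    by (simp add: legendre_const1_def)
qed

lemma legendre_const2_rec:
  "legendre_const2 m n * (5/12 + of_int m - of_int n - 1) = 8 * legendre_const2 m (n + 1)"
  "legendre_const2 m n * (1/4 + of_int m) = legendre_const2 (m + 1) n * (4 * (5/12 + of_int m - of_int n))"
  "legendre_const2 m n \<noteq> 0"
proof -
  have K: "5/12 + of_int m - of_int n \<noteq> (0::real)" for m n
    using rising_factorial_step[OF rf_nonint(3), of "m - n"] rising_factorial_step(2)[OF rf_nonint(3), of "m - n + 1"]
    by (metis add_diff_eq mult_zero_right of_int_diff)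
  have e1: "5/12 + of_int m - of_int n - 1 = 5/12 + (of_int (m - (n + 1)) :: real)"
    and e2: "5/12 + of_int m - of_int n = 5/12 + (of_int (m - n) :: real)" by simp_all
  obtain k :: real where k: "5/12 + of_int (m - n) = k" by blast
  have mn: "m - n = m - (n + 1) + 1" "m + 1 - n = m - n + 1" by simp_all
  have "5/12 + of_int (m - (n + 1)) \<noteq> (0::real)" using K[of m "n + 1"] by (simp add: algebra_simps)
  then show "legendre_const2 m n * (5/12 + of_int m - of_int n - 1) = 8 * legendre_const2 m (n + 1)"
    unfolding legendre_const2_def powr2_step mn(1) rising_factorial_step(1)[OF rf_nonint(3)] e1
    by (simp del: of_int_diff of_int_add)
  show "legendre_const2 m n * (1/4 + of_int m) = legendre_const2 (m + 1) n * (4 * (5/12 + of_int m - of_int n))"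
    unfolding legendre_const2_def powr2_step mn(2) rising_factorial_step(1)[OF rf_nonint(3)]
      rising_factorial_step(1)[OF rf_nonint(1)] e2
    using K[of m n, unfolded e2] unfolding k by simp
  show "legendre_const2 m n \<noteq> 0"
    using rising_factorial_step(2)[OF rf_nonint(1)] rising_factorial_step(2)[OF rf_nonint(3)]
      less_imp_neq[OF Gamma_real_pos[of "2/3"]]
    by (simp add: legendre_const2_def)
qed

lemma legendre_params_nonint:
  fixes m n :: int
  defines "\<nu> \<equiv> -3/4 - complex_of_int m" and "\<mu> \<equiv> 1/3 + complex_of_int n" and "\<mu>' \<equiv> -1/3 - complex_of_int n"
  shows "\<nu> \<notin> \<int>" "\<mu> \<notin> \<int>" "\<nu> + \<mu> \<notin> \<int>" "\<nu> - \<mu> \<notin> \<int>" "\<mu>' \<notin> \<int>" "\<nu> + \<mu>' \<notin> \<int>" "\<nu> - \<mu>' \<notin> \<int>"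
proof -
  have d: "\<not> 24 dvd (-18 - 24 * m)" "\<not> 24 dvd (8 + 24 * n)" "\<not> 24 dvd (-10 - 24 * m + 24 * n)"
    "\<not> 24 dvd (-26 - 24 * m - 24 * n)"
    "\<not> 24 dvd (-8 - 24 * n)"
    by presburger+
  show "\<nu> \<notin> \<int>" by (rule nonint_24[OF _ d(1)]) (simp add: \<nu>_def field_simps)
  show "\<mu> \<notin> \<int>" by (rule nonint_24[OF _ d(2)]) (simp add: \<mu>_def field_simps)
  show "\<nu> + \<mu> \<notin> \<int>" by (rule nonint_24[OF _ d(3)]) (simp add: \<nu>_def \<mu>_def field_simps)
  show "\<nu> - \<mu> \<notin> \<int>" by (rule nonint_24[OF _ d(4)]) (simp add: \<nu>_def \<mu>_def field_simps)
  show "\<mu>' \<notin> \<int>" by (rule nonint_24[OF _ d(5)]) (simp add: \<mu>'_def field_simps)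
  show "\<nu> + \<mu>' \<notin> \<int>" by (rule nonint_24[OF _ d(4)]) (simp add: \<nu>_def \<mu>'_def field_simps)
  show "\<nu> - \<mu>' \<notin> \<int>" by (rule nonint_24[OF _ d(3)]) (simp add: \<nu>_def \<mu>'_def field_simps)
qed

lemma sinh_of_real_complex: "sinh (complex_of_real x) = of_real (sinh x)"
  and cosh_of_real_complex: "cosh (complex_of_real x) = of_real (cosh x)"
  by (simp_all add: sinh_def cosh_def scaleR_conv_of_real flip: exp_of_real)

definition legendre_fam1 :: "int \<Rightarrow> int \<Rightarrow> real \<Rightarrow> complex" where
  "legendre_fam1 m n \<xi> = legendre_q (-3/4 - of_int m) (-1/3 - of_int n) (of_real \<xi>) / of_real (legendre_const1 m n)"

definition legendre_fam2 :: "int \<Rightarrow> int \<Rightarrow> real \<Rightarrow> complex" where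
  "legendre_fam2 m n \<xi> = legendre_q (-3/4 - of_int m) (1/3 + of_int n) (of_real \<xi>) / of_real (legendre_const2 m n)"

lemma oct_family_legendre1: "oct_family legendre_fam1"
  unfolding oct_family_def
proof (intro allI impI)
  fix m n :: int and \<xi> :: real assume \<xi>: "\<xi> > 0"
  define \<nu> \<mu> where "\<nu> = -3/4 - complex_of_int m" and "\<mu> = -1/3 - complex_of_int n"
  define M N where "M = complex_of_int m" and "N = complex_of_int n"
  define S C where "S = complex_of_real (sinh \<xi>)" and "C = complex_of_real (cosh \<xi>)"
  define p where "p = legendre_q \<nu> \<mu> (of_real \<xi>)"
  obtain d where d: "(legendre_q \<nu> \<mu> has_field_derivative d) (at (of_real \<xi>))"
    "(\<nu> + \<mu>) * S * legendre_q (\<nu> - 1) \<mu> (of_real \<xi>) = S * d + \<nu> * C * p"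
    "(\<nu> - \<mu> + 1) * S * legendre_q (\<nu> + 1) \<mu> (of_real \<xi>) = - (S * d) + (\<nu> + 1) * C * p"
    "legendre_q \<nu> (\<mu> + 1) (of_real \<xi>) = - (S * d) - \<mu> * C * p"
    "(\<nu> + \<mu>) * (\<nu> - \<mu> + 1) * legendre_q \<nu> (\<mu> - 1) (of_real \<xi>) = - (S * d) + \<mu> * C * p"
    unfolding S_def C_def p_def
    by (rule legendre_q_ladder[of \<nu> \<mu> "of_real \<xi>"])
      (use \<xi> legendre_params_nonint(1)[of m] legendre_params_nonint(5)[of n]
        legendre_params_nonint(6,7)[of m n] in \<open>auto simp: \<nu>_def \<mu>_def sinh_of_real_complex cosh_of_real_complex\<close>)
  define k where "k = complex_of_real (legendre_const1 m n)"
  have k: "k \<noteq> 0" using legendre_const1_rec(3) by (simp add: k_def)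
  define K where "K = 13/12 + M + N"
  define K' where "K' = 1/12 + M + N"
  have Kr: "complex_of_real (13/12 + of_int m + of_int n) = K" "complex_of_real (13/12 + of_int m + of_int (n - 1)) = K'"
    "complex_of_real (13/12 + of_int (m - 1) + of_int n) = K'" by (simp_all add: K_def K'_def M_def N_def)
  have rec: "k = of_real (legendre_const1 m (n + 1)) * (8 * K)"
    "of_real (legendre_const1 m (n - 1)) = k * (8 * K')"
    "k * (1/4 + M) = of_real (legendre_const1 (m + 1) n) * (4 * K)"
    "of_real (legendre_const1 (m - 1) n) * (M - 3/4) = k * (4 * K')"
    using arg_cong[OF legendre_const1_rec(1)[of m n], of complex_of_real]
      arg_cong[OF legendre_const1_rec(1)[of m "n - 1"], of complex_of_real]
      arg_cong[OF legendre_const1_rec(2)[of m n], of complex_of_real]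
        arg_cong[OF legendre_const1_rec(2)[of "m - 1" n], of complex_of_real]
    unfolding of_real_mult Kr by (simp_all add: k_def M_def algebra_simps)
  have cb: "oct_c m - oct_b m n = (\<nu> - \<mu> + 1) / 2" and a: "16 * oct_a m n = - (8 * K')" and c1: "oct_c m - 1 = - (1/4 + M)"
    and c: "oct_c m = - (M - 3/4)" and nm: "\<nu> + \<mu> = - K"
    by (simp_all add: oct_a_def oct_b_def oct_c_def \<nu>_def \<mu>_def K_def K'_def M_def N_def)
  have q: "legendre_q (-3/4 - of_int m) (-1/3 - of_int (n + 1)) = legendre_q \<nu> (\<mu> - 1)"
    "legendre_q (-3/4 - of_int m) (-1/3 - of_int (n - 1)) = legendre_q \<nu> (\<mu> + 1)"
    "legendre_q (-3/4 - of_int (m + 1)) (-1/3 - of_int n) = legendre_q (\<nu> - 1) \<mu>"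
    "legendre_q (-3/4 - of_int (m - 1)) (-1/3 - of_int n) = legendre_q (\<nu> + 1) \<mu>"
    by (simp_all add: \<nu>_def \<mu>_def algebra_simps)
  have nz: "of_real (legendre_const1 m n) \<noteq> (0::complex)" for m n using legendre_const1_rec(3) by simp
  have Mnz: "1/4 + M \<noteq> 0" "M - 3/4 \<noteq> 0"
    using oct_params_nonint(3,6)[of m] unfolding c1 unfolding c by (metis Ints_0 minus_zero)+
  have Knz: "K \<noteq> 0" "K' \<noteq> 0" "1/4 + M \<noteq> 0" "M - 3/4 \<noteq> 0"
    using Mnz rec nz[of m "n - 1"] nz[of "m + 1" n] nz[of "m - 1" n] k by auto
  have p0: "legendre_fam1 m n \<xi> = p / k"
    by (simp add: legendre_fam1_def p_def k_def \<nu>_def \<mu>_def)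
  have D: "(legendre_fam1 m n has_vector_derivative d / k) (at \<xi>)"
    using has_vector_derivative_real_field[OF DERIV_cdivide[OF d(1), of k]]
    unfolding legendre_fam1_def [abs_def] by (simp add: k_def \<nu>_def \<mu>_def)
  have "(oct_c m - oct_b m n) * legendre_fam1 m (n + 1) \<xi> =
    - 4 * ((\<nu> + \<mu>) * (\<nu> - \<mu> + 1) * legendre_q \<nu> (\<mu> - 1) (of_real \<xi>)) / k"
    unfolding legendre_fam1_def q cb nm rec(1) using Knz nz[of m "n + 1"] by simp
  also have "\<dots> = 4 * (S * (d / k) + (1/3 + N) * C * (p / k))"
    unfolding d unfolding \<mu>_def N_def divide_inverse[of _ k] by (simp add: algebra_simps)
  finally have 1: "(oct_c m - oct_b m n) * legendre_fam1 m (n + 1) \<xi> = 4 * (S * (d / k) + (1/3 + N) * C * (p / k))" .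
  have "16 * oct_a m n * legendre_fam1 m (n - 1) \<xi> = - legendre_q \<nu> (\<mu> + 1) (of_real \<xi>) / k"
    unfolding legendre_fam1_def q a rec(2) using Knz k by simp
  also have "\<dots> = S * (d / k) - (1/3 + N) * C * (p / k)"
    unfolding d unfolding \<mu>_def N_def divide_inverse[of _ k] by (simp add: algebra_simps)
  finally have 2: "16 * oct_a m n * legendre_fam1 m (n - 1) \<xi> = S * (d / k) - (1/3 + N) * C * (p / k)" .
  have r3: "of_real (legendre_const1 (m + 1) n) = k * (1/4 + M) / (4 * K)" using rec(3) Knz by simp
  have "(oct_c m - 1) * S * legendre_fam1 (m + 1) n \<xi> = 4 * ((\<nu> + \<mu>) * S * legendre_q (\<nu> - 1) \<mu> (of_real \<xi>)) / k"
  proof -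
    have "- x * S * (v / (k * x / (4 * y))) = 4 * (- y * S * v) / k" if "x \<noteq> 0" for v x y :: complex
      using that k by simp
    from this[OF Knz(3)] show ?thesis unfolding legendre_fam1_def q c1 nm r3 .
  qed
  also have "\<dots> = 4 * S * (d / k) - (3 + 4 * M) * C * (p / k)"
    unfolding d unfolding \<nu>_def M_def divide_inverse[of _ k] by (simp add: algebra_simps)
  finally have 3: "(oct_c m - 1) * S * legendre_fam1 (m + 1) n \<xi> = 4 * S * (d / k) - (3 + 4 * M) * C * (p / k)" .
  have r4: "of_real (legendre_const1 (m - 1) n) = k * (4 * K') / (M - 3/4)" using rec(4) Knz by (simp add: field_simps)
  have "- 16 * oct_a m n * (oct_c m - oct_b m n) * S * legendre_fam1 (m - 1) n \<xi>
      = - (16 * oct_a m n) * (oct_c m - oct_b m n) * S * legendre_fam1 (m - 1) n \<xi>" by simp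
  also have "\<dots> = - oct_c m * ((\<nu> - \<mu> + 1) * S * legendre_q (\<nu> + 1) \<mu> (of_real \<xi>)) / k"
  proof -
    have "- (- (8 * y)) * (w / 2) * S * (v / (k * (4 * y) / x)) = - (- x) * (w * S * v) / k"
      if "x \<noteq> 0" "y \<noteq> 0" for v w x y :: complex
      using that k by simp
    from this[OF Knz(4,2)] show ?thesis unfolding legendre_fam1_def q a cb r4 unfolding c .
  qed
  also have "\<dots> = oct_c m * (S * (d / k) - (1/4 - M) * C * (p / k))"
    unfolding d unfolding \<nu>_def M_def divide_inverse[of _ k] by (simp add: algebra_simps)
  finally have 4: "- 16 * oct_a m n * (oct_c m - oct_b m n) * S * legendre_fam1 (m - 1) n \<xi> =
    oct_c m * (S * (d / k) - (1/4 - M) * C * (p / k))" .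
  show "\<exists>d. oct_ladder legendre_fam1 m n \<xi> d"
    using D 1 2 3 4 unfolding oct_ladder_def p0 S_def C_def M_def N_def by blast
qed

lemma oct_family_legendre2: "oct_family legendre_fam2"
  unfolding oct_family_def
proof (intro allI impI)
  fix m n :: int and \<xi> :: real assume \<xi>: "\<xi> > 0"
  define \<nu> \<mu> where "\<nu> = -3/4 - complex_of_int m" and "\<mu> = 1/3 + complex_of_int n"
  define M N where "M = complex_of_int m" and "N = complex_of_int n"
  define S C where "S = complex_of_real (sinh \<xi>)" and "C = complex_of_real (cosh \<xi>)"
  define p where "p = legendre_q \<nu> \<mu> (of_real \<xi>)"
  obtain d where d: "(legendre_q \<nu> \<mu> has_field_derivative d) (at (of_real \<xi>))"
    "(\<nu> + \<mu>) * S * legendre_q (\<nu> - 1) \<mu> (of_real \<xi>) = S * d + \<nu> * C * p"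
    "(\<nu> - \<mu> + 1) * S * legendre_q (\<nu> + 1) \<mu> (of_real \<xi>) = - (S * d) + (\<nu> + 1) * C * p"
    "legendre_q \<nu> (\<mu> + 1) (of_real \<xi>) = - (S * d) - \<mu> * C * p"
    "(\<nu> + \<mu>) * (\<nu> - \<mu> + 1) * legendre_q \<nu> (\<mu> - 1) (of_real \<xi>) = - (S * d) + \<mu> * C * p"
    unfolding S_def C_def p_def
    by (rule legendre_q_ladder[of \<nu> \<mu> "of_real \<xi>"])
      (use \<xi> legendre_params_nonint(1)[of m] legendre_params_nonint(2)[of n]
        legendre_params_nonint(3,4)[of m n] in \<open>auto simp: \<nu>_def \<mu>_def sinh_of_real_complex cosh_of_real_complex\<close>)
  define k where "k = complex_of_real (legendre_const2 m n)"
  have k: "k \<noteq> 0" using legendre_const2_rec(3) by (simp add: k_def)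
  define K where "K = 5/12 + M - N"
  have Kr: "complex_of_real (5/12 + of_int m - of_int n - 1) = K - 1"
    "complex_of_real (5/12 + of_int m - of_int (n - 1) - 1) = K"
    "complex_of_real (5/12 + of_int m - of_int n) = K" "complex_of_real (5/12 + of_int (m - 1) - of_int n) = K - 1"
    by (simp_all add: K_def M_def N_def)
  have rec: "of_real (legendre_const2 m (n + 1)) = k * (K - 1) / 8"
    "of_real (legendre_const2 m (n - 1)) * K = 8 * k"
    "k * (1/4 + M) = of_real (legendre_const2 (m + 1) n) * (4 * K)"
    "of_real (legendre_const2 (m - 1) n) * (M - 3/4) = k * (4 * (K - 1))"
    using arg_cong[OF legendre_const2_rec(1)[of m n], of complex_of_real]
      arg_cong[OF legendre_const2_rec(1)[of m "n - 1"], of complex_of_real]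
      arg_cong[OF legendre_const2_rec(2)[of m n], of complex_of_real]
        arg_cong[OF legendre_const2_rec(2)[of "m - 1" n], of complex_of_real]
    unfolding of_real_mult Kr by (simp_all add: k_def M_def algebra_simps)
  have cb: "oct_c m - oct_b m n = - (K - 1) / 2" and a: "16 * oct_a m n =
    8 * (\<nu> - \<mu> + 1)" and c1: "oct_c m - 1 = - (1/4 + M)"
    and c: "oct_c m = - (M - 3/4)" and nm: "\<nu> + \<mu> = - K"
    by (simp_all add: oct_a_def oct_b_def oct_c_def \<nu>_def \<mu>_def K_def M_def N_def field_simps)
  have q: "legendre_q (-3/4 - of_int m) (1/3 + of_int (n + 1)) = legendre_q \<nu> (\<mu> + 1)"
    "legendre_q (-3/4 - of_int m) (1/3 + of_int (n - 1)) = legendre_q \<nu> (\<mu> - 1)"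
    "legendre_q (-3/4 - of_int (m + 1)) (1/3 + of_int n) = legendre_q (\<nu> - 1) \<mu>"
    "legendre_q (-3/4 - of_int (m - 1)) (1/3 + of_int n) = legendre_q (\<nu> + 1) \<mu>"
    by (simp_all add: \<nu>_def \<mu>_def algebra_simps)
  have nz: "of_real (legendre_const2 m n) \<noteq> (0::complex)" for m n using legendre_const2_rec(3) by simp
  have Mnz: "1/4 + M \<noteq> 0" "M - 3/4 \<noteq> 0"
    using oct_params_nonint(3,6)[of m] unfolding c1 unfolding c by (metis Ints_0 minus_zero)+
  have Knz: "K \<noteq> 0" "K - 1 \<noteq> 0" "1/4 + M \<noteq> 0" "M - 3/4 \<noteq> 0"
    using Mnz rec nz[of m "n - 1"] nz[of m "n + 1"] nz[of "m + 1" n] nz[of "m - 1" n] k by auto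
  have p0: "legendre_fam2 m n \<xi> = p / k"
    by (simp add: legendre_fam2_def p_def k_def \<nu>_def \<mu>_def)
  have D: "(legendre_fam2 m n has_vector_derivative d / k) (at \<xi>)"
    using has_vector_derivative_real_field[OF DERIV_cdivide[OF d(1), of k]]
    unfolding legendre_fam2_def [abs_def] by (simp add: k_def \<nu>_def \<mu>_def)
  have "(oct_c m - oct_b m n) * legendre_fam2 m (n + 1) \<xi> = - 4 * legendre_q \<nu> (\<mu> + 1) (of_real \<xi>) / k"
  proof -
    have "- x / 2 * (v / (y * x / 8)) = - 4 * v / y" if "x \<noteq> 0" "y \<noteq> 0" for v x y :: complex
      using that by simp
    from this[OF Knz(2) k] show ?thesis unfolding legendre_fam2_def q cb rec(1) .
  qed
  also have "\<dots> = 4 * (S * (d / k) + (1/3 + N) * C * (p / k))"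
    unfolding d unfolding \<mu>_def N_def divide_inverse[of _ k] by (simp add: algebra_simps)
  finally have 1: "(oct_c m - oct_b m n) * legendre_fam2 m (n + 1) \<xi> = 4 * (S * (d / k) + (1/3 + N) * C * (p / k))" .
  have r2: "of_real (legendre_const2 m (n - 1)) = 8 * k / K" using rec(2) Knz by (simp add: field_simps)
  have "16 * oct_a m n * legendre_fam2 m (n - 1) \<xi> = - ((\<nu> + \<mu>) * (\<nu> - \<mu> + 1) * legendre_q \<nu> (\<mu> - 1) (of_real \<xi>)) / k"
  proof -
    have "8 * x * (v / (8 * y / z)) = - (- z * x * v) / y" if "y \<noteq> 0" "z \<noteq> 0" for v x y z :: complex
      using that by simp
    from this[OF k Knz(1)] show ?thesis unfolding legendre_fam2_def q a r2 nm .
  qed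
  also have "\<dots> = S * (d / k) - (1/3 + N) * C * (p / k)"
    unfolding d unfolding \<mu>_def N_def divide_inverse[of _ k] by (simp add: algebra_simps)
  finally have 2: "16 * oct_a m n * legendre_fam2 m (n - 1) \<xi> = S * (d / k) - (1/3 + N) * C * (p / k)" .
  have r3: "of_real (legendre_const2 (m + 1) n) = k * (1/4 + M) / (4 * K)" using rec(3) Knz by simp
  have "(oct_c m - 1) * S * legendre_fam2 (m + 1) n \<xi> = 4 * ((\<nu> + \<mu>) * S * legendre_q (\<nu> - 1) \<mu> (of_real \<xi>)) / k"
  proof -
    have "- x * S * (v / (k * x / (4 * y))) = 4 * (- y * S * v) / k" if "x \<noteq> 0" for v x y :: complex
      using that k by simp
    from this[OF Knz(3)] show ?thesis unfolding legendre_fam2_def q c1 nm r3 .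
  qed
  also have "\<dots> = 4 * S * (d / k) - (3 + 4 * M) * C * (p / k)"
    unfolding d unfolding \<nu>_def M_def divide_inverse[of _ k] by (simp add: algebra_simps)
  finally have 3: "(oct_c m - 1) * S * legendre_fam2 (m + 1) n \<xi> = 4 * S * (d / k) - (3 + 4 * M) * C * (p / k)" .
  have r4: "of_real (legendre_const2 (m - 1) n) = k * (4 * (K - 1)) / (M - 3/4)" using rec(4) Knz by (simp add: field_simps)
  have "- 16 * oct_a m n * (oct_c m - oct_b m n) * S * legendre_fam2 (m - 1) n \<xi>
      = - (16 * oct_a m n) * (oct_c m - oct_b m n) * S * legendre_fam2 (m - 1) n \<xi>" by simp
  also have "\<dots> = - oct_c m * ((\<nu> - \<mu> + 1) * S * legendre_q (\<nu> + 1) \<mu> (of_real \<xi>)) / k"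
  proof -
    have "- (8 * w) * (- y / 2) * S * (v / (k * (4 * y) / x)) = - (- x) * (w * S * v) / k" if "x \<noteq> 0" "y \<noteq> 0"
      for v w x y :: complex
      using that k by simp
    from this[OF Knz(4,2)] show ?thesis unfolding legendre_fam2_def q a cb r4 unfolding c .
  qed
  also have "\<dots> = oct_c m * (S * (d / k) - (1/4 - M) * C * (p / k))"
    unfolding d unfolding \<nu>_def M_def divide_inverse[of _ k] by (simp add: algebra_simps)
  finally have 4: "- 16 * oct_a m n * (oct_c m - oct_b m n) * S * legendre_fam2 (m - 1) n \<xi> =
    oct_c m * (S * (d / k) - (1/4 - M) * C * (p / k))" .
  show "\<exists>d. oct_ladder legendre_fam2 m n \<xi> d"
    using D 1 2 3 4 unfolding oct_ladder_def p0 S_def C_def M_def N_def by blast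
qed

section \<open>The case \<open>m = n = 0\<close>\<close>

lemma wronskian_unique:
  fixes y y' s s' t t' V :: "real \<Rightarrow> complex" and S :: "real set"
  assumes S: "convex S" "0 \<in> S"
    and y: "\<And>x. x \<in> S \<Longrightarrow> (y has_vector_derivative y' x) (at x)" "\<And>x. x \<in> S \<Longrightarrow> (y' has_vector_derivative V x * y x) (at x)"
    and s: "\<And>x. x \<in> S \<Longrightarrow> (s has_vector_derivative s' x) (at x)" "\<And>x. x \<in> S \<Longrightarrow> (s' has_vector_derivative V x * s x) (at x)"
    and t: "\<And>x. x \<in> S \<Longrightarrow> (t has_vector_derivative t' x) (at x)" "\<And>x. x \<in> S \<Longrightarrow> (t' has_vector_derivative V x * t x) (at x)"
    and init: "s 0 = 1" "s' 0 = 0" "t 0 = 0" "t' 0 = 1" and x: "x \<in> S"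
  shows "y x = y 0 * s x + y' 0 * t x"
proof -
  have const: "f x * g' x - f' x * g x = f 0 * g' 0 - f' 0 * g 0"
    if f: "\<And>x. x \<in> S \<Longrightarrow> (f has_vector_derivative f' x) (at x)" "\<And>x. x \<in> S \<Longrightarrow> (f' has_vector_derivative V x * f x) (at x)"
      and g: "\<And>x. x \<in> S \<Longrightarrow> (g has_vector_derivative g' x) (at x)" "\<And>x. x \<in> S \<Longrightarrow> (g' has_vector_derivative V x * g x) (at x)"
    for f f' g g' :: "real \<Rightarrow> complex"
  proof -
    have "((\<lambda>x. f x * g' x - f' x * g x) has_vector_derivative 0) (at x within S)" if "x \<in> S" for x
    proof -
      have "((\<lambda>x. f x * g' x - f' x * g x) has_vector_derivative
          (f x * (V x * g x) + f' x * g' x) - (f' x * g' x + V x * f x * g x)) (at x)"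
        by (intro has_vector_derivative_diff has_vector_derivative_mult f g that)
      then show ?thesis by (simp add: has_vector_derivative_at_within)
    qed
    then obtain c where "\<And>x. x \<in> S \<Longrightarrow> f x * g' x - f' x * g x = c"
      using has_vector_derivative_zero_constant[OF S(1), of "\<lambda>x. f x * g' x - f' x * g x"] by blast
    then show ?thesis using S(2) x by simp
  qed
  have 1: "s x * t' x - s' x * t x = 1" using const[OF s t] init by simp
  have 2: "y x * t' x - y' x * t x = y 0" using const[OF y t] init by simp
  have 3: "y x * s' x - y' x * s x = - y' 0" using const[OF y s] init by simp
  have "y x * (s x * t' x - s' x * t x) = s x * (y x * t' x - y' x * t x) - t x * (y x * s' x - y' x * s x)"
    by (simp add: algebra_simps)
  then show ?thesis unfolding 1 2 3 by simp
qed

text \<open>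
  For \<open>\<mu> = \<mp>1/3\<close> the hypergeometric equation in \<open>exp (- 2 \<xi>)\<close> has exponents \<open>0\<close> and \<open>\<plusminus>1/3\<close> at \<open>0\<close>;
  the pullback along \<open>w \<mapsto> w\<^sup>3\<close> turns \<open>0\<close> into an ordinary point.
\<close>

definition ode_potential :: "real \<Rightarrow> complex" where
  "ode_potential w = of_real (- (27/16) * w / (1 - w ^ 3)\<^sup>2)"

lemma cubic_pullback:
  fixes b c :: complex
  assumes abc: "b \<notin> \<int>" "c \<notin> \<int>" and w: "norm w < 1"
  defines "y \<equiv> w ^ 3"
    and "v \<equiv> \<lambda>w::complex. (1 - w ^ 3) powr (3/4)"
    and "g \<equiv> hyp_ser (3/4) b c" and "g1 \<equiv> hyp_ser' (3/4) b c" and "g2 \<equiv> eval_fps (fps_deriv (fps_deriv (hyp_fps (3/4) b c)))"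
    and "L \<equiv> \<lambda>w::complex. - (9/4) * w\<^sup>2 / (1 - w ^ 3)"
  shows "norm y < 1" "1 - y \<noteq> 0"
    "(v has_field_derivative L w * v w) (at w)"
    "(L has_field_derivative - (9/2) * w / (1 - y) - 27/4 * w ^ 4 / (1 - y)\<^sup>2) (at w)"
    "((\<lambda>w. g (w ^ 3)) has_field_derivative g1 y * (3 * w\<^sup>2)) (at w)"
    "((\<lambda>w. g1 (w ^ 3)) has_field_derivative g2 y * (3 * w\<^sup>2)) (at w)"
    "y * g2 y = (3/4 * b * g y - (c - (7/4 + b) * y) * g1 y) / (1 - y)"
proof -
  have "norm y = norm w ^ 3" by (simp add: y_def norm_power)
  then show y: "norm y < 1" using w by (simp add: power_less_one_iff)
  have "1 - y \<notin> \<real>\<^sub>\<le>\<^sub>0"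
  proof
    assume "1 - y \<in> \<real>\<^sub>\<le>\<^sub>0"
    then have "Re y \<ge> 1" by (auto simp: complex_nonpos_Reals_iff)
    then show False using complex_Re_le_cmod[of y] y by linarith
  qed
  then have ny: "1 - w ^ 3 \<notin> \<real>\<^sub>\<le>\<^sub>0" and nz: "1 - w ^ 3 \<noteq> 0" by (auto simp: y_def)
  then show nz': "1 - y \<noteq> 0" by (simp add: y_def)
  have d3: "((\<lambda>w. 1 - w ^ 3) has_field_derivative - 3 * w\<^sup>2) (at w)"
    by (auto intro!: derivative_eq_intros)
  have "(v has_field_derivative (3/4 * (1 - w ^ 3) powr (3/4 - 1)) * (- 3 * w\<^sup>2)) (at w)"
    unfolding v_def
    by (rule DERIV_chain2[where g = "\<lambda>w. 1 - w ^ 3" and f = "\<lambda>x. x powr (3/4)", OF has_field_derivative_powr[OF ny] d3])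
  moreover have "(1 - w ^ 3) powr (3/4 - 1) = (1 - w ^ 3) powr (3/4) / (1 - w ^ 3)"
    using nz by (subst powr_diff) simp
  ultimately show "(v has_field_derivative L w * v w) (at w)" by (simp add: L_def v_def mult_ac)
  have "(L has_field_derivative ((- (9/4) * (2 * w)) * (1 - w ^ 3) - (- (9/4) * w\<^sup>2) * (- 3 * w\<^sup>2)) /
    ((1 - w ^ 3) * (1 - w ^ 3))) (at w)"
    unfolding L_def by (intro DERIV_divide d3 nz) (auto intro!: derivative_eq_intros)
  then show "(L has_field_derivative - (9/2) * w / (1 - y) - 27/4 * w ^ 4 / (1 - y)\<^sup>2) (at w)"
    by (rule DERIV_cong) (use nz in \<open>simp add: y_def divide_simps\<close>, simp add: algebra_simps power_numeral_reduce)
  have a: "(3/4 :: complex) \<notin> \<int>" by (rule nonint_24[of _ 18]) auto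
  have dy: "((\<lambda>w. w ^ 3) has_field_derivative 3 * w\<^sup>2) (at w)"
    by (auto intro!: derivative_eq_intros)
  show "((\<lambda>w. g (w ^ 3)) has_field_derivative g1 y * (3 * w\<^sup>2)) (at w)"
    "((\<lambda>w. g1 (w ^ 3)) has_field_derivative g2 y * (3 * w\<^sup>2)) (at w)"
    unfolding g_def g1_def g2_def
    by (rule DERIV_chain2[where g = "\<lambda>w. w ^ 3", OF _ dy],
        use DERIV_hyp_ser[OF a abc y] in \<open>simp add: y_def\<close>)+
  have "y * (1 - y) * g2 y + (c - (3/4 + b + 1) * y) * g1 y = 3/4 * b * g y"
    unfolding g_def g1_def g2_def by (rule hyp_ser_ode[OF a abc y])
  then have "y * g2 y * (1 - y) = 3/4 * b * g y - (c - (3/4 + b + 1) * y) * g1 y"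
    unfolding eq_diff_eq by (simp only: mult_ac)
  moreover have "3/4 + b + 1 = 7/4 + b" by simp
  ultimately show "y * g2 y = (3/4 * b * g y - (c - (7/4 + b) * y) * g1 y) / (1 - y)"
    using nz' by (simp only: eq_divide_eq if_True simp_thms)
qed

definition sol1 :: "complex \<Rightarrow> complex" where
  "sol1 w = (1 - w ^ 3) powr (3/4) * hyp_ser (3/4) (5/12) (2/3) (w ^ 3)"

definition sol2 :: "complex \<Rightarrow> complex" where
  "sol2 w = w * ((1 - w ^ 3) powr (3/4) * hyp_ser (3/4) (13/12) (4/3) (w ^ 3))"

lemma sol1_ode:
  obtains s' where "\<And>w. norm w < 1 \<Longrightarrow> (sol1 has_field_derivative s' w) (at w)"
    "\<And>w. norm w < 1 \<Longrightarrow> (s' has_field_derivative (- (27/16) * w / (1 - w ^ 3)\<^sup>2) * sol1 w) (at w)"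
    "sol1 0 = 1" "s' 0 = 0"
proof -
  have bc: "(5/12 :: complex) \<notin> \<int>" "(2/3 :: complex) \<notin> \<int>"
    by (rule nonint_24[of _ 10] nonint_24[of _ 16]; simp)+
  note F = cubic_pullback[OF bc]
  let ?v = "\<lambda>w::complex. (1 - w ^ 3) powr (3/4)" and ?L = "\<lambda>w::complex. - (9/4) * w\<^sup>2 / (1 - w ^ 3)"
  let ?g = "hyp_ser (3/4) (5/12) (2/3)" and ?g1 = "hyp_ser' (3/4) (5/12) (2/3)"
  define s' where "s' = (\<lambda>w. ?v w * (?L w * ?g (w ^ 3) + 3 * w\<^sup>2 * ?g1 (w ^ 3)))"
  show thesis
  proof (rule that[of s'])
    fix w :: complex assume w: "norm w < 1"
    note F = F[OF w]
    show "(sol1 has_field_derivative s' w) (at w)"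
      unfolding sol1_def [abs_def] s'_def
      by (rule DERIV_cong[OF DERIV_mult[OF F(3,5)]]) (simp add: algebra_simps)
    define y v g g1 g2 L where "y = w ^ 3" and "v = ?v w" and "g = ?g y" and "g1 = ?g1 y"
      and "g2 = eval_fps (fps_deriv (fps_deriv (hyp_fps (3/4) (5/12) (2/3)))) y" and "L = ?L w"
    have nz: "1 - y \<noteq> 0" using F(2) by (simp add: y_def)
    have ode: "y * g2 = (3/4 * (5/12) * g - (2/3 - (7/4 + 5/12) * y) * g1) / (1 - y)"
      using F(7) by (simp only: y_def g_def g1_def g2_def)
    have dw: "((\<lambda>w. 3 * w\<^sup>2) has_field_derivative 6 * w) (at w)" by (auto intro!: derivative_eq_intros)
    have "(s' has_field_derivative L * v * (L * g + 3 * w\<^sup>2 * g1) +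
        (((- (9/2) * w / (1 - y) - 27/4 * w ^ 4 / (1 - y)\<^sup>2) * g + g1 * (3 * w\<^sup>2) * L) +
          (6 * w * g1 + g2 * (3 * w\<^sup>2) * (3 * w\<^sup>2))) * v) (at w)"
      unfolding s'_def y_def v_def g_def g1_def g2_def L_def
      by (rule DERIV_mult[OF F(3) DERIV_add[OF DERIV_mult[OF F(4,5)] DERIV_mult[OF dw F(6)]]])
    also have "L * v * (L * g + 3 * w\<^sup>2 * g1) +
        (((- (9/2) * w / (1 - y) - 27/4 * w ^ 4 / (1 - y)\<^sup>2) * g + g1 * (3 * w\<^sup>2) * L) +
          (6 * w * g1 + g2 * (3 * w\<^sup>2) * (3 * w\<^sup>2))) * v
      = v * ((L\<^sup>2 - 9/2 * w / (1 - y) - 27/4 * w * y / (1 - y)\<^sup>2) * g + (6 * w\<^sup>2 * L + 6 * w) * g1 + 9 * w * (y * g2))"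
      by (simp add: y_def algebra_simps power_numeral_reduce)
    also have "\<dots> = - (27/16) * w / (1 - y)\<^sup>2 * (v * g)"
    proof -
      have "L = - (9/4) * w\<^sup>2 / (1 - y)" by (simp add: L_def y_def)
      note Ly = this
      have L: "L\<^sup>2 = 81/16 * w * y / (1 - y)\<^sup>2" "w\<^sup>2 * L = - (9/4) * w * y / (1 - y)"
        unfolding Ly using nz by (simp_all add: divide_simps) (simp_all add: y_def algebra_simps power_numeral_reduce)
      show ?thesis unfolding ode mult.assoc[of 6 "w\<^sup>2" L] L
        using nz by (simp add: divide_simps) (simp add: algebra_simps power2_eq_square)
    qed
    finally show "(s' has_field_derivative (- (27/16) * w / (1 - w ^ 3)\<^sup>2) * sol1 w) (at w)"
      by (simp add: sol1_def y_def v_def g_def)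
  qed (simp_all add: sol1_def s'_def eval_fps_at_0)
qed

lemma sol2_ode:
  obtains s' where "\<And>w. norm w < 1 \<Longrightarrow> (sol2 has_field_derivative s' w) (at w)"
    "\<And>w. norm w < 1 \<Longrightarrow> (s' has_field_derivative (- (27/16) * w / (1 - w ^ 3)\<^sup>2) * sol2 w) (at w)"
    "sol2 0 = 0" "s' 0 = 1"
proof -
  have bc: "(13/12 :: complex) \<notin> \<int>" "(4/3 :: complex) \<notin> \<int>"
    by (rule nonint_24[of _ 26] nonint_24[of _ 32]; simp)+
  note F = cubic_pullback[OF bc]
  let ?v = "\<lambda>w::complex. (1 - w ^ 3) powr (3/4)" and ?L = "\<lambda>w::complex. - (9/4) * w\<^sup>2 / (1 - w ^ 3)"
  let ?g = "hyp_ser (3/4) (13/12) (4/3)" and ?g1 = "hyp_ser' (3/4) (13/12) (4/3)"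
  define s' where "s' = (\<lambda>w. ?v w * ((1 + w * ?L w) * ?g (w ^ 3) + 3 * w ^ 3 * ?g1 (w ^ 3)))"
  show thesis
  proof (rule that[of s'])
    fix w :: complex assume w: "norm w < 1"
    note F = F[OF w]
    have did: "((\<lambda>w. w) has_field_derivative 1) (at w)" by (rule DERIV_ident)
    show "(sol2 has_field_derivative s' w) (at w)"
      unfolding sol2_def [abs_def] s'_def
      by (rule DERIV_cong[OF DERIV_mult[OF did DERIV_mult[OF F(3,5)]]]) (simp add: algebra_simps power_numeral_reduce)
    define y v g g1 g2 L where "y = w ^ 3" and "v = ?v w" and "g = ?g y" and "g1 = ?g1 y"
      and "g2 = eval_fps (fps_deriv (fps_deriv (hyp_fps (3/4) (13/12) (4/3)))) y" and "L = ?L w"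
    have nz: "1 - y \<noteq> 0" using F(2) by (simp add: y_def)
    have ode: "y * g2 = (3/4 * (13/12) * g - (4/3 - (7/4 + 13/12) * y) * g1) / (1 - y)"
      using F(7) by (simp only: y_def g_def g1_def g2_def)
    have dw: "((\<lambda>w. 3 * w ^ 3) has_field_derivative 9 * w\<^sup>2) (at w)" by (auto intro!: derivative_eq_intros)
    have "(s' has_field_derivative L * v * ((1 + w * L) * g + 3 * w ^ 3 * g1) +
        (((0 + (1 * L + (- (9/2) * w / (1 - y) - 27/4 * w ^ 4 / (1 - y)\<^sup>2) * w)) * g + g1 * (3 * w\<^sup>2) *
          (1 + w * L)) + (9 * w\<^sup>2 * g1 + g2 * (3 * w\<^sup>2) * (3 * w ^ 3))) * v) (at w)"
      unfolding s'_def y_def v_def g_def g1_def g2_def L_def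
      by (rule DERIV_mult[OF F(3) DERIV_add[OF DERIV_mult[OF DERIV_add[OF DERIV_const DERIV_mult[OF did F(4)]]
        F(5)] DERIV_mult[OF dw F(6)]]])
    also have "L * v * ((1 + w * L) * g + 3 * w ^ 3 * g1) +
        (((0 + (1 * L + (- (9/2) * w / (1 - y) - 27/4 * w ^ 4 / (1 - y)\<^sup>2) * w)) * g + g1 * (3 * w\<^sup>2) *
          (1 + w * L)) + (9 * w\<^sup>2 * g1 + g2 * (3 * w\<^sup>2) * (3 * w ^ 3))) * v
      = v * ((2 * L + w * L\<^sup>2 - 9/2 * w\<^sup>2 / (1 - y) - 27/4 * w\<^sup>2 * y / (1 - y)\<^sup>2) * g +
        (6 * w * (w\<^sup>2 * L) + 12 * w\<^sup>2) * g1 + 9 * w\<^sup>2 * (y * g2))"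
      by (simp add: y_def algebra_simps power_numeral_reduce)
    also have "\<dots> = - (27/16) * w / (1 - y)\<^sup>2 * (w * (v * g))"
    proof -
      have Ly: "L = - (9/4) * w\<^sup>2 / (1 - y)" by (simp add: L_def y_def)
      have "L\<^sup>2 = 81/16 * w * y / (1 - y)\<^sup>2" "w\<^sup>2 * L = - (9/4) * w * y / (1 - y)"
        unfolding Ly using nz by (simp_all add: divide_simps) (simp_all add: y_def algebra_simps power_numeral_reduce)
      note L = Ly this
      show ?thesis unfolding ode L(2,3) unfolding L(1)
        using nz by (simp add: divide_simps) (simp add: algebra_simps power2_eq_square)
    qed
    finally show "(s' has_field_derivative (- (27/16) * w / (1 - w ^ 3)\<^sup>2) * sol2 w) (at w)"
      by (simp add: sol2_def y_def v_def g_def)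
  qed (simp_all add: sol2_def s'_def eval_fps_at_0)
qed

text \<open>
  In \<open>w = exp (- 2 \<xi> / 3)\<close>, \<open>root_k (\<plusminus>1)\<close> is \<open>(sinh \<xi> A\<^sub>\<plusminus>) powr (1/4)\<close> up to a constant multiple
  of \<open>exp (\<xi> / 3)\<close>, and \<open>root_l\<close> is its logarithmic derivative.
\<close>

definition root_Y :: "real \<Rightarrow> real" where "root_Y w = sqrt (3 * (1 + w + w\<^sup>2))"

definition root_B :: "real \<Rightarrow> real \<Rightarrow> real" where "root_B \<sigma> w = \<sigma> * (1 + w) + 2/3 * root_Y w"

definition root_k :: "real \<Rightarrow> real \<Rightarrow> real" where "root_k \<sigma> w = ((1 - w ^ 3) * root_B \<sigma> w) powr (1/4)"

definition root_l :: "real \<Rightarrow> real \<Rightarrow> real" where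
  "root_l \<sigma> w = (\<sigma> * root_Y w - (1 + w + 4 * w\<^sup>2)) / (4 * (1 - w ^ 3))"

lemma root_Y:
  "root_Y w > 0" "(root_Y w)\<^sup>2 = 3 * (1 + w + w\<^sup>2)"
  "(root_Y has_real_derivative 3 * (1 + 2 * w) / (2 * root_Y w)) (at w)"
proof -
  have "1 + w + w\<^sup>2 = (w + 1/2)\<^sup>2 + 3/4" by (simp add: power2_eq_square algebra_simps)
  then have pos: "1 + w + w\<^sup>2 > 0" by (simp add: add_nonneg_pos)
  then show Y: "root_Y w > 0" "(root_Y w)\<^sup>2 = 3 * (1 + w + w\<^sup>2)" by (simp_all add: root_Y_def)
  have "((\<lambda>w. 3 * (1 + w + w\<^sup>2)) has_real_derivative 3 * (1 + 2 * w)) (at w)"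
    by (auto intro!: derivative_eq_intros)
  from DERIV_chain2[OF DERIV_real_sqrt this] pos
  show "(root_Y has_real_derivative 3 * (1 + 2 * w) / (2 * root_Y w)) (at w)"
    by (simp add: root_Y_def [abs_def] inverse_eq_divide mult.commute)
qed

lemma cube_less_one: "w ^ 3 < 1" if "-1 < w" "w < 1" for w :: real
proof -
  have "(1 - w) * (1 + w + w\<^sup>2) > 0"
    using that zero_less_power[OF root_Y(1), of w 2] unfolding root_Y(2) by (intro mult_pos_pos) auto
  then show ?thesis by (simp add: algebra_simps power_numeral_reduce)
qed

lemma root_B_pos:
  assumes "\<sigma>\<^sup>2 = 1" "-1 < w" "w < 1"
  shows "root_B \<sigma> w > 0"
proof -
  have "0 < (1 - w) * (1 - w)" using assms(3) by simp
  then have "(1 + w)\<^sup>2 < 4/9 * (3 * (1 + w + w\<^sup>2))"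
    by (simp add: power2_eq_square algebra_simps)
  also have "\<dots> = (2/3 * root_Y w)\<^sup>2" unfolding root_Y(2)[symmetric] by (simp add: power2_eq_square)
  finally have "1 + w < 2/3 * root_Y w"
    by (rule power2_less_imp_less) (use root_Y(1)[of w] in simp)
  moreover have "\<sigma> = 1 \<or> \<sigma> = -1" using assms(1) by (simp add: power2_eq_1_iff)
  ultimately show ?thesis using assms(2) root_Y(1)[of w] by (auto simp: root_B_def)
qed

lemma root_k_deriv:
  assumes \<sigma>: "\<sigma>\<^sup>2 = 1" and w: "-1 < w" "w < 1"
  shows "(root_k \<sigma> has_real_derivative root_k \<sigma> w * root_l \<sigma> w) (at w)"
    "((\<lambda>w. root_k \<sigma> w * root_l \<sigma> w) has_real_derivative - (27/16) * w / (1 - w ^ 3)\<^sup>2 * root_k \<sigma> w) (at w)"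
proof -
  define Y where "Y = root_Y w"
  have Y: "Y > 0" "Y\<^sup>2 = 3 * (1 + w + w\<^sup>2)" using root_Y by (simp_all add: Y_def)
  have c: "1 - w ^ 3 > 0" using cube_less_one[OF w] by simp
  have B: "root_B \<sigma> w > 0" by (rule root_B_pos[OF \<sigma> w])
  have dc: "((\<lambda>w. 1 - w ^ 3) has_real_derivative - 3 * w\<^sup>2) (at w)" by (auto intro!: derivative_eq_intros)
  have dB: "(root_B \<sigma> has_real_derivative \<sigma> + (1 + 2 * w) / Y) (at w)"
  proof -
    have "(root_B \<sigma> has_real_derivative \<sigma> * 1 + 2/3 * (3 * (1 + 2 * w) / (2 * root_Y w))) (at w)"
      unfolding root_B_def [abs_def] by (intro DERIV_add DERIV_cmult root_Y) (auto intro!: derivative_eq_intros)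
    moreover have "2/3 * (3 * (1 + 2 * w) / (2 * root_Y w)) = (1 + 2 * w) / Y"
      using Y(1) by (simp add: Y_def divide_simps)
    ultimately show ?thesis by simp
  qed
  have key: "(\<sigma> + (1 + 2 * w) / Y) * (1 - w ^ 3) - 3 * w\<^sup>2 * root_B \<sigma> w = (\<sigma> * Y - (1 + w + 4 * w\<^sup>2)) * root_B \<sigma> w"
  proof -
    have Y3: "(1 - w ^ 3) / Y = (1 - w) * Y / 3"
    proof -
      have "1 - w ^ 3 = (1 - w) * (Y\<^sup>2 / 3)" unfolding Y(2) by (simp add: algebra_simps power_numeral_reduce)
      then show ?thesis using Y(1) by (simp add: power2_eq_square)
    qed
    have k1: "(\<sigma> + (1 + 2 * w) / Y) * (1 - w ^ 3) = \<sigma> * (1 - w ^ 3) + (1 + 2 * w) * ((1 - w) * Y / 3)"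
      unfolding Y3[symmetric] by (simp add: algebra_simps)
    have k2: "(\<sigma> * Y - (1 + w + 4 * w\<^sup>2)) * root_B \<sigma> w =
      \<sigma>\<^sup>2 * (Y * (1 + w)) + 2/3 * \<sigma> * Y\<^sup>2 - (1 + w + 4 * w\<^sup>2) * root_B \<sigma> w"
      by (simp add: root_B_def Y_def algebra_simps power2_eq_square)
    obtain Z where Z: "Y = 3 * Z" by (metis nonzero_mult_div_cancel_left times_divide_eq_right zero_neq_numeral)
    have Z3: "(1 - w) * (3 * Z) / 3 = (1 - w) * Z" "2 / 3 * (3 * Z) = 2 * Z" by simp_all
    show ?thesis unfolding k1 k2 \<sigma> Y(2) unfolding root_B_def Y_def[symmetric] Z Z3
      by (simp add: algebra_simps power_numeral_reduce)
  qed
  have "(root_k \<sigma> has_real_derivative root_k \<sigma> w * (1/4 *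
     (((- 3 * w\<^sup>2) * root_B \<sigma> w + (\<sigma> + (1 + 2 * w) / Y) * (1 - w ^ 3)) / ((1 - w ^ 3) * root_B \<sigma> w)))) (at w)"
    unfolding root_k_def [abs_def] using c B by (intro DERIV_powr_log DERIV_mult dc dB) simp_all
  also have "(- 3 * w\<^sup>2) * root_B \<sigma> w + (\<sigma> + (1 + 2 * w) / Y) * (1 - w ^ 3) = (\<sigma> * Y - (1 + w + 4 * w\<^sup>2)) * root_B \<sigma> w"
    using key by simp
  also have "1/4 * ((\<sigma> * Y - (1 + w + 4 * w\<^sup>2)) * root_B \<sigma> w / ((1 - w ^ 3) * root_B \<sigma> w)) = root_l \<sigma> w"
    using c B by (simp add: root_l_def Y_def)
  finally show d1: "(root_k \<sigma> has_real_derivative root_k \<sigma> w * root_l \<sigma> w) (at w)" .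
  define n where "n = \<sigma> * Y - (1 + w + 4 * w\<^sup>2)"
  define n' where "n' = \<sigma> * (3 * (1 + 2 * w) / (2 * Y)) - (1 + 8 * w)"
  have l: "root_l \<sigma> w = n / (4 * (1 - w ^ 3))" by (simp add: root_l_def n_def Y_def)
  have "((\<lambda>w. 1 + w + 4 * w\<^sup>2) has_real_derivative 1 + 8 * w) (at w)"
    by (auto intro!: derivative_eq_intros)
  from DERIV_diff[OF DERIV_cmult[OF root_Y(3), of \<sigma>] this]
  have dn: "((\<lambda>w. \<sigma> * root_Y w - (1 + w + 4 * w\<^sup>2)) has_real_derivative n') (at w)"
    by (simp add: n'_def Y_def)
  have "(root_l \<sigma> has_real_derivative (n' * (4 * (1 - w ^ 3)) - n * (4 * (- 3 * w\<^sup>2))) /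
    (4 * (1 - w ^ 3) * (4 * (1 - w ^ 3)))) (at w)"
    unfolding root_l_def [abs_def] using DERIV_divide[OF dn DERIV_cmult[OF dc, of 4]] c by (simp add: n_def Y_def)
  from DERIV_mult[OF d1 this]
  show "((\<lambda>w. root_k \<sigma> w * root_l \<sigma> w) has_real_derivative - (27/16) * w / (1 - w ^ 3)\<^sup>2 * root_k \<sigma> w) (at w)"
  proof (rule DERIV_cong)
    have Y3: "n' * (1 - w ^ 3) = \<sigma> * ((1 + 2 * w) * (1 - w) * Y / 2) - (1 + 8 * w) * (1 - w ^ 3)"
    proof -
      have "1 - w ^ 3 = (1 - w) * (Y\<^sup>2 / 3)" unfolding Y(2) by (simp add: algebra_simps power_numeral_reduce)
      then have "(1 - w ^ 3) / Y = (1 - w) * Y / 3" using Y(1) by (simp add: power2_eq_square)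
      note a = this
      have "n' * (1 - w ^ 3) = \<sigma> * (3 * (1 + 2 * w) / 2) * ((1 - w ^ 3) / Y) - (1 + 8 * w) * (1 - w ^ 3)"
        by (simp add: n'_def left_diff_distrib)
      then show ?thesis unfolding a by simp (simp add: algebra_simps)
    qed
    have "n\<^sup>2 = \<sigma>\<^sup>2 * Y\<^sup>2 - 2 * \<sigma> * Y * (1 + w + 4 * w\<^sup>2) + (1 + w + 4 * w\<^sup>2)\<^sup>2"
      by (simp add: n_def power2_eq_square algebra_simps)
    then have n2: "n\<^sup>2 = 3 * (1 + w + w\<^sup>2) - 2 * \<sigma> * Y * (1 + w + 4 * w\<^sup>2) + (1 + w + 4 * w\<^sup>2)\<^sup>2"
      unfolding \<sigma> Y(2) by simp
    have N: "n\<^sup>2 + 4 * (n' * (1 - w ^ 3)) + 12 * w\<^sup>2 * n = - 27 * w"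
    proof -
      have "4 * (n' * (1 - w ^ 3)) = 2 * \<sigma> * (1 + 2 * w) * (1 - w) * Y - 4 * (1 + 8 * w) * (1 - w ^ 3)"
        unfolding Y3 by simp
      then show ?thesis unfolding n2 by (simp only: n_def) (simp add: algebra_simps power_numeral_reduce)
    qed
    define C where "C = 1 - w ^ 3"
    have C: "C \<noteq> 0" using c by (simp add: C_def)
    have "root_k \<sigma> w * (n / (4 * C)) * (n / (4 * C)) +
      (n' * (4 * C) - n * (4 * (- 3 * w\<^sup>2))) / (4 * C * (4 * C)) * root_k \<sigma> w
       = root_k \<sigma> w * (n\<^sup>2 + 4 * (n' * C) + 12 * w\<^sup>2 * n) / (16 * C\<^sup>2)"
    proof -
      have 1: "k * (n / (4 * C)) * (n / (4 * C)) = k * n\<^sup>2 / (16 * C\<^sup>2)" for k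
        by (simp add: power2_eq_square)
      have 2: "(n' * (4 * C) - n * (4 * (- 3 * w\<^sup>2))) / (4 * C * (4 * C)) * k =
        k * (4 * (n' * C) + 12 * w\<^sup>2 * n) / (16 * C\<^sup>2)" for k
        by (simp add: power2_eq_square mult_ac)
      show ?thesis unfolding 1 2 add_divide_distrib[symmetric] distrib_left[symmetric] by (simp only: add.assoc)
    qed
    also have "\<dots> = - (27/16) * w / C\<^sup>2 * root_k \<sigma> w"
      unfolding N[folded C_def] by simp
    finally show "root_k \<sigma> w * root_l \<sigma> w * root_l \<sigma> w +
      (n' * (4 * (1 - w ^ 3)) - n * (4 * (- 3 * w\<^sup>2))) / (4 * (1 - w ^ 3) * (4 * (1 - w ^ 3))) * root_k \<sigma> w
      = - (27/16) * w / (1 - w ^ 3)\<^sup>2 * root_k \<sigma> w"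
      unfolding l C_def .
  qed
qed

lemma cosh_sinh_triple:
  fixes t :: real
  shows "cosh (3 * t) = cosh t * ((cosh t)\<^sup>2 + 3 * (sinh t)\<^sup>2)"
    and "sinh (3 * t) = sinh t * (3 * (cosh t)\<^sup>2 + (sinh t)\<^sup>2)"
proof -
  have "3 * t = 2 * t + t" by simp
  then show "cosh (3 * t) = cosh t * ((cosh t)\<^sup>2 + 3 * (sinh t)\<^sup>2)"
    "sinh (3 * t) = sinh t * (3 * (cosh t)\<^sup>2 + (sinh t)\<^sup>2)"
    by (simp_all only: cosh_add sinh_add cosh_double sinh_double) (simp_all add: algebra_simps power2_eq_square)
qed

lemma oct_point:
  fixes x y t \<delta> :: real
  assumes x: "x > 0" "y > 0" and t: "t > 0" and \<delta>: "\<delta> * \<delta> = 1"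
    and sub: "x - y = \<delta> * (2 * cosh t)" and prod: "x * y = (sinh t)\<^sup>2 / 3"
  defines "u \<equiv> complex_of_real (- (y / x))"
  shows "p_e u = of_real (\<delta> * (8 * cosh (3 * t)) / x ^ 3)"
    and "oct_R u = of_real ((sinh (3 * t) / cosh (3 * t))\<^sup>2)"
    and "u \<in> oct_dom"
proof -
  define v where "v = - (y / x)"
  define c s where "c = cosh t" and "s = sinh t"
  have vx: "v * x = - y" using x by (simp add: v_def)
  have uv: "u = of_real v" by (simp add: u_def v_def)
  have "(x - y)\<^sup>2 = (\<delta> * \<delta>) * (4 * c\<^sup>2)" unfolding sub by (simp add: c_def power2_eq_square)
  then have sq: "(x - y)\<^sup>2 = 4 * c\<^sup>2" unfolding \<delta> by simp
  have "((1 + v) * (1 - 34 * v + v\<^sup>2)) * x ^ 3 = (x + v * x) * (x\<^sup>2 - 34 * (v * x) * x + (v * x)\<^sup>2)"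
    by (simp add: algebra_simps power_numeral_reduce)
  also have "\<dots> = (x - y) * ((x - y)\<^sup>2 + 36 * (x * y))" unfolding vx by (simp add: algebra_simps power_numeral_reduce)
  also have "\<dots> = \<delta> * (8 * cosh (3 * t))"
    unfolding sq prod unfolding cosh_sinh_triple sub by (simp add: c_def s_def algebra_simps)
  finally have e: "(1 + v) * (1 - 34 * v + v\<^sup>2) = \<delta> * (8 * cosh (3 * t)) / x ^ 3"
    using x by (simp add: eq_divide_eq)
  have "p_e u = of_real ((1 + v) * (1 - 34 * v + v\<^sup>2))" by (simp add: p_e_def uv)
  then show pe: "p_e u = of_real (\<delta> * (8 * cosh (3 * t)) / x ^ 3)" unfolding e .
  have "(v * (1 - v) ^ 4) * x ^ 6 = (v * x) * x * ((x - v * x)\<^sup>2)\<^sup>2"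
    by (simp add: algebra_simps power_numeral_reduce)
  also have "\<dots> = - (x * y) * ((x - y)\<^sup>2 + 4 * (x * y))\<^sup>2" unfolding vx by (simp add: algebra_simps power_numeral_reduce)
  also have "\<dots> = - (16/27) * (sinh (3 * t))\<^sup>2"
    unfolding sq prod cosh_sinh_triple by (simp add: c_def s_def field_simps power_numeral_reduce)
  finally have pv: "v * (1 - v) ^ 4 = - (16/27) * (sinh (3 * t))\<^sup>2 / x ^ 6"
    using x by (subst nonzero_eq_divide_eq) simp_all
  have "p_v u = of_real (v * (1 - v) ^ 4)" by (simp add: p_v_def uv)
  then have "oct_R u = of_real (-108 * (- (16/27) * (sinh (3 * t))\<^sup>2 / x ^ 6) / (\<delta> * (8 * cosh (3 * t)) / x ^ 3)\<^sup>2)"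
    unfolding oct_R_def pe pv by simp
  also have "-108 * (- (16/27) * (sinh (3 * t))\<^sup>2 / x ^ 6) / (\<delta> * (8 * cosh (3 * t)) / x ^ 3)\<^sup>2 =
    (sinh (3 * t) / cosh (3 * t))\<^sup>2"
  proof -
    have "(\<delta> * (8 * cosh (3 * t)) / x ^ 3)\<^sup>2 = 64 * (cosh (3 * t))\<^sup>2 / x ^ 6"
      using \<delta> by (simp add: power_divide power_mult_distrib power2_eq_square[of \<delta>] flip: power_mult)
    then show ?thesis using x by (simp add: power_divide)
  qed
  finally show R: "oct_R u = of_real ((sinh (3 * t) / cosh (3 * t))\<^sup>2)" .
  have "\<delta> \<noteq> 0" using \<delta> by auto
  then have pe0: "p_e u \<noteq> 0" unfolding pe using x by simp
  have "p_f u \<noteq> 0"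
  proof
    assume "p_f u = 0"
    then have "(sinh (3 * t) / cosh (3 * t))\<^sup>2 = 1"
      using R oct_R_altdef[OF pe0] by (metis diff_zero div_0 of_real_eq_1_iff power_zero_numeral)
    then have "(sinh (3 * t))\<^sup>2 = (cosh (3 * t))\<^sup>2" by (simp add: power_divide)
    then show False using cosh_square_eq[of "3 * t"] by simp
  qed
  moreover have "v < 0" using x by (simp add: v_def)
  then have "u \<noteq> 0" "u \<noteq> 1" by (simp_all add: uv del: of_real_eq_0_iff of_real_eq_1_iff) (auto simp: uv)
  ultimately show "u \<in> oct_dom" using pe0 by (simp add: oct_dom_def)
qed

lemma A_facts:
  assumes "\<xi> > 0"
  shows "A_plus \<xi> > 0" "A_minus \<xi> > 0" "A_plus \<xi> - A_minus \<xi> = 2 * cosh (\<xi> / 3)"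
    "A_plus \<xi> * A_minus \<xi> = (sinh (\<xi> / 3))\<^sup>2 / 3"
proof -
  define c where "c = cosh (\<xi> / 3)"
  have s: "(sinh (\<xi> / 3))\<^sup>2 = c\<^sup>2 - 1" using cosh_square_eq[of "\<xi> / 3"] by (simp add: c_def)
  have c: "c \<ge> 1" by (simp add: c_def cosh_real_ge_1)
  then have "1 \<le> c\<^sup>2" by (rule one_le_power)
  then have pos: "(4 * c\<^sup>2 - 1) / 3 > 0" by simp
  define r where "r = sqrt ((4 * c\<^sup>2 - 1) / 3)"
  have r: "r > 0" "r\<^sup>2 = (4 * c\<^sup>2 - 1) / 3" using pos by (simp_all add: r_def)
  have A: "A_plus \<xi> = c + r" "A_minus \<xi> = r - c" by (simp_all add: A_plus_def A_minus_def c_def r_def)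
  show "A_plus \<xi> - A_minus \<xi> = 2 * cosh (\<xi> / 3)" by (simp add: A flip: c_def)
  have "A_plus \<xi> * A_minus \<xi> = r\<^sup>2 - c\<^sup>2" by (simp add: A algebra_simps power2_eq_square)
  then show P: "A_plus \<xi> * A_minus \<xi> = (sinh (\<xi> / 3))\<^sup>2 / 3" unfolding r(2) s by (simp add: field_simps)
  show "A_plus \<xi> > 0" using A(1) r(1) c by simp
  moreover have "A_plus \<xi> * A_minus \<xi> > 0" unfolding P using assms by simp
  ultimately show "A_minus \<xi> > 0" by (simp add: zero_less_mult_iff)
qed

lemma A_deriv:
  assumes "\<xi> > 0"
  shows "(A_plus has_real_derivative deriv A_plus \<xi>) (at \<xi>)" "(A_minus has_real_derivative deriv A_minus \<xi>) (at \<xi>)"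
proof -
  have c: "cosh (\<xi> / 3) \<ge> 1" by (simp add: cosh_real_ge_1)
  then have "1 \<le> (cosh (\<xi> / 3))\<^sup>2" by (rule one_le_power)
  then have pos: "(4 * (cosh (\<xi> / 3))\<^sup>2 - 1) / 3 > 0" by simp
  have dc: "((\<lambda>\<xi>. cosh (\<xi> / 3)) has_real_derivative sinh (\<xi> / 3) / 3) (at \<xi>)"
    by (auto intro!: derivative_eq_intros)
  have "((\<lambda>\<xi>. (4 * (cosh (\<xi> / 3))\<^sup>2 - 1) / 3) has_real_derivative (8 * cosh (\<xi> / 3) * (sinh (\<xi> / 3) / 3)) / 3) (at \<xi>)"
    by (auto intro!: derivative_eq_intros dc)
  note dr = DERIV_chain2[OF DERIV_real_sqrt[OF pos] this]
  have "\<exists>D. (A_plus has_real_derivative D) (at \<xi>)" "\<exists>D. (A_minus has_real_derivative D) (at \<xi>)"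
    unfolding A_plus_def [abs_def] A_minus_def [abs_def]
    using DERIV_add[OF dc dr] DERIV_add[OF DERIV_minus[OF dc] dr] by blast+
  then show "(A_plus has_real_derivative deriv A_plus \<xi>) (at \<xi>)" "(A_minus has_real_derivative deriv A_minus \<xi>) (at \<xi>)"
    using DERIV_imp_deriv by blast+
qed

interpretation branch_plus: oct_branch A_plus "\<lambda>\<xi>. - (A_minus \<xi> / A_plus \<xi>)" "deriv A_plus"
  "\<lambda>\<xi>. - ((deriv A_minus \<xi> * A_plus \<xi> - A_minus \<xi> * deriv A_plus \<xi>) / (A_plus \<xi> * A_plus \<xi>))" 1
proof
  fix \<xi> :: real assume \<xi>: "\<xi> > 0"
  note A = A_facts[OF \<xi>]
  show "((\<lambda>\<xi>. - (A_minus \<xi> / A_plus \<xi>)) has_real_derivative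
     - ((deriv A_minus \<xi> * A_plus \<xi> - A_minus \<xi> * deriv A_plus \<xi>) / (A_plus \<xi> * A_plus \<xi>))) (at \<xi>)"
    using A by (intro DERIV_minus DERIV_divide A_deriv \<xi>) auto
  note P = oct_point[OF A(1,2) _ _ _ A(4), of 1]
  show "p_e (of_real (- (A_minus \<xi> / A_plus \<xi>))) = of_real (1 * (8 * cosh \<xi>) / A_plus \<xi> ^ 3)"
    "oct_R (of_real (- (A_minus \<xi> / A_plus \<xi>))) = of_real ((sinh \<xi> / cosh \<xi>)\<^sup>2)"
    "of_real (- (A_minus \<xi> / A_plus \<xi>)) \<in> oct_dom"
    using P A(3) \<xi> by simp_all
qed (simp_all add: A_facts A_deriv)

interpretation branch_minus: oct_branch A_minus "\<lambda>\<xi>. - (A_plus \<xi> / A_minus \<xi>)" "deriv A_minus"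
  "\<lambda>\<xi>. - ((deriv A_plus \<xi> * A_minus \<xi> - A_plus \<xi> * deriv A_minus \<xi>) / (A_minus \<xi> * A_minus \<xi>))" "-1"
proof
  fix \<xi> :: real assume \<xi>: "\<xi> > 0"
  note A = A_facts[OF \<xi>]
  show "((\<lambda>\<xi>. - (A_plus \<xi> / A_minus \<xi>)) has_real_derivative
     - ((deriv A_plus \<xi> * A_minus \<xi> - A_plus \<xi> * deriv A_minus \<xi>) / (A_minus \<xi> * A_minus \<xi>))) (at \<xi>)"
    using A by (intro DERIV_minus DERIV_divide A_deriv \<xi>) auto
  have prod: "A_minus \<xi> * A_plus \<xi> = (sinh (\<xi> / 3))\<^sup>2 / 3" using A(4) by (simp only: mult.commute)
  have sub: "A_minus \<xi> - A_plus \<xi> = -1 * (2 * cosh (\<xi> / 3))" using A(3) by simp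
  note P = oct_point[OF A(2,1) _ _ sub prod]
  show "p_e (of_real (- (A_plus \<xi> / A_minus \<xi>))) = of_real (-1 * (8 * cosh \<xi>) / A_minus \<xi> ^ 3)"
    "oct_R (of_real (- (A_plus \<xi> / A_minus \<xi>))) = of_real ((sinh \<xi> / cosh \<xi>)\<^sup>2)"
    "of_real (- (A_plus \<xi> / A_minus \<xi>)) \<in> oct_dom"
    using P \<xi> by simp_all
qed (simp_all add: A_facts A_deriv)

lemma root_k_solution:
  assumes w: "-1 < w" "w < 1"
  shows "complex_of_real (a * root_k 1 w + b * root_k (-1) w) =
    of_real (a * root_k 1 0 + b * root_k (-1) 0) * sol1 (of_real w) +
    of_real (a * (root_k 1 0 * root_l 1 0) + b * (root_k (-1) 0 * root_l (-1) 0)) * sol2 (of_real w)"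
proof -
  obtain s1 where s1: "\<And>w. norm w < 1 \<Longrightarrow> (sol1 has_field_derivative s1 w) (at w)"
    "\<And>w. norm w < 1 \<Longrightarrow> (s1 has_field_derivative (- (27/16) * w / (1 - w ^ 3)\<^sup>2) * sol1 w) (at w)"
    "sol1 0 = 1" "s1 0 = 0" by (rule sol1_ode) blast
  obtain s2 where s2: "\<And>w. norm w < 1 \<Longrightarrow> (sol2 has_field_derivative s2 w) (at w)"
    "\<And>w. norm w < 1 \<Longrightarrow> (s2 has_field_derivative (- (27/16) * w / (1 - w ^ 3)\<^sup>2) * sol2 w) (at w)"
    "sol2 0 = 0" "s2 0 = 1" by (rule sol2_ode) blast
  have small: "norm (complex_of_real x) < 1" if "x \<in> {-1<..<1}" for x using that by auto
  have V: "- (27/16) * complex_of_real x / (1 - complex_of_real x ^ 3)\<^sup>2 = ode_potential x" for x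
    by (simp add: ode_potential_def)
  let ?y = "\<lambda>w. complex_of_real (a * root_k 1 w + b * root_k (-1) w)"
  let ?y' = "\<lambda>w. complex_of_real (a * (root_k 1 w * root_l 1 w) + b * (root_k (-1) w * root_l (-1) w))"
  have "?y w = ?y 0 * sol1 (of_real w) + ?y' 0 * sol2 (of_real w)"
  proof (rule wronskian_unique[where S = "{-1<..<1}" and V = ode_potential and y = ?y and y' = ?y'
        and s = "\<lambda>w. sol1 (of_real w)" and s' = "\<lambda>w. s1 (of_real w)" and t = "\<lambda>w. sol2 (of_real w)" and t'
          = "\<lambda>w. s2 (of_real w)"])
    fix x :: real assume x: "x \<in> {-1<..<1}"
    then have x1: "-1 < x" "x < 1" by auto
    have "((\<lambda>w. a * root_k 1 w + b * root_k (-1) w) has_real_derivative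
        a * (root_k 1 x * root_l 1 x) + b * (root_k (-1) x * root_l (-1) x)) (at x)"
      by (intro DERIV_add DERIV_cmult root_k_deriv x1) simp_all
    then show "(?y has_vector_derivative ?y' x) (at x)"
      by (intro has_vector_derivative_of_real) (simp add: has_real_derivative_iff_has_vector_derivative)
    have "((\<lambda>w. a * (root_k 1 w * root_l 1 w) + b * (root_k (-1) w * root_l (-1) w)) has_real_derivative
        a * (- (27/16) * x / (1 - x ^ 3)\<^sup>2 * root_k 1 x) + b * (- (27/16) * x / (1 - x ^ 3)\<^sup>2 * root_k (-1) x)) (at x)"
      by (intro DERIV_add DERIV_cmult root_k_deriv x1) simp_all
    then have "(?y' has_vector_derivative of_real (a * (- (27/16) * x / (1 - x ^ 3)\<^sup>2 * root_k 1 x) +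
      b * (- (27/16) * x / (1 - x ^ 3)\<^sup>2 * root_k (-1) x))) (at x)"
      by (intro has_vector_derivative_of_real) (simp add: has_real_derivative_iff_has_vector_derivative)
    also have "a * (- (27/16) * x / (1 - x ^ 3)\<^sup>2 * root_k 1 x) + b * (- (27/16) * x / (1 - x ^ 3)\<^sup>2 * root_k (-1) x)
      = (- (27/16) * x / (1 - x ^ 3)\<^sup>2) * (a * root_k 1 x + b * root_k (-1) x)"
      by (simp only: distrib_left distrib_right mult_ac)
    finally show "(?y' has_vector_derivative ode_potential x * ?y x) (at x)"
      by (simp only: ode_potential_def of_real_mult)
    show "((\<lambda>w. sol1 (of_real w)) has_vector_derivative s1 (of_real x)) (at x)"
      "((\<lambda>w. s1 (of_real w)) has_vector_derivative ode_potential x * sol1 (of_real x)) (at x)"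
      "((\<lambda>w. sol2 (of_real w)) has_vector_derivative s2 (of_real x)) (at x)"
      "((\<lambda>w. s2 (of_real w)) has_vector_derivative ode_potential x * sol2 (of_real x)) (at x)"
      by (rule has_vector_derivative_real_field, rule s1(1)[OF small[OF x]] s1(2)[OF small[OF x], unfolded V]
          s2(1)[OF small[OF x]] s2(2)[OF small[OF x], unfolded V])+
  qed (use w s1 s2 in auto)
  then show ?thesis .
qed

lemma fourth_root_power: "(x ^ 4) powr (1/4) = x" if "x > 0" for x :: real
proof -
  have "x ^ 4 = x powr 4" using that by simp
  then have "(x ^ 4) powr (1/4) = x powr (4 * (1/4))" by (simp only: powr_powr)
  then show ?thesis using that by simp
qed

lemma root_init:
  defines "\<kappa> \<equiv> (2 / sqrt 3) powr (1/4)"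
  shows "sqrt (sqrt 3 - 1) * root_k 1 0 = \<kappa>" "sqrt (sqrt 3 + 1) * root_k (-1) 0 = \<kappa>"
    "sqrt (sqrt 3 + 1) * root_k 1 0 = \<kappa> * ((sqrt 3 + 1) / sqrt 2)"
    "sqrt (sqrt 3 - 1) * root_k (-1) 0 = \<kappa> * ((sqrt 3 - 1) / sqrt 2)"
    "root_l 1 0 = (sqrt 3 - 1) / 4" "root_l (-1) 0 = (- sqrt 3 - 1) / 4"
proof -
  define r where "r = sqrt (3::real)"
  have r: "r > 1" "r * r = 3" by (simp_all add: r_def)
  have r2: "2/3 * r > 1"
  proof -
    have "(3/2)\<^sup>2 < r\<^sup>2" using r(2) by (simp add: power2_eq_square)
    then have "3/2 < r" by (rule power2_less_imp_less) (use r in simp)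
    then show ?thesis by simp
  qed
  have sq: "sqrt x = (x\<^sup>2) powr (1/4)" if "x > 0" for x
  proof -
    have "x\<^sup>2 = x powr 2" using that by simp
    then have "(x\<^sup>2) powr (1/4) = x powr (2 * (1/4))" by (simp only: powr_powr)
    then show ?thesis using that by (simp add: powr_half_sqrt)
  qed
  have four: "x = (x ^ 4) powr (1/4)" if "x > 0" for x :: real
    by (rule fourth_root_power [symmetric, OF that])
  have k: "root_k 1 0 = (1 + 2/3 * r) powr (1/4)" "root_k (-1) 0 = (2/3 * r - 1) powr (1/4)"
    by (simp_all add: root_k_def root_B_def root_Y_def r_def)
  have s2: "(1 / sqrt 2) ^ 4 = (1/4 :: real)"
    by (simp add: power_divide power4_eq_xxxx)
  have p3: "r ^ 2 = 3" "2 / r = 2/3 * r" using r by (simp_all add: power2_eq_square field_simps)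
  have base: "\<kappa> = (2/3 * r) powr (1/4)" by (simp only: \<kappa>_def r_def[symmetric] p3(2))
  have "sqrt (r - 1) * root_k 1 0 = ((r - 1)\<^sup>2 * (1 + 2/3 * r)) powr (1/4)"
    using r unfolding k by (subst sq) (simp_all add: powr_mult)
  also have "(r - 1)\<^sup>2 * (1 + 2/3 * r) = 2/3 * r" using r(2) by (simp add: power2_eq_square algebra_simps)
  finally show "sqrt (sqrt 3 - 1) * root_k 1 0 = \<kappa>" unfolding base by (simp only: r_def)
  have "sqrt (r + 1) * root_k (-1) 0 = ((r + 1)\<^sup>2 * (2/3 * r - 1)) powr (1/4)"
    using r r2 unfolding k by (subst sq) (simp_all add: powr_mult)
  also have "(r + 1)\<^sup>2 * (2/3 * r - 1) = 2/3 * r" using r(2) by (simp add: power2_eq_square algebra_simps)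
  finally show "sqrt (sqrt 3 + 1) * root_k (-1) 0 = \<kappa>" unfolding base by (simp only: r_def)
  have "sqrt (r + 1) * root_k 1 0 = ((r + 1)\<^sup>2 * (1 + 2/3 * r)) powr (1/4)"
    using r unfolding k by (subst sq) (simp_all add: powr_mult)
  also have "(r + 1)\<^sup>2 * (1 + 2/3 * r) = (2/3 * r) * ((r + 1) * (1 / sqrt 2)) ^ 4"
    unfolding power_mult_distrib s2 using r(2) by (simp add: power2_eq_square power4_eq_xxxx algebra_simps)
  also have "((2/3 * r) * ((r + 1) * (1 / sqrt 2)) ^ 4) powr (1/4) = \<kappa> * ((r + 1) * (1 / sqrt 2))"
    unfolding base using r four[of "(r + 1) * (1 / sqrt 2)"] by (subst powr_mult) simp_all
  finally show "sqrt (sqrt 3 + 1) * root_k 1 0 = \<kappa> * ((sqrt 3 + 1) / sqrt 2)" by (simp add: r_def)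
  have "sqrt (r - 1) * root_k (-1) 0 = ((r - 1)\<^sup>2 * (2/3 * r - 1)) powr (1/4)"
    using r r2 unfolding k by (subst sq) (simp_all add: powr_mult)
  also have "(r - 1)\<^sup>2 * (2/3 * r - 1) = (2/3 * r) * ((r - 1) * (1 / sqrt 2)) ^ 4"
    unfolding power_mult_distrib s2 using r(2) by (simp add: power2_eq_square power4_eq_xxxx algebra_simps)
  also have "((2/3 * r) * ((r - 1) * (1 / sqrt 2)) ^ 4) powr (1/4) = \<kappa> * ((r - 1) * (1 / sqrt 2))"
    unfolding base using r four[of "(r - 1) * (1 / sqrt 2)"] by (subst powr_mult) simp_all
  finally show "sqrt (sqrt 3 - 1) * root_k (-1) 0 = \<kappa> * ((sqrt 3 - 1) / sqrt 2)" by (simp add: r_def)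
  show "root_l 1 0 = (sqrt 3 - 1) / 4" "root_l (-1) 0 = (- sqrt 3 - 1) / 4"
    by (simp_all add: root_l_def root_Y_def)
qed

lemma const_values:
  defines "\<kappa> \<equiv> (2 / sqrt 3) powr (1/4)"
  shows "2 powr (5/4) * 3 powr (-3/8) * (4 powr (-1/4) * (\<kappa> * (sqrt 3 / 2))) = 1"
    and "2 powr (-1/4) * 3 powr (-3/8) * (4 powr (-1/4) * (\<kappa> * (2 * sqrt 3 / sqrt 2))) = 1"
proof -
  have s: "sqrt 3 = 3 powr (1/2)" "sqrt 2 = 2 powr (1/2)" by (simp_all add: powr_half_sqrt)
  have "(3::real) powr (-1/8) = 1 / 3 powr (1/8)" using powr_minus_divide[of "3::real" "1/8"] by simp
  then have k: "\<kappa> = 2 powr (1/4) * 3 powr (-1/8)"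
    unfolding \<kappa>_def s powr_divide powr_powr by simp
  have four: "(4::real) powr (-1/4) = 2 powr (-1/2)"
    using powr_powr[of "2::real" 2 "-1/4"] by simp
  have "2 powr (5/4) * 3 powr (-3/8) * (4 powr (-1/4) * (\<kappa> * (sqrt 3 / 2))) =
     (2 powr (5/4) * 2 powr (-1/2) * 2 powr (1/4)) * (3 powr (-3/8) * 3 powr (-1/8) * 3 powr (1/2)) / (2::real)"
    unfolding k s four by simp
  also have "\<dots> = 1" unfolding powr_add[symmetric] by simp
  finally show "2 powr (5/4) * 3 powr (-3/8) * (4 powr (-1/4) * (\<kappa> * (sqrt 3 / 2))) = 1" .
  have "2 powr (-1/4) * 3 powr (-3/8) * (4 powr (-1/4) * (\<kappa> * (2 * sqrt 3 / sqrt 2))) =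
     (2 powr (-1/4) * 2 powr (-1/2) * 2 powr (1/4) * 2 powr 1 / 2 powr (1/2)) *
       (3 powr (-3/8) * 3 powr (-1/8) * 3 powr (1/2) :: real)"
    unfolding k s four by simp
  also have "\<dots> = 1" unfolding powr_add[symmetric] powr_diff[symmetric] by simp
  finally show "2 powr (-1/4) * 3 powr (-3/8) * (4 powr (-1/4) * (\<kappa> * (2 * sqrt 3 / sqrt 2))) = 1" .
qed

lemma branch_factorization:
  assumes "\<xi> > 0"
  defines "h \<equiv> exp (\<xi> / 3)" and "w \<equiv> exp (- 2 * \<xi> / 3)"
  shows "sinh \<xi> powr (1/4) * A_plus \<xi> powr (1/4) = h * 4 powr (-1/4) * root_k 1 w"
    and "sinh \<xi> powr (1/4) * A_minus \<xi> powr (1/4) = h * 4 powr (-1/4) * root_k (-1) w"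
    and "0 < w" "w < 1"
proof -
  show w: "0 < w" "w < 1" using assms(1) by (simp_all add: w_def)
  have h: "h > 0" by (simp add: h_def)
  have hw: "exp (- (\<xi> / 3)) = h * w" "h * h * w = 1" "exp (- \<xi>) = h ^ 3 * w ^ 3" "exp \<xi> = h ^ 3"
    by (simp_all add: h_def w_def flip: exp_add exp_of_nat_mult)
  have c: "cosh (\<xi> / 3) = h * (1 + w) / 2" by (simp add: cosh_def hw(1) algebra_simps flip: h_def)
  have s: "sinh \<xi> = h ^ 3 * (1 - w ^ 3) / 2" by (simp add: sinh_def hw(3,4) algebra_simps)
  have "(4 * (cosh (\<xi> / 3))\<^sup>2 - 1) / 3 = (h * root_Y w / 3)\<^sup>2"
  proof -
    have "4 * (cosh (\<xi> / 3))\<^sup>2 - 1 = (h * (1 + w))\<^sup>2 - h * h * w" unfolding c hw(2) by (simp add: power2_eq_square)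
    also have "\<dots> = h\<^sup>2 * (1 + w + w\<^sup>2)" by (simp add: power2_eq_square algebra_simps)
    finally show ?thesis unfolding power_divide power_mult_distrib root_Y(2) by simp
  qed
  then have "sqrt ((4 * (cosh (\<xi> / 3))\<^sup>2 - 1) / 3) = h * root_Y w / 3"
    using h root_Y(1)[of w] by simp
  then have A: "A_plus \<xi> = h * root_B 1 w / 2" "A_minus \<xi> = h * root_B (-1) w / 2"
    unfolding A_plus_def A_minus_def c root_B_def by (simp_all add: field_simps)
  have cube: "1 - w ^ 3 > 0" using cube_less_one[of w] w by simp
  have "sinh \<xi> powr (1/4) * (h * B / 2) powr (1/4) = h * 4 powr (-1/4) * ((1 - w ^ 3) * B) powr (1/4)" if B: "B > 0" for B
  proof -
    have "sinh \<xi> powr (1/4) * (h * B / 2) powr (1/4) = (h ^ 3 * (1 - w ^ 3) / 2 * (h * B / 2)) powr (1/4)"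
      unfolding s by (rule powr_mult [symmetric])
    also have "h ^ 3 * (1 - w ^ 3) / 2 * (h * B / 2) = h ^ 4 * (1 / 4) * ((1 - w ^ 3) * B)"
      by (simp add: power_numeral_reduce)
    also have "\<dots> powr (1/4) = (h ^ 4) powr (1/4) * (1/4) powr (1/4) * ((1 - w ^ 3) * B) powr (1/4)"
      by (simp only: powr_mult mult.assoc)
    also have "(h ^ 4) powr (1/4) = h" by (rule fourth_root_power[OF h])
    also have "(1/4) powr (1/4) = (4 powr (-1/4) :: real)" by (simp add: powr_divide powr_minus_divide)
    finally show ?thesis .
  qed
  from this[OF root_B_pos[of 1 w]] this[OF root_B_pos[of "-1" w]] w
  show "sinh \<xi> powr (1/4) * A_plus \<xi> powr (1/4) = h * 4 powr (-1/4) * root_k 1 w"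
    "sinh \<xi> powr (1/4) * A_minus \<xi> powr (1/4) = h * 4 powr (-1/4) * root_k (-1) w"
    unfolding A root_k_def by simp_all
qed

lemma legendre_base:
  assumes "\<xi> > 0"
  defines "h \<equiv> exp (\<xi> / 3)" and "w \<equiv> exp (- 2 * \<xi> / 3)"
  shows "legendre_fam1 0 0 \<xi> = of_real (h * (1 / (2 powr (5/4) * 3 powr (-3/8)))) * sol2 (of_real w)"
    and "legendre_fam2 0 0 \<xi> = of_real (h * (1 / (2 powr (-1/4) * 3 powr (-3/8)))) * sol1 (of_real w)"
proof -
  have w3: "w ^ 3 = exp (- 2 * \<xi>)" by (simp add: w_def flip: exp_of_nat_mult)
  have q: "exp (- 2 * complex_of_real \<xi>) = of_real w ^ 3"
    using arg_cong[OF w3, of complex_of_real] by (simp flip: exp_of_real)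
  have e1: "exp ((1/3) * complex_of_real \<xi>) = of_real h" by (simp add: h_def flip: exp_of_real)
  have "h * w = exp (- (\<xi> / 3))" by (simp add: h_def w_def flip: exp_add)
  then have e2: "exp ((-1/3) * complex_of_real \<xi>) = of_real (h * w)" by (simp flip: exp_of_real)
  have G: "Gamma (2/3 :: real) \<noteq> 0" "Gamma (4/3 :: real) \<noteq> 0"
    using less_imp_neq[OF Gamma_real_pos[of "2/3"]] less_imp_neq[OF Gamma_real_pos[of "4/3"]] by auto
  have Gc: "Gamma (1 - 1/3) = complex_of_real (Gamma (2/3))" "Gamma (1 - (-1/3)) = complex_of_real (Gamma (4/3))"
    using Gamma_complex_of_real[of "2/3"] Gamma_complex_of_real[of "4/3"] by simp_all
  have pars: "- (-3/4) = (3/4 :: complex)" "- (1/3) - (-3/4) = (5/12 :: complex)" "1 - 1/3 = (2/3 :: complex)"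
     "- (-1/3) - (-3/4) = (13/12 :: complex)" "1 - (-1/3) = (4/3 :: complex)" by simp_all
  have "legendre_q (-3/4) (-1/3) (of_real \<xi>) = of_real h * sol2 (of_real w) / of_real (Gamma (4/3))"
    unfolding legendre_q_def q e2 Gc unfolding pars sol2_def by simp
  moreover have "legendre_const1 0 0 = 2 powr (5/4) * 3 powr (-3/8) / Gamma (4/3)"
    by (simp add: legendre_const1_def rising_factorial_def inverse_eq_divide)
  ultimately show "legendre_fam1 0 0 \<xi> = of_real (h * (1 / (2 powr (5/4) * 3 powr (-3/8)))) * sol2 (of_real w)"
    using G by (simp add: legendre_fam1_def)
  have "legendre_q (-3/4) (1/3) (of_real \<xi>) = of_real h * sol1 (of_real w) / of_real (Gamma (2/3))"
    unfolding legendre_q_def q e1 Gc unfolding pars sol1_def by simp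
  moreover have "legendre_const2 0 0 = 2 powr (-1/4) * 3 powr (-3/8) / Gamma (2/3)"
    by (simp add: legendre_const2_def rising_factorial_def inverse_eq_divide)
  ultimately show "legendre_fam2 0 0 \<xi> = of_real (h * (1 / (2 powr (-1/4) * 3 powr (-3/8)))) * sol1 (of_real w)"
    using G by (simp add: legendre_fam2_def)
qed

lemma legendre_fam_eq:
  assumes "\<xi> > 0"
  shows "legendre_fam1 m n \<xi> = of_real (sqrt (sqrt 3 - 1)) * branch_plus.E m n \<xi> +
    of_real (- sqrt (sqrt 3 + 1)) * branch_minus.E m n \<xi>" (is ?fam1)
    and "legendre_fam2 m n \<xi> = of_real (sqrt (sqrt 3 + 1)) * branch_plus.E m n \<xi> +
      of_real (sqrt (sqrt 3 - 1)) * branch_minus.E m n \<xi>" (is ?fam2)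
proof -
  define \<kappa> where "\<kappa> = (2 / sqrt (3::real)) powr (1/4)"
  note init = root_init[folded \<kappa>_def] and vals = const_values[folded \<kappa>_def]
  have inv: "y = 1 / x" if "x * y = 1" for x y :: real
    using that by (cases "x = 0") (simp_all add: nonzero_eq_divide_eq mult.commute)
  have E0: "of_real a * branch_plus.E 0 0 \<xi> + of_real b * branch_minus.E 0 0 \<xi> =
     of_real (exp (\<xi> / 3) * 4 powr (-1/4)) * complex_of_real
       (a * root_k 1 (exp (- 2 * \<xi> / 3)) + b * root_k (-1) (exp (- 2 * \<xi> / 3)))"
    if "\<xi> > 0" for \<xi> a b
    using branch_factorization(1,2)[OF that] that
    unfolding branch_plus.E_def branch_minus.E_def branch_plus.pref_def branch_minus.pref_def
    by (simp add: octahedral_r_base branch_plus.U_dom[simplified] branch_minus.U_dom[simplified] algebra_simps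
      flip: of_real_mult)
  have base1: "legendre_fam1 0 0 \<xi> =
    of_real (sqrt (sqrt 3 - 1)) * branch_plus.E 0 0 \<xi> + of_real (- sqrt (sqrt 3 + 1)) * branch_minus.E 0 0 \<xi>"
    if \<xi>: "\<xi> > 0" for \<xi>
  proof -
    define w where "w = exp (- 2 * \<xi> / 3)"
    have w: "-1 < w" "w < 1" using branch_factorization(3,4)[OF \<xi>] unfolding w_def by linarith+
    have i1: "sqrt (sqrt 3 - 1) * root_k 1 0 + - sqrt (sqrt 3 + 1) * root_k (-1) 0 = 0" using init by simp
    have "sqrt (sqrt 3 - 1) * (root_k 1 0 * root_l 1 0) + - sqrt (sqrt 3 + 1) * (root_k (-1) 0 * root_l (-1) 0)
        = (sqrt (sqrt 3 - 1) * root_k 1 0) * root_l 1 0 - (sqrt (sqrt 3 + 1) * root_k (-1) 0) * root_l (-1) 0" by simp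
    also have "\<dots> = \<kappa> * (sqrt 3 / 2)" unfolding init by (simp add: field_simps)
    finally have i2: "sqrt (sqrt 3 - 1) * (root_k 1 0 * root_l 1 0) +
      - sqrt (sqrt 3 + 1) * (root_k (-1) 0 * root_l (-1) 0) = \<kappa> * (sqrt 3 / 2)" .
    show ?thesis
      unfolding E0[OF \<xi>] legendre_base(1)[OF \<xi>] w_def[symmetric] root_k_solution[OF w] i1 i2 inv[OF vals(1), symmetric]
      by simp
  qed
  have base2: "legendre_fam2 0 0 \<xi> =
    of_real (sqrt (sqrt 3 + 1)) * branch_plus.E 0 0 \<xi> + of_real (sqrt (sqrt 3 - 1)) * branch_minus.E 0 0 \<xi>"
    if \<xi>: "\<xi> > 0" for \<xi>
  proof -
    define w where "w = exp (- 2 * \<xi> / 3)"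
    have w: "-1 < w" "w < 1" using branch_factorization(3,4)[OF \<xi>] unfolding w_def by linarith+
    have i1: "sqrt (sqrt 3 + 1) * root_k 1 0 + sqrt (sqrt 3 - 1) * root_k (-1) 0 = \<kappa> * (2 * sqrt 3 / sqrt 2)"
      unfolding init by (simp add: field_simps)
    have "sqrt (sqrt 3 + 1) * (root_k 1 0 * root_l 1 0) + sqrt (sqrt 3 - 1) * (root_k (-1) 0 * root_l (-1) 0)
        = (sqrt (sqrt 3 + 1) * root_k 1 0) * root_l 1 0 + (sqrt (sqrt 3 - 1) * root_k (-1) 0) * root_l (-1) 0" by simp
    also have "\<dots> = 0" unfolding init by (simp add: field_simps)
    finally have i2: "sqrt (sqrt 3 + 1) * (root_k 1 0 * root_l 1 0) +
      sqrt (sqrt 3 - 1) * (root_k (-1) 0 * root_l (-1) 0) = 0" .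
    show ?thesis
      unfolding E0[OF \<xi>] legendre_base(2)[OF \<xi>] w_def[symmetric] root_k_solution[OF w] i1 i2 inv[OF vals(2), symmetric]
      by simp
  qed
  show ?fam1
    by (rule oct_family_unique[OF oct_family_legendre1 oct_family_lincomb[OF branch_plus.E_family branch_minus.E_family]])
      (use base1 assms in auto)
  show ?fam2
    by (rule oct_family_unique[OF oct_family_legendre2 oct_family_lincomb[OF branch_plus.E_family branch_minus.E_family]])
      (use base2 assms in auto)
qed

theorem theorem4p2:
  fixes n m :: int and \<xi> :: real
  assumes "\<xi> > 0"
  shows "A_plus \<xi> > 0 \<and> A_minus \<xi> > 0 \<and>
    legendre_P (-3/4 - of_int m) (-1/3 - of_int n) (coth \<xi>) =
      of_real ((-1) powi n * 2 powr (5/4 - 2 * of_int m - 3 * of_int n) * 3 powr (-3/8) *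
        rising_factorial (1/4) m * inverse (rising_factorial (13/12) (m + n)) *
        inverse (Gamma (4/3))) *
      of_real (sinh \<xi> powr (1/4 - of_int m)) *
      ((-1) powi n * of_real (sqrt (sqrt 3 - 1) * A_plus \<xi> powr (1/4 + 3 * of_int m + 3 * of_int n)) *
          octahedral_r m n (of_real (- (A_minus \<xi> / A_plus \<xi>)))
       - (-1) powi m * of_real (sqrt (sqrt 3 + 1) * A_minus \<xi> powr (1/4 + 3 * of_int m + 3 * of_int n)) *
          octahedral_r m n (of_real (- (A_plus \<xi> / A_minus \<xi>)))) \<and>
    legendre_P (-3/4 - of_int m) (1/3 + of_int n) (coth \<xi>) =
      of_real ((-1) powi n * 2 powr (-1/4 - 2 * of_int m - 3 * of_int n) * 3 powr (-3/8) *
        rising_factorial (1/4) m * inverse (rising_factorial (5/12) (m - n)) *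
        inverse (Gamma (2/3))) *
      of_real (sinh \<xi> powr (1/4 - of_int m)) *
      ((-1) powi n * of_real (sqrt (sqrt 3 + 1) * A_plus \<xi> powr (1/4 + 3 * of_int m + 3 * of_int n)) *
          octahedral_r m n (of_real (- (A_minus \<xi> / A_plus \<xi>)))
       + (-1) powi m * of_real (sqrt (sqrt 3 - 1) * A_minus \<xi> powr (1/4 + 3 * of_int m + 3 * of_int n)) *
          octahedral_r m n (of_real (- (A_plus \<xi> / A_minus \<xi>))))"
proof -
  note A = A_facts[OF assms]
  have ni: "-3/4 - complex_of_int m \<notin> \<int>" "1/3 + complex_of_int n \<notin> \<int>" "(1/3 + of_int n) + (-3/4 - complex_of_int m) \<notin> \<int>"
    "-1/3 - complex_of_int n \<notin> \<int>" "(-1/3 - of_int n) + (-3/4 - complex_of_int m) \<notin> \<int>"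
    using legendre_params_nonint(1)[of m] legendre_params_nonint(2)[of n] legendre_params_nonint(3)[of m n]
      legendre_params_nonint(5)[of n] legendre_params_nonint(6)[of m n] by (simp_all only: add.commute not_False_eq_True)
  have sgn: "(-1) powi n * (-1) powi n = (1 :: complex)" "(-1) powi n * (-1) powi m = ((-1) powi (m + n) :: complex)"
    by (simp_all add: power_int_add flip: power_int_mult_distrib)
  have factor: "of_real ((-1) powi n * M * T * F * G * H) * of_real S *
        ((-1) powi n * of_real (x * X) * p + (-1) powi m * of_real (y * Y) * q) =
      of_real (M * T * F * G * H) *
        (of_real x * (of_real (1 powi (m + n) * (S * X)) * p) + of_real y * (of_real ((-1) powi (m + n) * (S * Y)) * q))"
    for M T F G H S x y X Y :: real and p q :: complex
  proof -
    have "of_real ((-1) powi n * M * T * F * G * H) * of_real S *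
        ((-1) powi n * of_real (x * X) * p + (-1) powi m * of_real (y * Y) * q) =
      of_real (M * T * F * G * H) * (((-1) powi n * (-1) powi n) * (of_real x * (of_real S * of_real X * p)) +
        ((-1) powi n * (-1) powi m) * (of_real y * (of_real S * of_real Y * q)))"
      by (simp add: algebra_simps)
    then show ?thesis unfolding sgn by (simp add: mult_ac)
  qed
  have factor_minus: "of_real ((-1) powi n * M * T * F * G * H) * of_real S *
        ((-1) powi n * of_real (x * X) * p - (-1) powi m * of_real (y * Y) * q) =
      of_real (M * T * F * G * H) *
        (of_real x * (of_real (1 powi (m + n) * (S * X)) * p) + of_real (- y) * (of_real ((-1) powi (m + n) * (S * Y)) * q))"
    for M T F G H S x y X Y :: real and p q :: complex
    using factor[where q = "- q"] by simp
  have P1: "legendre_P (-3/4 - of_int m) (-1/3 - of_int n) (coth \<xi>) = of_real (legendre_const1 m n) * legendre_fam1 m n \<xi>"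
    unfolding legendre_P_coth[OF ni(1,4,5) assms] legendre_fam1_def using legendre_const1_rec(3)[of m n] by simp
  have P2: "legendre_P (-3/4 - of_int m) (1/3 + of_int n) (coth \<xi>) = of_real (legendre_const2 m n) * legendre_fam2 m n \<xi>"
    unfolding legendre_P_coth[OF ni(1,2,3) assms] legendre_fam2_def using legendre_const2_rec(3)[of m n] by simp
  show ?thesis
  proof (intro conjI A)
    show "legendre_P (-3/4 - of_int m) (-1/3 - of_int n) (coth \<xi>) =
      of_real ((-1) powi n * 2 powr (5/4 - 2 * of_int m - 3 * of_int n) * 3 powr (-3/8) *
        rising_factorial (1/4) m * inverse (rising_factorial (13/12) (m + n)) *
        inverse (Gamma (4/3))) *
      of_real (sinh \<xi> powr (1/4 - of_int m)) *
      ((-1) powi n * of_real (sqrt (sqrt 3 - 1) * A_plus \<xi> powr (1/4 + 3 * of_int m + 3 * of_int n)) *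
          octahedral_r m n (of_real (- (A_minus \<xi> / A_plus \<xi>)))
       - (-1) powi m * of_real (sqrt (sqrt 3 + 1) * A_minus \<xi> powr (1/4 + 3 * of_int m + 3 * of_int n)) *
          octahedral_r m n (of_real (- (A_plus \<xi> / A_minus \<xi>))))"
      unfolding P1 legendre_fam_eq(1)[OF assms] legendre_const1_def branch_plus.E_def branch_minus.E_def
        branch_plus.pref_def branch_minus.pref_def
      by (rule factor_minus[symmetric])
    show "legendre_P (-3/4 - of_int m) (1/3 + of_int n) (coth \<xi>) =
      of_real ((-1) powi n * 2 powr (-1/4 - 2 * of_int m - 3 * of_int n) * 3 powr (-3/8) *
        rising_factorial (1/4) m * inverse (rising_factorial (5/12) (m - n)) *
        inverse (Gamma (2/3))) *
      of_real (sinh \<xi> powr (1/4 - of_int m)) *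
      ((-1) powi n * of_real (sqrt (sqrt 3 + 1) * A_plus \<xi> powr (1/4 + 3 * of_int m + 3 * of_int n)) *
          octahedral_r m n (of_real (- (A_minus \<xi> / A_plus \<xi>)))
       + (-1) powi m * of_real (sqrt (sqrt 3 - 1) * A_minus \<xi> powr (1/4 + 3 * of_int m + 3 * of_int n)) *
          octahedral_r m n (of_real (- (A_plus \<xi> / A_minus \<xi>))))"
      unfolding P2 legendre_fam_eq(2)[OF assms] legendre_const2_def branch_plus.E_def branch_minus.E_def
        branch_plus.pref_def branch_minus.pref_def
      by (rule factor[symmetric])
  qed
qed

end
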